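(* The one-to-one correspondence $(H,R)\leftrightarrow(\mathcal{H},\mathcal{R},g)$ between isomorphism classes of triangular Hopf algebras with Drinfeld element of square $1$ and isomorphism classes of triangular Hopf superalgebras $(\mathcal{H},\mathcal{R})$ with Drinfeld element $1$ together with a grouplike $g\in\mathcal{H}$ satisfying $g^2=1$ and $gxg^{-1}=(-1)^{p(x)}x$ (described in the context) restricts to a one-to-one correspondence between: (1) isomorphism classes of triangular Hopf algebras over $\mathbb{C}$ with $R$-matrix of rank $\le 2$; and (2) isomorphism classes of pairs $(\mathcal{H},g)$ where $\mathcal{H}$ is a cocommutative Hopf superalgebra over $\mathbb{C}$ (considered as triangular with $\mathcal{R}=1\otimes 1$) and $g$ is a grouplike element of $\mathcal{H}$ such that $g^2=1$ and $gxg^{-1}=(-1)^{p(x)}x$ for all homogeneous $x\in\mathcal{H}$.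
   Context: The ground field is $\mathbb{C}$. Supervector spaces are $\mathbb{Z}_2$-graded vector spaces $V=V_0\oplus V_1$ with parity $p$ and commutativity constraint $\beta(v\otimes w)=(-1)^{p(v)p(w)}w\otimes v$. A Hopf superalgebra is a Hopf algebra in this symmetric tensor category; in particular the product on $\mathcal{H}\otimes\mathcal{H}$ is $(a\otimes b)(a'\otimes b')=(-1)^{p(a')p(b)}aa'\otimes bb'$. It is cocommutative if $\Delta=\beta\circ\Delta$. A (quasi)triangular Hopf superalgebra is a Hopf superalgebra with an even $\mathcal{R}\in\mathcal{H}\otimes\mathcal{H}$ satisfying the usual (quasi)triangularity axioms interpreted in this category (triangular: $\mathcal{R}\mathcal{R}_{21}=1$, with $\mathcal{R}_{21}=\beta(\mathcal{R})$). Its Drinfeld element is $m\circ\beta\circ(\mathrm{Id}\otimes S)(\mathcal{R})$; for ordinary Hopf algebras $\beta$ is replaced by the flip. The rank of an $R$-matrix is the dimension of the minimal part, i.e. of the Hopf subalgebra generated by its tensorands. For an ordinary triangular Hopf algebra, rank $\le 2$ means equivalently that $R=R_u:=\frac12(1\otimes 1+1\otimes u+u\otimes 1-u\otimes u)$ with $u$ a grouplike element of order $\le 2$. The correspondence: given a triangular Hopf algebra $(H,R)$ with Drinfeld element $u$, $u^2=1$, put $\mathcal{H}=H$ as an algebra, graded by the adjoint action of $u$ (so $uxu^{-1}=(-1)^{p(x)}x$), and $g=u$. Write $\Delta(h)=\Delta_0(h)+\Delta_1(h)$ with $\Delta_i(h)\in H\otimes H_i$, and set $\tilde\Delta(h)=\Delta_0(h)-(-1)^{p(h)}(u\otimes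 1)\Delta_1(h)$, $\tilde S(h)=u^{p(h)}S(h)$, same counit. Write $R=R_0+R_1$ with $R_i\in H_i\otimes H_i$ and put $\mathcal{R}=(R_0+(1\otimes u)R_1)R_u$ (products computed in the ordinary algebra $H\otimes H$). The inverse assignment is given by the same formulas: $\Delta(h)=\tilde\Delta_0(h)-(-1)^{p(h)}(g\otimes 1)\tilde\Delta_1(h)$, $S(h)=g^{p(h)}\tilde S(h)$, $R=(\mathcal{R}_0+(1\otimes g)\mathcal{R}_1)R_g$, $u=g$. *)

theory Defs
  imports Complex_Main "HOL-Library.Function_Algebras" "HOL-Library.Extended_Nat"
begin

section \<open>Complex vector spaces\<close>

class complex_vector = ab_group_add +
  fixes scaleC :: "complex \<Rightarrow> 'a \<Rightarrow> 'a"  (infixr "*\<^sub>C" 75)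
  assumes scaleC_add_right: "a *\<^sub>C (x + y) = a *\<^sub>C x + a *\<^sub>C y"
    and scaleC_add_left: "(a + b) *\<^sub>C x = a *\<^sub>C x + b *\<^sub>C x"
    and scaleC_scaleC: "a *\<^sub>C b *\<^sub>C x = (a * b) *\<^sub>C x"
    and scaleC_one: "1 *\<^sub>C x = x"

interpretation cvec: vector_space "scaleC :: complex \<Rightarrow> 'a::complex_vector \<Rightarrow> 'a"
  by unfold_locales (simp_all add: scaleC_add_right scaleC_add_left scaleC_scaleC scaleC_one)

instantiation complex :: complex_vector
begin
definition scaleC_complex :: "complex \<Rightarrow> complex \<Rightarrow> complex"
  where "scaleC_complex a x = a * x"
instance by standard (simp_all add: scaleC_complex_def algebra_simps)
end

instantiation "fun" :: (type, complex_vector) complex_vector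
begin
definition scaleC_fun :: "complex \<Rightarrow> ('a \<Rightarrow> 'b) \<Rightarrow> 'a \<Rightarrow> 'b"
  where "scaleC_fun a f = (\<lambda>x. a *\<^sub>C f x)"
instance
  by standard
    (simp_all add: scaleC_fun_def fun_eq_iff scaleC_add_right scaleC_add_left scaleC_scaleC scaleC_one)
end

interpretation cvec_pair: vector_space_pair
  "scaleC :: complex \<Rightarrow> 'a::complex_vector \<Rightarrow> 'a"
  "scaleC :: complex \<Rightarrow> 'b::complex_vector \<Rightarrow> 'b"
  by unfold_locales

definition linear_on :: "'a::complex_vector set \<Rightarrow> ('a \<Rightarrow> 'b::complex_vector) \<Rightarrow> bool" where
  "linear_on V f \<longleftrightarrow>
     (\<forall>x\<in>V. \<forall>y\<in>V. f (x + y) = f x + f y) \<and> (\<forall>c. \<forall>x\<in>V. f (c *\<^sub>C x) = c *\<^sub>C f x)"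

definition bilinear_on ::
  "'a::complex_vector set \<Rightarrow> 'b::complex_vector set \<Rightarrow> ('a \<Rightarrow> 'b \<Rightarrow> 'c::complex_vector) \<Rightarrow> bool" where
  "bilinear_on V W f \<longleftrightarrow>
     (\<forall>y\<in>W. linear_on V (\<lambda>x. f x y)) \<and> (\<forall>x\<in>V. linear_on W (f x))"

text \<open>The library's dimension of an infinite-dimensional space is 0, hence the extended version.\<close>

definition edim :: "'a::complex_vector set \<Rightarrow> enat" where
  "edim A = (if \<exists>B. finite B \<and> A \<subseteq> cvec.span B then enat (cvec.dim A) else \<infinity>)"


section \<open>Tensor products\<close>

text \<open>
  The algebraic tensor product of two subspaces \<open>V\<close> and \<open>W\<close> is realised inside the dual of the
  space of bilinear forms on \<open>V \<times> W\<close>, as the linear span of the evaluations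
  \<open>x \<otimes> y = (B \<mapsto> B x y)\<close>.
  Forms are functions on whole types; evaluating to 0 at a function that is not bilinear on
  \<open>V \<times> W\<close> makes equality of tensors the right one.
  Lemmas \<open>bilinear_on_tens\<close>, \<open>ex_lift\<close> and \<open>lift_unique\<close> are the universal property.
\<close>

type_synonym ('a, 'b) tensor = "('a \<Rightarrow> 'b \<Rightarrow> complex) \<Rightarrow> complex"

definition tens ::
  "'a::complex_vector set \<Rightarrow> 'b::complex_vector set \<Rightarrow> 'a \<Rightarrow> 'b \<Rightarrow> ('a, 'b) tensor" where
  "tens V W x y = (\<lambda>B. if bilinear_on V W B then B x y else 0)"

definition tensor ::
  "'a::complex_vector set \<Rightarrow> 'b::complex_vector set \<Rightarrow> ('a, 'b) tensor set" where
  "tensor V W = cvec.span {tens V W x y | x y. x \<in> V \<and> y \<in> W}"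

definition lift ::
  "'a::complex_vector set \<Rightarrow> 'b::complex_vector set \<Rightarrow> ('a \<Rightarrow> 'b \<Rightarrow> 'c::complex_vector)
     \<Rightarrow> ('a, 'b) tensor \<Rightarrow> 'c" where
  "lift V W F =
     (SOME L. linear_on (tensor V W) L \<and> (\<forall>x\<in>V. \<forall>y\<in>W. L (tens V W x y) = F x y))"

lemma bilinear_on_tens: "bilinear_on V W (tens V W)"
  by (auto simp: bilinear_on_def linear_on_def tens_def fun_eq_iff scaleC_fun_def)

lemma functionals_separate:
  fixes v w :: "'a::complex_vector"
  assumes sep: "\<And>f :: 'a \<Rightarrow> complex. Vector_Spaces.linear scaleC scaleC f \<Longrightarrow> f v = f w"
  shows "v = w"
proof (rule ccontr)
  assume "v \<noteq> w"
  then have "cvec.independent {v - w}" by simp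
  then have "\<exists>f :: 'a \<Rightarrow> complex. Vector_Spaces.linear scaleC scaleC f \<and> (\<forall>x\<in>{v - w}. f x = 1)"
    by (rule cvec_pair.linear_independent_extend)
  then obtain f :: "'a \<Rightarrow> complex"
    where f: "Vector_Spaces.linear scaleC scaleC f" and f1: "f (v - w) = 1" by blast
  have "f (v - w) = f v - f w"
    by (rule cvec_pair.linear_diff[OF f])
  then show False
    using sep[OF f] f1 by simp
qed

lemma ex_lift:
  fixes F :: "'a::complex_vector \<Rightarrow> 'b::complex_vector \<Rightarrow> 'c::complex_vector"
  assumes F: "bilinear_on V W F"
  shows "\<exists>L. linear_on (tensor V W) L \<and> (\<forall>x\<in>V. \<forall>y\<in>W. L (tens V W x y) = F x y)"
proof -
  define lin where "lin f \<longleftrightarrow> Vector_Spaces.linear scaleC scaleC f" for f :: "'c \<Rightarrow> complex"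
  define P where "P t v \<longleftrightarrow> (\<forall>f. lin f \<longrightarrow> f v = t (\<lambda>x y. f (F x y)))"
    for t :: "('a, 'b) tensor" and v
  have lin_add: "f (x + y) = f x + f y" if "lin f" for f x y
    using that unfolding lin_def by (rule cvec_pair.linear_add)
  have lin_scale: "f (c *\<^sub>C x) = c *\<^sub>C f x" if "lin f" for f c x
    using that unfolding lin_def by (rule cvec_pair.linear_scale)
  have bil: "bilinear_on V W (\<lambda>x y. f (F x y))" if "lin f" for f
    using F unfolding bilinear_on_def linear_on_def
    by (simp add: lin_add[OF that] lin_scale[OF that])
  have uniq: "v = w" if "P t v" "P t w" for t v w
  proof (rule functionals_separate)
    fix f :: "'c \<Rightarrow> complex"
    assume "Vector_Spaces.linear scaleC scaleC f"
    then have "f v = t (\<lambda>x y. f (F x y))" "f w = t (\<lambda>x y. f (F x y))"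
      using that unfolding P_def lin_def by blast+
    then show "f v = f w" by (rule trans[OF _ sym])
  qed
  have pure: "P (tens V W x y) (F x y)" for x y
    using bil by (simp add: P_def tens_def)
  have add: "P (s + t) (v + w)" if "P s v" "P t w" for s t v w
    using that by (simp add: P_def lin_add)
  have scale: "P (c *\<^sub>C t) (c *\<^sub>C v)" if "P t v" for c t v
    using that by (simp add: P_def lin_scale scaleC_fun_def)
  have zero: "P 0 0"
    using scale[OF pure, of 0] by simp
  define L where "L t = (THE v. P t v)" for t
  have L: "L t = v" if "P t v" for t v
    unfolding L_def by (rule the_equality) (fact that, rule uniq[OF _ that])
  have ex: "\<exists>v. P t v" if "t \<in> tensor V W" for t
    using that unfolding tensor_def
  proof (induction rule: cvec.span_induct_alt)
    case base
    show ?case using zero by blast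
  next
    case (step c s t)
    then obtain x y v where "s = tens V W x y" "P t v" by blast
    then have "P (c *\<^sub>C s + t) (c *\<^sub>C F x y + v)"
      using add[OF scale[OF pure]] by blast
    then show ?case by blast
  qed
  have PL: "P t (L t)" if t: "t \<in> tensor V W" for t
  proof -
    obtain v where v: "P t v" using ex[OF t] ..
    then show ?thesis by (simp only: L[OF v])
  qed
  have "linear_on (tensor V W) L"
    unfolding linear_on_def by (intro conjI ballI allI) (rule L, intro add scale PL, assumption+)+
  moreover have "\<forall>x\<in>V. \<forall>y\<in>W. L (tens V W x y) = F x y"
    by (intro ballI L pure)
  ultimately show ?thesis by blast
qed

lemma lift_unique:
  assumes lin: "linear_on (tensor V W) L" "linear_on (tensor V W) L'"
    and eq: "\<And>x y. x \<in> V \<Longrightarrow> y \<in> W \<Longrightarrow> L (tens V W x y) = L' (tens V W x y)"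
    and t: "t \<in> tensor V W"
  shows "L t = L' t"
proof -
  have 0: "0 \<in> tensor V W"
    unfolding tensor_def by (rule cvec.span_zero)
  have z: "M 0 = 0" if "linear_on (tensor V W) M" for M :: "_ \<Rightarrow> 'c"
  proof -
    have "M (0 *\<^sub>C 0) = 0 *\<^sub>C M 0"
      using that 0 unfolding linear_on_def by blast
    then show ?thesis by simp
  qed
  from t have "t \<in> cvec.span {tens V W x y | x y. x \<in> V \<and> y \<in> W}"
    unfolding tensor_def .
  then have "t \<in> tensor V W \<and> L t = L' t"
  proof (induction rule: cvec.span_induct_alt)
    case base
    show ?case
      by (intro conjI 0) (simp only: z[OF lin(1)] z[OF lin(2)])
  next
    case (step c s t)
    then obtain x y where xy: "s = tens V W x y" "x \<in> V" "y \<in> W" by blast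
    have s: "s \<in> tensor V W"
      unfolding tensor_def by (rule cvec.span_base) (use xy in blast)
    have cs: "c *\<^sub>C s \<in> tensor V W"
      using s unfolding tensor_def by (rule cvec.span_scale)
    have t: "t \<in> tensor V W"
      using step.IH ..
    have split: "M (c *\<^sub>C s + t) = c *\<^sub>C M s + M t"
      if "linear_on (tensor V W) M" for M :: "_ \<Rightarrow> 'c"
      using that s cs t unfolding linear_on_def by simp
    have "L s = L' s" "L t = L' t"
      using eq[OF xy(2,3)] xy(1) step.IH by blast+
    then have "L (c *\<^sub>C s + t) = L' (c *\<^sub>C s + t)"
      by (simp only: split[OF lin(1)] split[OF lin(2)])
    moreover have "c *\<^sub>C s + t \<in> tensor V W"
      using cs t unfolding tensor_def by (rule cvec.span_add)
    ultimately show ?case by blast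
  qed
  then show ?thesis ..
qed


section \<open>Hopf algebras in a symmetric tensor category\<close>

record 'a hopf =
  carr :: "'a set"
  mul :: "'a \<Rightarrow> 'a \<Rightarrow> 'a"
  unity :: 'a
  comul :: "'a \<Rightarrow> ('a, 'a) tensor"
  counit :: "'a \<Rightarrow> complex"
  antipode :: "'a \<Rightarrow> 'a"

text \<open>\<open>part K False\<close> and \<open>part K True\<close> are the even and the odd subspace.\<close>

record 'a hopf_super = "'a hopf" +
  part :: "bool \<Rightarrow> 'a set"

type_synonym 'a tensor2 = "('a, 'a) tensor"
type_synonym 'a tensor3 = "('a, 'a tensor2) tensor"

definition pure2 :: "('a::complex_vector, 'm) hopf_scheme \<Rightarrow> 'a \<Rightarrow> 'a \<Rightarrow> 'a tensor2" where
  "pure2 H = tens (carr H) (carr H)"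

definition tensor2 :: "('a::complex_vector, 'm) hopf_scheme \<Rightarrow> 'a tensor2 set" where
  "tensor2 H = tensor (carr H) (carr H)"

definition lift2 ::
  "('a::complex_vector, 'm) hopf_scheme \<Rightarrow> ('a \<Rightarrow> 'a \<Rightarrow> 'c::complex_vector) \<Rightarrow> 'a tensor2 \<Rightarrow> 'c" where
  "lift2 H = lift (carr H) (carr H)"

definition pure3 :: "('a::complex_vector, 'm) hopf_scheme \<Rightarrow> 'a \<Rightarrow> 'a \<Rightarrow> 'a \<Rightarrow> 'a tensor3" where
  "pure3 H x y z = tens (carr H) (tensor2 H) x (pure2 H y z)"

definition lift3 ::
  "('a::complex_vector, 'm) hopf_scheme \<Rightarrow> ('a \<Rightarrow> 'a \<Rightarrow> 'a \<Rightarrow> 'c::complex_vector) \<Rightarrow> 'a tensor3 \<Rightarrow> 'c" where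
  "lift3 H F = lift (carr H) (tensor2 H) (\<lambda>x. lift2 H (F x))"

text \<open>
  A symmetric braiding \<open>c\<close> enters through \<open>c x y\<close>, the image of \<open>x \<otimes> y\<close>. The products on
  the tensor square and the tensor cube move the factors of the right-hand argument past those of
  the left-hand one by means of \<open>c\<close>.
\<close>

type_synonym 'a braiding = "'a \<Rightarrow> 'a \<Rightarrow> 'a tensor2"

definition mul2 ::
  "'a::complex_vector braiding \<Rightarrow> ('a, 'm) hopf_scheme \<Rightarrow> 'a tensor2 \<Rightarrow> 'a tensor2 \<Rightarrow> 'a tensor2" where
  "mul2 c H s t =
     lift2 H (\<lambda>a b. lift2 H (\<lambda>a' b'.
       lift2 H (\<lambda>a1 b1. pure2 H (mul H a a1) (mul H b1 b')) (c b a')) t) s"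

definition mul3 ::
  "'a::complex_vector braiding \<Rightarrow> ('a, 'm) hopf_scheme \<Rightarrow> 'a tensor3 \<Rightarrow> 'a tensor3 \<Rightarrow> 'a tensor3" where
  "mul3 c H s t =
     lift3 H (\<lambda>x y z. lift3 H (\<lambda>x' y' z'.
       lift2 H (\<lambda>x1 z1. lift2 H (\<lambda>x2 y1. lift2 H (\<lambda>y2 z2.
         pure3 H (mul H x x2) (mul H y1 y2) (mul H z2 z')) (c z1 y')) (c y x1)) (c z x')) t) s"

definition hopf_in ::
  "'a::complex_vector braiding \<Rightarrow> ('a, 'm) hopf_scheme \<Rightarrow> bool" where
  "hopf_in c H \<longleftrightarrow>
     (let V = carr H; m = mul H; e = unity H; D = comul H; \<epsilon> = counit H; S = antipode H in
       cvec.subspace V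
       \<comment> \<open>algebra\<close>
     \<and> bilinear_on V V m \<and> (\<forall>x\<in>V. \<forall>y\<in>V. m x y \<in> V) \<and> e \<in> V
     \<and> (\<forall>x\<in>V. \<forall>y\<in>V. \<forall>z\<in>V. m (m x y) z = m x (m y z))
     \<and> (\<forall>x\<in>V. m e x = x \<and> m x e = x)
       \<comment> \<open>coalgebra\<close>
     \<and> linear_on V D \<and> (\<forall>x\<in>V. D x \<in> tensor2 H) \<and> linear_on V \<epsilon>
     \<and> (\<forall>h\<in>V. lift2 H (\<lambda>x y. lift2 H (\<lambda>a b. pure3 H a b y) (D x)) (D h)
              = lift2 H (\<lambda>x y. lift2 H (\<lambda>a b. pure3 H x a b) (D y)) (D h))
     \<and> (\<forall>h\<in>V. lift2 H (\<lambda>x y. \<epsilon> x *\<^sub>C y) (D h) = h \<and> lift2 H (\<lambda>x y. \<epsilon> y *\<^sub>C x) (D h) = h)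
       \<comment> \<open>compatibility\<close>
     \<and> D e = pure2 H e e \<and> (\<forall>x\<in>V. \<forall>y\<in>V. D (m x y) = mul2 c H (D x) (D y))
     \<and> \<epsilon> e = 1 \<and> (\<forall>x\<in>V. \<forall>y\<in>V. \<epsilon> (m x y) = \<epsilon> x * \<epsilon> y)
       \<comment> \<open>antipode\<close>
     \<and> linear_on V S \<and> (\<forall>x\<in>V. S x \<in> V)
     \<and> (\<forall>h\<in>V. lift2 H (\<lambda>x y. m (S x) y) (D h) = \<epsilon> h *\<^sub>C e
            \<and> lift2 H (\<lambda>x y. m x (S y)) (D h) = \<epsilon> h *\<^sub>C e))"

definition quasitriangular_in ::
  "'a::complex_vector braiding \<Rightarrow> ('a, 'm) hopf_scheme \<Rightarrow> 'a tensor2 \<Rightarrow> bool" where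
  "quasitriangular_in c H R \<longleftrightarrow>
     (let e = unity H; D = comul H;
          R12 = lift2 H (\<lambda>x y. pure3 H x y e) R;
          R13 = lift2 H (\<lambda>x y. pure3 H x e y) R;
          R23 = lift2 H (\<lambda>x y. pure3 H e x y) R in
       R \<in> tensor2 H
     \<and> (\<exists>Q\<in>tensor2 H. mul2 c H R Q = pure2 H e e \<and> mul2 c H Q R = pure2 H e e)
     \<and> (\<forall>h\<in>carr H. mul2 c H (lift2 H c (D h)) R = mul2 c H R (D h))
     \<and> lift2 H (\<lambda>x y. lift2 H (\<lambda>a b. pure3 H a b y) (D x)) R = mul3 c H R13 R23
     \<and> lift2 H (\<lambda>x y. lift2 H (\<lambda>a b. pure3 H x a b) (D y)) R = mul3 c H R13 R12)"

definition triangular_in ::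
  "'a::complex_vector braiding \<Rightarrow> ('a, 'm) hopf_scheme \<Rightarrow> 'a tensor2 \<Rightarrow> bool" where
  "triangular_in c H R \<longleftrightarrow>
     quasitriangular_in c H R \<and> mul2 c H R (lift2 H c R) = pure2 H (unity H) (unity H)"

definition drinfeld_in ::
  "'a::complex_vector braiding \<Rightarrow> ('a, 'm) hopf_scheme \<Rightarrow> 'a tensor2 \<Rightarrow> 'a" where
  "drinfeld_in c H R =
     lift2 H (mul H) (lift2 H c (lift2 H (\<lambda>x y. pure2 H x (antipode H y)) R))"

definition grouplike :: "('a::complex_vector, 'm) hopf_scheme \<Rightarrow> 'a \<Rightarrow> bool" where
  "grouplike H g \<longleftrightarrow> g \<in> carr H \<and> g \<noteq> 0 \<and> comul H g = pure2 H g g"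

definition inverse_in :: "('a::complex_vector, 'm) hopf_scheme \<Rightarrow> 'a \<Rightarrow> 'a" where
  "inverse_in H g = (THE k. k \<in> carr H \<and> mul H g k = unity H \<and> mul H k g = unity H)"

definition conjugate :: "('a::complex_vector, 'm) hopf_scheme \<Rightarrow> 'a \<Rightarrow> 'a \<Rightarrow> 'a" where
  "conjugate H g x = mul H (mul H g x) (inverse_in H g)"

definition hopf_iso ::
  "('a::complex_vector, 'm) hopf_scheme \<Rightarrow> ('a, 'n) hopf_scheme \<Rightarrow> ('a \<Rightarrow> 'a) \<Rightarrow> bool" where
  "hopf_iso H H' \<phi> \<longleftrightarrow>
     linear_on (carr H) \<phi> \<and> bij_betw \<phi> (carr H) (carr H')
   \<and> (\<forall>x\<in>carr H. \<forall>y\<in>carr H. \<phi> (mul H x y) = mul H' (\<phi> x) (\<phi> y)) \<and> \<phi> (unity H) = unity H'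
   \<and> (\<forall>x\<in>carr H. comul H' (\<phi> x) = lift2 H (\<lambda>a b. pure2 H' (\<phi> a) (\<phi> b)) (comul H x))
   \<and> (\<forall>x\<in>carr H. counit H' (\<phi> x) = counit H x)
   \<and> (\<forall>x\<in>carr H. \<phi> (antipode H x) = antipode H' (\<phi> x))"


section \<open>Triangular Hopf algebras and the rank of an R-matrix\<close>

definition flip :: "('a::complex_vector, 'm) hopf_scheme \<Rightarrow> 'a braiding" where
  "flip H x y = pure2 H y x"

definition triangular_hopf_algebra :: "'a::complex_vector hopf \<Rightarrow> 'a tensor2 \<Rightarrow> bool" where
  "triangular_hopf_algebra H R \<longleftrightarrow> hopf_in (flip H) H \<and> triangular_in (flip H) H R"

definition drinfeld :: "'a::complex_vector hopf \<Rightarrow> 'a tensor2 \<Rightarrow> 'a" where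
  "drinfeld H R = drinfeld_in (flip H) H R"

definition tensorands :: "'a::complex_vector hopf \<Rightarrow> 'a tensor2 \<Rightarrow> 'a set" where
  "tensorands H R =
     {lift2 H (\<lambda>x y. f y *\<^sub>C x) R | f. linear_on (carr H) f}
   \<union> {lift2 H (\<lambda>x y. f x *\<^sub>C y) R | f. linear_on (carr H) f}"

definition hopf_subalgebra :: "'a::complex_vector hopf \<Rightarrow> 'a set \<Rightarrow> bool" where
  "hopf_subalgebra H A \<longleftrightarrow>
     cvec.subspace A \<and> A \<subseteq> carr H \<and> unity H \<in> A
   \<and> (\<forall>x\<in>A. \<forall>y\<in>A. mul H x y \<in> A) \<and> (\<forall>x\<in>A. antipode H x \<in> A)
   \<and> (\<forall>x\<in>A. comul H x \<in> cvec.span {pure2 H a b | a b. a \<in> A \<and> b \<in> A})"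

definition minimal_part :: "'a::complex_vector hopf \<Rightarrow> 'a tensor2 \<Rightarrow> 'a set" where
  "minimal_part H R = \<Inter> {A. hopf_subalgebra H A \<and> tensorands H R \<subseteq> A}"

definition R_rank :: "'a::complex_vector hopf \<Rightarrow> 'a tensor2 \<Rightarrow> enat" where
  "R_rank H R = edim (minimal_part H R)"


section \<open>Triangular Hopf superalgebras\<close>

definition psign :: "bool \<Rightarrow> complex" where
  "psign p = (if p then - 1 else 1)"

definition hcomp :: "(bool \<Rightarrow> 'a::complex_vector set) \<Rightarrow> bool \<Rightarrow> 'a \<Rightarrow> 'a" where
  "hcomp P p x = (THE y. y \<in> P p \<and> x - y \<in> P (\<not> p))"

definition superflip :: "'a::complex_vector hopf_super \<Rightarrow> 'a braiding" where
  "superflip K x y =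
     (\<Sum>p\<in>UNIV. \<Sum>q\<in>UNIV.
        psign (p \<and> q) *\<^sub>C pure2 K (hcomp (part K) q y) (hcomp (part K) p x))"

definition tensor2_part :: "'a::complex_vector hopf_super \<Rightarrow> bool \<Rightarrow> 'a tensor2 set" where
  "tensor2_part K r =
     cvec.span {pure2 K x y | x y p q. x \<in> part K p \<and> y \<in> part K q \<and> (p \<noteq> q) = r}"

definition hopf_superalgebra :: "'a::complex_vector hopf_super \<Rightarrow> bool" where
  "hopf_superalgebra K \<longleftrightarrow>
     hopf_in (superflip K) K
   \<and> cvec.subspace (part K False) \<and> cvec.subspace (part K True)
   \<and> part K False \<inter> part K True = {0}
   \<and> carr K = {x + y | x y. x \<in> part K False \<and> y \<in> part K True}
     \<comment> \<open>the structure maps are even\<close>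
   \<and> (\<forall>p q. \<forall>x\<in>part K p. \<forall>y\<in>part K q. mul K x y \<in> part K (p \<noteq> q))
   \<and> unity K \<in> part K False
   \<and> (\<forall>p. \<forall>x\<in>part K p. comul K x \<in> tensor2_part K p)
   \<and> (\<forall>x\<in>part K True. counit K x = 0)
   \<and> (\<forall>p. \<forall>x\<in>part K p. antipode K x \<in> part K p)"

definition cocommutative_super :: "'a::complex_vector hopf_super \<Rightarrow> bool" where
  "cocommutative_super K \<longleftrightarrow> (\<forall>h\<in>carr K. lift2 K (superflip K) (comul K h) = comul K h)"

definition triangular_hopf_superalgebra ::
  "'a::complex_vector hopf_super \<Rightarrow> 'a tensor2 \<Rightarrow> bool" where
  "triangular_hopf_superalgebra K R \<longleftrightarrow>
     hopf_superalgebra K \<and> R \<in> tensor2_part K False \<and> triangular_in (superflip K) K R"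

definition drinfeld_super :: "'a::complex_vector hopf_super \<Rightarrow> 'a tensor2 \<Rightarrow> 'a" where
  "drinfeld_super K R = drinfeld_in (superflip K) K R"

definition parity_element :: "'a::complex_vector hopf_super \<Rightarrow> 'a \<Rightarrow> bool" where
  "parity_element K g \<longleftrightarrow>
     grouplike K g \<and> mul K g g = unity K
   \<and> (\<forall>p. \<forall>x\<in>part K p. conjugate K g x = psign p *\<^sub>C x)"


section \<open>Isomorphism classes\<close>

text \<open>
  All Hopf (super)algebras are carried by subspaces of one complex vector space, the type
  \<open>'a\<close>, which is arbitrary. An isomorphism class is a class of the equivalence relations below.
\<close>

definition triangular_objects :: "('a::complex_vector hopf \<times> 'a tensor2) set" where
  "triangular_objects =
     {(H, R). triangular_hopf_algebra H R \<and> mul H (drinfeld H R) (drinfeld H R) = unity H}"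

definition super_objects :: "('a::complex_vector hopf_super \<times> 'a tensor2 \<times> 'a) set" where
  "super_objects =
     {(K, R, g). triangular_hopf_superalgebra K R \<and> drinfeld_super K R = unity K
        \<and> parity_element K g}"

definition triangular_iso ::
  "(('a::complex_vector hopf \<times> 'a tensor2) \<times> ('a hopf \<times> 'a tensor2)) set" where
  "triangular_iso =
     {((H, R), (H', R')). (H, R) \<in> triangular_objects \<and> (H', R') \<in> triangular_objects
        \<and> (\<exists>\<phi>. hopf_iso H H' \<phi> \<and> R' = lift2 H (\<lambda>x y. pure2 H' (\<phi> x) (\<phi> y)) R)}"

definition super_iso ::
  "(('a::complex_vector hopf_super \<times> 'a tensor2 \<times> 'a) \<times> ('a hopf_super \<times> 'a tensor2 \<times> 'a)) set" where
  "super_iso =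
     {((K, R, g), (K', R', g')). (K, R, g) \<in> super_objects \<and> (K', R', g') \<in> super_objects
        \<and> (\<exists>\<phi>. hopf_iso K K' \<phi> \<and> (\<forall>p. \<phi> ` part K p = part K' p)
              \<and> R' = lift2 K (\<lambda>x y. pure2 K' (\<phi> x) (\<phi> y)) R \<and> \<phi> g = g')}"

text \<open>The map on classes induced by a map \<open>f\<close> of representatives.\<close>

definition class_map :: "('b \<times> 'b) set \<Rightarrow> ('a \<Rightarrow> 'b) \<Rightarrow> 'a set \<Rightarrow> 'b set" where
  "class_map r f X = (\<Union>x\<in>X. r `` {f x})"

definition rank_le_two_objects :: "('a::complex_vector hopf \<times> 'a tensor2) set" where
  "rank_le_two_objects = {(H, R). triangular_hopf_algebra H R \<and> R_rank H R \<le> 2}"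

definition cocommutative_objects :: "('a::complex_vector hopf_super \<times> 'a tensor2 \<times> 'a) set" where
  "cocommutative_objects =
     {(K, R, g). hopf_superalgebra K \<and> cocommutative_super K
        \<and> R = pure2 K (unity K) (unity K) \<and> parity_element K g}"


section \<open>The correspondence\<close>

text \<open>
  The same formulas serve in both directions, for a grading \<open>P\<close> that is conjugation by \<open>g\<close>.
  They are given on homogeneous elements, so for general \<open>h\<close> one sums over its homogeneous
  components. Products of tensors are the ordinary ones, taken with respect to \<open>flip\<close>.
\<close>

definition comul_part ::
  "('a::complex_vector, 'm) hopf_scheme \<Rightarrow> (bool \<Rightarrow> 'a set) \<Rightarrow> bool \<Rightarrow> 'a \<Rightarrow> 'a tensor2" where
  "comul_part H P i h = lift2 H (\<lambda>a b. pure2 H a (hcomp P i b)) (comul H h)"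

definition twisted_comul ::
  "('a::complex_vector, 'm) hopf_scheme \<Rightarrow> (bool \<Rightarrow> 'a set) \<Rightarrow> 'a \<Rightarrow> 'a \<Rightarrow> 'a tensor2" where
  "twisted_comul H P g h =
     (\<Sum>p\<in>UNIV. comul_part H P False (hcomp P p h)
        - psign p *\<^sub>C mul2 (flip H) H (pure2 H g (unity H)) (comul_part H P True (hcomp P p h)))"

definition twisted_antipode ::
  "('a::complex_vector, 'm) hopf_scheme \<Rightarrow> (bool \<Rightarrow> 'a set) \<Rightarrow> 'a \<Rightarrow> 'a \<Rightarrow> 'a" where
  "twisted_antipode H P g h =
     (\<Sum>p\<in>UNIV. mul H (if p then g else unity H) (antipode H (hcomp P p h)))"

definition R_elem :: "('a::complex_vector, 'm) hopf_scheme \<Rightarrow> 'a \<Rightarrow> 'a tensor2" where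
  "R_elem H g =
     (1 / 2) *\<^sub>C (pure2 H (unity H) (unity H) + pure2 H (unity H) g + pure2 H g (unity H) - pure2 H g g)"

definition tensor_part ::
  "('a::complex_vector, 'm) hopf_scheme \<Rightarrow> (bool \<Rightarrow> 'a set) \<Rightarrow> bool \<Rightarrow> 'a tensor2 \<Rightarrow> 'a tensor2" where
  "tensor_part H P i = lift2 H (\<lambda>x y. pure2 H (hcomp P i x) (hcomp P i y))"

definition twisted_R ::
  "('a::complex_vector, 'm) hopf_scheme \<Rightarrow> (bool \<Rightarrow> 'a set) \<Rightarrow> 'a \<Rightarrow> 'a tensor2 \<Rightarrow> 'a tensor2" where
  "twisted_R H P g R =
     mul2 (flip H) H
       (tensor_part H P False R
          + mul2 (flip H) H (pure2 H (unity H) g) (tensor_part H P True R))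
       (R_elem H g)"

definition adjoint_grading ::
  "('a::complex_vector, 'm) hopf_scheme \<Rightarrow> 'a \<Rightarrow> bool \<Rightarrow> 'a set" where
  "adjoint_grading H u p = {x \<in> carr H. conjugate H u x = psign p *\<^sub>C x}"

definition superize ::
  "'a::complex_vector hopf \<times> 'a tensor2 \<Rightarrow> 'a hopf_super \<times> 'a tensor2 \<times> 'a" where
  "superize = (\<lambda>(H, R).
     let u = drinfeld H R; P = adjoint_grading H u in
       (\<lparr>carr = carr H, mul = mul H, unity = unity H, comul = twisted_comul H P u,
         counit = counit H, antipode = twisted_antipode H P u, part = P\<rparr>,
        twisted_R H P u R, u))"

definition unsuperize ::
  "'a::complex_vector hopf_super \<times> 'a tensor2 \<times> 'a \<Rightarrow> 'a hopf \<times> 'a tensor2" where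
  "unsuperize = (\<lambda>(K, R, g).
     let P = part K in
       (\<lparr>carr = carr K, mul = mul K, unity = unity K, comul = twisted_comul K P g,
         counit = counit K, antipode = twisted_antipode K P g\<rparr>,
        twisted_R K P g R))"

definition superize_class ::
  "('a::complex_vector hopf \<times> 'a tensor2) set \<Rightarrow> ('a hopf_super \<times> 'a tensor2 \<times> 'a) set" where
  "superize_class = class_map super_iso superize"

definition unsuperize_class ::
  "('a::complex_vector hopf_super \<times> 'a tensor2 \<times> 'a) set \<Rightarrow> ('a hopf \<times> 'a tensor2) set" where
  "unsuperize_class = class_map triangular_iso unsuperize"

end

theory Submission
  imports Defs
begin

text \<open>
  Let \<open>g\<close> be a grouplike involution of a Hopf algebra whose conjugation is the parity: for a
  superalgebra this is the hypothesis on \<open>g\<close>, and for an ordinary Hopf algebra it defines a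
  grading. Ordinary Hopf algebras and superalgebras are then treated alike, as Hopf algebras for
  the rule \<open>x \<otimes> y \<mapsto> s\<^sup>p\<^sup>q y \<otimes> x\<close> (\<open>x\<close>, \<open>y\<close> of parity \<open>p\<close>, \<open>q\<close>) with \<open>s = 1\<close> and \<open>s = -1\<close>
  respectively.

  On homogeneous components the twisted coproduct is \<open>h \<mapsto> \<Sum> h\<^sub>1 g\<^sup>p \<otimes> h\<^sub>2\<close>, where \<open>p\<close> is the
  parity of \<open>h\<^sub>2\<close>; so it is \<open>\<tau> \<circ> \<Delta>\<close> for the involution \<open>\<tau> (a \<otimes> b) = a g\<^sup>p \<otimes> b\<close>
  (\<open>twisted_comul_eq\<close>). When two such coproducts are multiplied, moving \<open>g\<^sup>p\<close> past the next factor
  costs exactly the sign by which the product rules for \<open>s\<close> and \<open>-s\<close> differ. Hence twisting turns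
  a Hopf algebra for \<open>s\<close> into one for \<open>-s\<close> (\<open>hopf_in_twist\<close>), and twisting twice gives back the
  original (\<open>twist_twist\<close>): this is the correspondence in both directions, as far as the Hopf
  structures are concerned.

  Conjugation by \<open>R\<^sub>g\<close> sends \<open>a \<otimes> b\<close>, of parities \<open>p\<close> and \<open>q\<close>, to \<open>(-1)\<^sup>p\<^sup>q a g\<^sup>q \<otimes> b g\<^sup>p\<close>
  (\<open>R_mul_left\<close>). Comparing this with \<open>\<tau>\<close> shows that \<open>R\<^sub>g \<Delta> = \<Delta>\<^sup>o\<^sup>p R\<^sub>g\<close> holds if and only if \<open>\<tau> \<circ>
  \<Delta>\<close> is cocommutative in the super sense (\<open>super_cocommutative_iff\<close>). The other axioms hold for
  every \<open>R\<^sub>g\<close> (\<open>triangular_R\<close>), its Drinfeld element is \<open>g\<close>, and the formula for the R-matrix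
  exchanges \<open>R\<^sub>g\<close> and \<open>1 \<otimes> 1\<close>. So the triangular Hopf algebras of the form \<open>(H, R\<^sub>g)\<close> correspond
  to the cocommutative superalgebras with a parity element.

  It remains to see that the R-matrices of rank at most 2 are those of the form \<open>R\<^sub>g\<close>. If the
  minimal part has dimension at most 2, it is spanned by 1 and some \<open>x\<close> with \<open>\<epsilon>(x) = 0\<close>; the
  counit then forces \<open>R = 1 \<otimes> 1 + d x \<otimes> x\<close>, one hexagon identity computes \<open>\<Delta> x\<close>, and \<open>R R\<^sub>2\<^sub>1 = 1\<close>
  fixes \<open>d\<close> so that \<open>R\<close> comes from a grouplike involution in the span of 1 and \<open>x\<close>
  (\<open>rank_le_two_R_elem\<close>). Isomorphisms preserve all the data (\<open>twist_iso\<close>), so everything passes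
  to isomorphism classes (\<open>class_map_bij\<close>).
\<close>

section \<open>Linear maps on subspaces and on tensor squares\<close>

text \<open>
  Tensors are encoded as functions. These pointwise rules would rewrite a sum of tensors into its
  values, which hides it from the linearity lemmas.
\<close>

declare zero_fun_apply [simp del] plus_fun_apply [simp del] minus_apply [simp del] uminus_apply [simp del]

lemma linear_onI:
  "(\<And>x y. x \<in> V \<Longrightarrow> y \<in> V \<Longrightarrow> f (x + y) = f x + f y) \<Longrightarrow> (\<And>c x. x \<in> V \<Longrightarrow> f (c *\<^sub>C x) = c *\<^sub>C f x)
    \<Longrightarrow> linear_on V f"
  by (simp add: linear_on_def)

lemma linear_on_add: "linear_on V f \<Longrightarrow> x \<in> V \<Longrightarrow> y \<in> V \<Longrightarrow> f (x + y) = f x + f y"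
  and linear_on_scale: "linear_on V f \<Longrightarrow> x \<in> V \<Longrightarrow> f (c *\<^sub>C x) = c *\<^sub>C f x"
  by (simp_all add: linear_on_def)

lemma linear_on_zero: "linear_on V f \<Longrightarrow> cvec.subspace V \<Longrightarrow> f 0 = 0"
  using linear_on_scale[of V f 0 0] cvec.subspace_0[of V] by simp

lemma linear_on_diff:
  assumes f: "linear_on V f" and "cvec.subspace V" "x \<in> V" "y \<in> V"
  shows "f (x - y) = f x - f y"
proof -
  have "f (x + (-1) *\<^sub>C y) = f x + (-1) *\<^sub>C f y"
    using assms by (simp only: linear_on_add[OF f] linear_on_scale[OF f] cvec.subspace_scale)
  then show ?thesis by simp
qed

lemma linear_on_sum:
  assumes f: "linear_on V f" and V: "cvec.subspace V" and x: "\<And>i. i \<in> I \<Longrightarrow> x i \<in> V"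
  shows "f (\<Sum>i\<in>I. x i) = (\<Sum>i\<in>I. f (x i))"
  using x
proof (induction I rule: infinite_finite_induct)
  case (insert i I)
  then show ?case
    using linear_on_add[OF f, of "x i" "sum x I"] cvec.subspace_sum[OF V, of I x] by simp
qed (simp_all add: linear_on_zero[OF f V])

lemma linear_on_cong: "(\<And>x. x \<in> V \<Longrightarrow> f x = g x) \<Longrightarrow> cvec.subspace V \<Longrightarrow> linear_on V f = linear_on V g"
  by (simp add: linear_on_def cvec.subspace_add cvec.subspace_scale)

lemma bilinear_onI:
  "(\<And>y. y \<in> W \<Longrightarrow> linear_on V (\<lambda>x. F x y)) \<Longrightarrow> (\<And>x. x \<in> V \<Longrightarrow> linear_on W (\<lambda>y. F x y))
    \<Longrightarrow> bilinear_on V W F"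
  by (simp add: bilinear_on_def)

lemma bilinear_onD1: "bilinear_on V W F \<Longrightarrow> y \<in> W \<Longrightarrow> linear_on V (\<lambda>x. F x y)"
  and bilinear_onD2: "bilinear_on V W F \<Longrightarrow> x \<in> V \<Longrightarrow> linear_on W (\<lambda>y. F x y)"
  by (simp_all add: bilinear_on_def)

lemma linear_on_id: "linear_on V (\<lambda>x. x)"
  and linear_on_plus: "linear_on V f \<Longrightarrow> linear_on V g \<Longrightarrow> linear_on V (\<lambda>x. f x + g x)"
  and linear_on_minus: "linear_on V f \<Longrightarrow> linear_on V g \<Longrightarrow> linear_on V (\<lambda>x. f x - g x)"
  and linear_on_scaled: "linear_on V f \<Longrightarrow> linear_on V (\<lambda>x. c *\<^sub>C f x)"
  and linear_on_functional: "linear_on V k \<Longrightarrow> linear_on V (\<lambda>x. k x *\<^sub>C y)"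
  by (simp_all add: linear_on_def scaleC_add_right scaleC_add_left scaleC_scaleC cvec.scale_right_diff_distrib
      scaleC_complex_def mult.commute)

lemma linear_on_comp:
  "linear_on W g \<Longrightarrow> linear_on V f \<Longrightarrow> (\<And>x. x \<in> V \<Longrightarrow> f x \<in> W) \<Longrightarrow> linear_on V (\<lambda>x. g (f x))"
  by (simp add: linear_on_def)

lemma linear_on_Sum:
  assumes "\<And>i. i \<in> I \<Longrightarrow> linear_on V (f i)"
  shows "linear_on V (\<lambda>x. \<Sum>i\<in>I. f i x)"
  using assms by (simp add: linear_on_def sum.distrib cvec.scale_sum_right)

lemma subspace_tensor: "cvec.subspace (tensor V W)"
  by (simp add: tensor_def)

lemma tens_in_tensor: "x \<in> V \<Longrightarrow> y \<in> W \<Longrightarrow> tens V W x y \<in> tensor V W"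
  unfolding tensor_def by (rule cvec.span_base) blast

lemma linear_on_lift: "bilinear_on V W F \<Longrightarrow> linear_on (tensor V W) (lift V W F)"
  and lift_tens: "bilinear_on V W F \<Longrightarrow> x \<in> V \<Longrightarrow> y \<in> W \<Longrightarrow> lift V W F (tens V W x y) = F x y"
  using someI_ex[OF ex_lift[of V W F]] unfolding lift_def by blast+

lemma lift_cong: "(\<And>x y. x \<in> V \<Longrightarrow> y \<in> W \<Longrightarrow> F x y = G x y) \<Longrightarrow> lift V W F = lift V W G"
  by (simp add: lift_def)

lemma tens_scale: "x \<in> V \<Longrightarrow> y \<in> W \<Longrightarrow> tens V W (c *\<^sub>C x) y = c *\<^sub>C tens V W x y"
  by (rule linear_on_scale[OF bilinear_onD1[OF bilinear_on_tens]])

lemma tensor_induct [consumes 2, case_names zero add]: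
  assumes V: "cvec.subspace V" and t: "t \<in> tensor V W" and 0: "P 0"
    and add: "\<And>x y t. x \<in> V \<Longrightarrow> y \<in> W \<Longrightarrow> t \<in> tensor V W \<Longrightarrow> P t \<Longrightarrow> P (tens V W x y + t)"
  shows "P t"
proof -
  have "t \<in> tensor V W \<and> P t"
    using t unfolding tensor_def
  proof (induction rule: cvec.span_induct_alt)
    case base
    show ?case by (simp add: 0 cvec.span_zero)
  next
    case (step c s t)
    then obtain x y where xy: "s = tens V W x y" "x \<in> V" "y \<in> W" by blast
    have *: "c *\<^sub>C s = tens V W (c *\<^sub>C x) y" and cx: "c *\<^sub>C x \<in> V"
      using xy V by (simp_all add: tens_scale cvec.subspace_scale)
    show ?case
      using step.IH add[OF cx xy(3)] tens_in_tensor[OF cx xy(3)]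
      unfolding * by (simp add: tensor_def cvec.span_add)
  qed
  then show ?thesis ..
qed

text \<open>
  A lifted map depends linearly on parameters of the bilinear map; this is what makes nested
  Sweedler sums multilinear.
\<close>

lemma linear_on_lift_fun:
  assumes V: "cvec.subspace V" and t: "t \<in> tensor V W" and U: "cvec.subspace U"
    and F: "\<And>x. x \<in> U \<Longrightarrow> bilinear_on V W (F x)"
    and lin: "\<And>a b. a \<in> V \<Longrightarrow> b \<in> W \<Longrightarrow> linear_on U (\<lambda>x. F x a b)"
  shows "linear_on U (\<lambda>x. lift V W (F x) t)"
  using V t
proof (induction rule: tensor_induct)
  case zero
  show ?case
    by (rule linear_onI)
      (simp_all add: linear_on_zero[OF linear_on_lift[OF F] subspace_tensor] U cvec.subspace_add cvec.subspace_scale)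
next
  case (add x y t)
  have *: "lift V W (F u) (tens V W x y + t) = F u x y + lift V W (F u) t" if "u \<in> U" for u
    using that add by (simp add: linear_on_add[OF linear_on_lift[OF F]] lift_tens[OF F] tens_in_tensor)
  show ?case
    by (subst linear_on_cong[OF * U], assumption) (intro linear_on_plus lin add)
qed

text \<open>
  Evaluation of tensors, as functionals on bilinear forms, turns an identity between linear
  combinations of pure tensors into one between complex numbers, with the values of the pure
  tensors as atoms.
\<close>

lemmas tensor_eval = plus_fun_apply minus_apply uminus_apply scaleC_fun_def scaleC_complex_def

locale carrier_space =
  fixes H :: "('a::complex_vector, 'm) hopf_scheme"
  assumes subspace_carr: "cvec.subspace (carr H)"
begin

abbreviation "V \<equiv> carr H"

abbreviation bilinear :: "('a \<Rightarrow> 'a \<Rightarrow> 'c::complex_vector) \<Rightarrow> bool" where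
  "bilinear \<equiv> bilinear_on V V"

lemma carr_closed:
  "0 \<in> V" "x \<in> V \<Longrightarrow> y \<in> V \<Longrightarrow> x + y \<in> V" "x \<in> V \<Longrightarrow> y \<in> V \<Longrightarrow> x - y \<in> V" "x \<in> V \<Longrightarrow> c *\<^sub>C x \<in> V"
  "x \<in> V \<Longrightarrow> - x \<in> V"
  using subspace_carr
  by (simp_all add: cvec.subspace_0 cvec.subspace_add cvec.subspace_diff cvec.subspace_scale cvec.subspace_neg)

lemma subspace_tensor2: "cvec.subspace (tensor2 H)"
  by (simp add: tensor2_def subspace_tensor)

lemma pure2_in: "x \<in> V \<Longrightarrow> y \<in> V \<Longrightarrow> pure2 H x y \<in> tensor2 H"
  by (simp add: pure2_def tensor2_def tens_in_tensor)

lemma tensor2_closed: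
  "0 \<in> tensor2 H" "s \<in> tensor2 H \<Longrightarrow> t \<in> tensor2 H \<Longrightarrow> s + t \<in> tensor2 H"
  "s \<in> tensor2 H \<Longrightarrow> t \<in> tensor2 H \<Longrightarrow> s - t \<in> tensor2 H" "t \<in> tensor2 H \<Longrightarrow> c *\<^sub>C t \<in> tensor2 H"
  using subspace_tensor2
  by (simp_all add: cvec.subspace_0 cvec.subspace_add cvec.subspace_diff cvec.subspace_scale)

lemma tensor2_sum: "(\<And>i. i \<in> I \<Longrightarrow> t i \<in> tensor2 H) \<Longrightarrow> (\<Sum>i\<in>I. t i) \<in> tensor2 H"
  by (rule cvec.subspace_sum[OF subspace_tensor2])

lemma carr_sum: "(\<And>i. i \<in> I \<Longrightarrow> t i \<in> V) \<Longrightarrow> (\<Sum>i\<in>I. t i) \<in> V"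
  by (rule cvec.subspace_sum[OF subspace_carr])

lemma linear_on_pure2_left: "linear_on U f \<Longrightarrow> (\<And>x. x \<in> U \<Longrightarrow> f x \<in> V) \<Longrightarrow> y \<in> V \<Longrightarrow> linear_on U (\<lambda>x. pure2 H (f x) y)"
  and linear_on_pure2_right: "linear_on U f \<Longrightarrow> (\<And>x. x \<in> U \<Longrightarrow> f x \<in> V) \<Longrightarrow> y \<in> V \<Longrightarrow> linear_on U (\<lambda>x. pure2 H y (f x))"
  using bilinear_on_tens[of V V] by (auto simp: pure2_def bilinear_on_def linear_on_def)

lemma lift2_linear: "bilinear F \<Longrightarrow> linear_on (tensor2 H) (lift2 H F)"
  by (simp add: lift2_def tensor2_def linear_on_lift)

lemma linear_on_lift2_arg:
  "bilinear F \<Longrightarrow> linear_on U f \<Longrightarrow> (\<And>x. x \<in> U \<Longrightarrow> f x \<in> tensor2 H) \<Longrightarrow> linear_on U (\<lambda>x. lift2 H F (f x))"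
  by (rule linear_on_comp[OF lift2_linear])

lemma lift2_pure: "bilinear F \<Longrightarrow> x \<in> V \<Longrightarrow> y \<in> V \<Longrightarrow> lift2 H F (pure2 H x y) = F x y"
  by (simp add: lift2_def pure2_def lift_tens)

lemma lift2_cong: "(\<And>x y. x \<in> V \<Longrightarrow> y \<in> V \<Longrightarrow> F x y = G x y) \<Longrightarrow> lift2 H F t = lift2 H G t"
  using lift_cong[of V V F G] by (simp add: lift2_def)

lemma tensor2_induct [consumes 1, case_names zero add]:
  assumes t: "t \<in> tensor2 H" and 0: "P 0"
    and add: "\<And>x y t. x \<in> V \<Longrightarrow> y \<in> V \<Longrightarrow> t \<in> tensor2 H \<Longrightarrow> P t \<Longrightarrow> P (pure2 H x y + t)"
  shows "P t"
  using subspace_carr t[unfolded tensor2_def]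
  by (induction rule: tensor_induct) (simp_all add: 0 add[unfolded pure2_def tensor2_def])

lemma linear_on_lift2_fun:
  assumes "t \<in> tensor2 H" "\<And>x. x \<in> U \<Longrightarrow> bilinear (F x)" "cvec.subspace U"
    and "\<And>a b. a \<in> V \<Longrightarrow> b \<in> V \<Longrightarrow> linear_on U (\<lambda>x. F x a b)"
  shows "linear_on U (\<lambda>x. lift2 H (\<lambda>a b. F x a b) t)"
  unfolding lift2_def using assms by (intro linear_on_lift_fun) (simp_all add: subspace_carr tensor2_def)

lemma lift2_ext:
  assumes f: "linear_on (tensor2 H) f" and g: "linear_on (tensor2 H) g"
    and eq: "\<And>x y. x \<in> V \<Longrightarrow> y \<in> V \<Longrightarrow> f (pure2 H x y) = g (pure2 H x y)" and t: "t \<in> tensor2 H"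
  shows "f t = g t"
  using lift_unique[of V V f g t] assms by (simp add: tensor2_def pure2_def)

lemma lift2_in:
  assumes t: "t \<in> tensor2 H" and F: "bilinear F" and U: "cvec.subspace U"
    and mem: "\<And>a b. a \<in> V \<Longrightarrow> b \<in> V \<Longrightarrow> F a b \<in> U"
  shows "lift2 H F t \<in> U"
  using t
proof (induction rule: tensor2_induct)
  case zero
  show ?case by (simp add: linear_on_zero[OF lift2_linear[OF F] subspace_tensor2] U cvec.subspace_0)
next
  case (add x y t)
  then show ?case
    by (simp add: linear_on_add[OF lift2_linear[OF F]] lift2_pure[OF F] pure2_in mem cvec.subspace_add[OF U])
qed

text \<open>
  A linear map may be moved inside a Sweedler sum. The target \<open>U\<close> of the summands is a subspace,
  because the maps of interest are linear only on the carrier or on its tensor powers.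
\<close>

lemma linear_lift2:
  assumes t: "t \<in> tensor2 H" and F: "bilinear F" and U: "cvec.subspace U"
    and mem: "\<And>a b. a \<in> V \<Longrightarrow> b \<in> V \<Longrightarrow> F a b \<in> U" and f: "linear_on U f"
  shows "f (lift2 H F t) = lift2 H (\<lambda>a b. f (F a b)) t"
proof -
  have b: "bilinear (\<lambda>a b. f (F a b))"
    by (intro bilinear_onI linear_on_comp[OF f] bilinear_onD1[OF F] bilinear_onD2[OF F] mem)
  show ?thesis
    by (rule lift2_ext[OF linear_on_comp[OF f lift2_linear[OF F]] lift2_linear[OF b] _ t])
      (simp_all add: lift2_in[OF _ F U mem] lift2_pure[OF F] lift2_pure[OF b])
qed

lemma lift2_lift2:
  assumes "t \<in> tensor2 H" "bilinear G" "bilinear F" "\<And>a b. a \<in> V \<Longrightarrow> b \<in> V \<Longrightarrow> G a b \<in> tensor2 H"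
  shows "lift2 H F (lift2 H G t) = lift2 H (\<lambda>a b. lift2 H F (G a b)) t"
  by (rule linear_lift2[OF assms(1,2) subspace_tensor2 assms(4) lift2_linear[OF assms(3)]])

lemma lift2_pure_id: "t \<in> tensor2 H \<Longrightarrow> lift2 H (\<lambda>a b. pure2 H a b) t = t"
proof -
  assume t: "t \<in> tensor2 H"
  have b: "bilinear (\<lambda>a b. pure2 H a b)"
    by (intro bilinear_onI linear_on_pure2_left linear_on_pure2_right linear_on_id)
  show ?thesis
    by (rule lift2_ext[OF lift2_linear[OF b] linear_on_id _ t]) (simp add: lift2_pure[OF b])
qed

definition trilinear :: "('a \<Rightarrow> 'a \<Rightarrow> 'a \<Rightarrow> 'c::complex_vector) \<Rightarrow> bool" where
  "trilinear T \<longleftrightarrow> (\<forall>y\<in>V. \<forall>z\<in>V. linear_on V (\<lambda>x. T x y z)) \<and> (\<forall>x\<in>V. bilinear (T x))"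

lemma trilinearI:
  "(\<And>y z. y \<in> V \<Longrightarrow> z \<in> V \<Longrightarrow> linear_on V (\<lambda>x. T x y z)) \<Longrightarrow>
   (\<And>x z. x \<in> V \<Longrightarrow> z \<in> V \<Longrightarrow> linear_on V (\<lambda>y. T x y z)) \<Longrightarrow>
   (\<And>x y. x \<in> V \<Longrightarrow> y \<in> V \<Longrightarrow> linear_on V (\<lambda>z. T x y z)) \<Longrightarrow> trilinear T"
  by (simp add: trilinear_def bilinear_onI)

lemma trilinearD:
  assumes "trilinear T"
  shows "y \<in> V \<Longrightarrow> z \<in> V \<Longrightarrow> linear_on V (\<lambda>x. T x y z)"
    and "x \<in> V \<Longrightarrow> bilinear (T x)"
    and "x \<in> V \<Longrightarrow> z \<in> V \<Longrightarrow> linear_on V (\<lambda>y. T x y z)"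
    and "x \<in> V \<Longrightarrow> y \<in> V \<Longrightarrow> linear_on V (\<lambda>z. T x y z)"
  using assms by (simp_all add: trilinear_def bilinear_on_def)

definition "tensor3 = tensor V (tensor2 H)"

lemma subspace_tensor3: "cvec.subspace tensor3"
  by (simp add: tensor3_def subspace_tensor)

lemma pure3_in: "x \<in> V \<Longrightarrow> y \<in> V \<Longrightarrow> z \<in> V \<Longrightarrow> pure3 H x y z \<in> tensor3"
  by (simp add: pure3_def tensor3_def tens_in_tensor pure2_in)

lemma bilinear_lift2: "trilinear T \<Longrightarrow> bilinear_on V (tensor2 H) (\<lambda>x. lift2 H (T x))"
  by (rule bilinear_onI, rule linear_on_lift2_fun)
    (simp_all add: trilinearD subspace_carr lift2_linear)

lemma lift3_linear: "trilinear T \<Longrightarrow> linear_on tensor3 (lift3 H T)"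
  unfolding lift3_def tensor3_def by (intro linear_on_lift bilinear_lift2)

lemma lift3_pure:
  "trilinear T \<Longrightarrow> x \<in> V \<Longrightarrow> y \<in> V \<Longrightarrow> z \<in> V \<Longrightarrow> lift3 H T (pure3 H x y z) = T x y z"
  unfolding lift3_def pure3_def
  by (simp add: lift_tens[OF bilinear_lift2] pure2_in lift2_pure trilinearD)

lemma linear_on_pure3:
  "linear_on U f \<Longrightarrow> (\<And>x. x \<in> U \<Longrightarrow> f x \<in> V) \<Longrightarrow> y \<in> V \<Longrightarrow> z \<in> V \<Longrightarrow> linear_on U (\<lambda>x. pure3 H (f x) y z)"
  "linear_on U f \<Longrightarrow> (\<And>x. x \<in> U \<Longrightarrow> f x \<in> V) \<Longrightarrow> y \<in> V \<Longrightarrow> z \<in> V \<Longrightarrow> linear_on U (\<lambda>x. pure3 H y (f x) z)"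
  "linear_on U f \<Longrightarrow> (\<And>x. x \<in> U \<Longrightarrow> f x \<in> V) \<Longrightarrow> y \<in> V \<Longrightarrow> z \<in> V \<Longrightarrow> linear_on U (\<lambda>x. pure3 H y z (f x))"
proof -
  have l: "linear_on V (\<lambda>x. tens V (tensor2 H) x t)" if "t \<in> tensor2 H" for t
    using bilinear_onD1[OF bilinear_on_tens that] .
  have r: "linear_on (tensor2 H) (\<lambda>t. tens V (tensor2 H) x t)" if "x \<in> V" for x
    using bilinear_onD2[OF bilinear_on_tens that] .
  assume *: "linear_on U f" "\<And>x. x \<in> U \<Longrightarrow> f x \<in> V" "y \<in> V" "z \<in> V"
  show "linear_on U (\<lambda>x. pure3 H (f x) y z)"
    unfolding pure3_def by (rule linear_on_comp[OF l]) (simp_all add: * pure2_in)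
  show "linear_on U (\<lambda>x. pure3 H y (f x) z)" "linear_on U (\<lambda>x. pure3 H y z (f x))"
    unfolding pure3_def using *
    by (auto intro!: linear_on_comp[OF r] linear_on_pure2_left linear_on_pure2_right pure2_in)
qed

lemma linear_on_lift3_fun:
  assumes t: "t \<in> tensor3" and F: "\<And>x. x \<in> U \<Longrightarrow> trilinear (F x)" and U: "cvec.subspace U"
    and lin: "\<And>a b c. a \<in> V \<Longrightarrow> b \<in> V \<Longrightarrow> c \<in> V \<Longrightarrow> linear_on U (\<lambda>x. F x a b c)"
  shows "linear_on U (\<lambda>x. lift3 H (\<lambda>a b c. F x a b c) t)"
  unfolding lift3_def
proof (rule linear_on_lift_fun[OF subspace_carr t[unfolded tensor3_def] U])
  show "bilinear_on V (tensor2 H) (\<lambda>a. lift2 H (F x a))" if "x \<in> U" for x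
    by (rule bilinear_lift2[OF F[OF that]])
  show "linear_on U (\<lambda>x. lift2 H (F x a) b)" if "a \<in> V" "b \<in> tensor2 H" for a b
    using linear_on_lift2_fun[OF that(2) _ U, of "\<lambda>x. F x a"] lin that F by (simp add: trilinearD)
qed

lemma lift3_cong:
  "(\<And>x y z. x \<in> V \<Longrightarrow> y \<in> V \<Longrightarrow> z \<in> V \<Longrightarrow> F x y z = G x y z) \<Longrightarrow> lift3 H F = lift3 H G"
  unfolding lift3_def by (rule lift_cong) (auto intro: lift2_cong)

end

context carrier_space
begin

lemma pure2_zero: "y \<in> V \<Longrightarrow> pure2 H 0 y = 0" "x \<in> V \<Longrightarrow> pure2 H x 0 = 0"
  using linear_on_zero[OF linear_on_pure2_left[OF linear_on_id, of V y] subspace_carr]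
    linear_on_zero[OF linear_on_pure2_right[OF linear_on_id, of V x] subspace_carr]
  by simp_all

lemma pure2_scale:
  "x \<in> V \<Longrightarrow> y \<in> V \<Longrightarrow> pure2 H (c *\<^sub>C x) y = c *\<^sub>C pure2 H x y"
  "x \<in> V \<Longrightarrow> y \<in> V \<Longrightarrow> pure2 H x (c *\<^sub>C y) = c *\<^sub>C pure2 H x y"
  by (rule linear_on_scale[OF linear_on_pure2_left[OF linear_on_id]] linear_on_scale[OF linear_on_pure2_right[OF linear_on_id]]; assumption)+

lemma pure2_distrib:
  "x \<in> V \<Longrightarrow> y \<in> V \<Longrightarrow> z \<in> V \<Longrightarrow> pure2 H (x + y) z = pure2 H x z + pure2 H y z"
  "x \<in> V \<Longrightarrow> y \<in> V \<Longrightarrow> z \<in> V \<Longrightarrow> pure2 H z (x + y) = pure2 H z x + pure2 H z y"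
  "x \<in> V \<Longrightarrow> y \<in> V \<Longrightarrow> pure2 H (c *\<^sub>C x) y = c *\<^sub>C pure2 H x y"
  "x \<in> V \<Longrightarrow> y \<in> V \<Longrightarrow> pure2 H x (c *\<^sub>C y) = c *\<^sub>C pure2 H x y"
  by (simp_all add: pure2_scale linear_on_add[OF linear_on_pure2_left[OF linear_on_id]]
      linear_on_add[OF linear_on_pure2_right[OF linear_on_id]])

lemma pure3_zero:
  "y \<in> V \<Longrightarrow> z \<in> V \<Longrightarrow> pure3 H 0 y z = 0" "y \<in> V \<Longrightarrow> z \<in> V \<Longrightarrow> pure3 H y 0 z = 0"
  "y \<in> V \<Longrightarrow> z \<in> V \<Longrightarrow> pure3 H y z 0 = 0"
  using linear_on_zero[OF linear_on_pure3(1)[OF linear_on_id, of V y z] subspace_carr]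
    linear_on_zero[OF linear_on_pure3(2)[OF linear_on_id, of V y z] subspace_carr]
    linear_on_zero[OF linear_on_pure3(3)[OF linear_on_id, of V y z] subspace_carr]
  by simp_all

lemma lift2_zero: "bilinear F \<Longrightarrow> lift2 H F 0 = 0"
  by (rule linear_on_zero[OF lift2_linear subspace_tensor2])

lemma lift2_add: "bilinear F \<Longrightarrow> s \<in> tensor2 H \<Longrightarrow> t \<in> tensor2 H \<Longrightarrow> lift2 H F (s + t) = lift2 H F s + lift2 H F t"
  and lift2_scale: "bilinear F \<Longrightarrow> s \<in> tensor2 H \<Longrightarrow> lift2 H F (c *\<^sub>C s) = c *\<^sub>C lift2 H F s"
  and lift2_diff: "bilinear F \<Longrightarrow> s \<in> tensor2 H \<Longrightarrow> t \<in> tensor2 H \<Longrightarrow> lift2 H F (s - t) = lift2 H F s - lift2 H F t"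
  and lift2_sum: "bilinear F \<Longrightarrow> (\<And>i. i \<in> I \<Longrightarrow> u i \<in> tensor2 H) \<Longrightarrow> lift2 H F (\<Sum>i\<in>I. u i) = (\<Sum>i\<in>I. lift2 H F (u i))"
  by (simp_all add: linear_on_add[OF lift2_linear] linear_on_scale[OF lift2_linear]
      linear_on_diff[OF lift2_linear] linear_on_sum[OF lift2_linear] subspace_tensor2)

lemma lift2_sum_fun:
  assumes t: "t \<in> tensor2 H" and F: "\<And>i. i \<in> I \<Longrightarrow> bilinear (F i)"
  shows "lift2 H (\<lambda>a b. \<Sum>i\<in>I. F i a b) t = (\<Sum>i\<in>I. lift2 H (F i) t)"
proof -
  have b: "bilinear (\<lambda>a b. \<Sum>i\<in>I. F i a b)"
    by (intro bilinear_onI linear_on_Sum bilinear_onD1[OF F] bilinear_onD2[OF F])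
  show ?thesis
    by (rule lift2_ext[OF lift2_linear[OF b] linear_on_Sum[OF lift2_linear[OF F]] _ t])
      (simp_all add: lift2_pure b F)
qed

lemma linear_on_bilinear:
  assumes F: "bilinear F" and f: "linear_on U f" "\<And>x. x \<in> U \<Longrightarrow> f x \<in> V" and y: "y \<in> V"
  shows "linear_on U (\<lambda>x. F (f x) y)" "linear_on U (\<lambda>x. F y (f x))"
  using linear_on_comp[OF bilinear_onD1[OF F y] f] linear_on_comp[OF bilinear_onD2[OF F y] f] by simp_all

end

section \<open>The grading by conjugation with an involution\<close>

text \<open>
  An algebra with an element \<open>g\<close> of square 1. Conjugation by \<open>g\<close> is an involution of the vector
  space, so its eigenspaces \<open>P False\<close> and \<open>P True\<close> form a grading.
\<close>

locale involutive_algebra = carrier_space H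
  for H :: "('a::complex_vector, 'm) hopf_scheme" +
  fixes g :: 'a
  assumes mul_bilinear: "bilinear_on (carr H) (carr H) (mul H)"
    and mul_closed: "x \<in> carr H \<Longrightarrow> y \<in> carr H \<Longrightarrow> mul H x y \<in> carr H"
    and unity_closed: "unity H \<in> carr H"
    and mul_assoc: "x \<in> carr H \<Longrightarrow> y \<in> carr H \<Longrightarrow> z \<in> carr H \<Longrightarrow> mul H (mul H x y) z = mul H x (mul H y z)"
    and mul_unity: "x \<in> carr H \<Longrightarrow> mul H (unity H) x = x" "x \<in> carr H \<Longrightarrow> mul H x (unity H) = x"
    and g_closed: "g \<in> carr H"
    and g_square: "mul H g g = unity H"
begin

abbreviation mult (infixl "\<cdot>" 70) where "x \<cdot> y \<equiv> mul H x y"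
abbreviation "e \<equiv> unity H"
abbreviation "P \<equiv> adjoint_grading H g"

lemma linear_on_mul:
  "linear_on U f \<Longrightarrow> (\<And>x. x \<in> U \<Longrightarrow> f x \<in> V) \<Longrightarrow> y \<in> V \<Longrightarrow> linear_on U (\<lambda>x. f x \<cdot> y)"
  "linear_on U f \<Longrightarrow> (\<And>x. x \<in> U \<Longrightarrow> f x \<in> V) \<Longrightarrow> y \<in> V \<Longrightarrow> linear_on U (\<lambda>x. y \<cdot> f x)"
  by (rule linear_on_bilinear[OF mul_bilinear]; assumption)+

lemma mul_distrib:
  "x \<in> V \<Longrightarrow> y \<in> V \<Longrightarrow> z \<in> V \<Longrightarrow> (x + y) \<cdot> z = x \<cdot> z + y \<cdot> z"
  "x \<in> V \<Longrightarrow> y \<in> V \<Longrightarrow> z \<in> V \<Longrightarrow> z \<cdot> (x + y) = z \<cdot> x + z \<cdot> y"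
  "x \<in> V \<Longrightarrow> z \<in> V \<Longrightarrow> (c *\<^sub>C x) \<cdot> z = c *\<^sub>C (x \<cdot> z)"
  "x \<in> V \<Longrightarrow> z \<in> V \<Longrightarrow> z \<cdot> (c *\<^sub>C x) = c *\<^sub>C (z \<cdot> x)"
  "z \<in> V \<Longrightarrow> 0 \<cdot> z = 0" "z \<in> V \<Longrightarrow> z \<cdot> 0 = 0"
  "x \<in> V \<Longrightarrow> y \<in> V \<Longrightarrow> z \<in> V \<Longrightarrow> (x - y) \<cdot> z = x \<cdot> z - y \<cdot> z"
  "x \<in> V \<Longrightarrow> y \<in> V \<Longrightarrow> z \<in> V \<Longrightarrow> z \<cdot> (x - y) = z \<cdot> x - z \<cdot> y"
  using linear_on_add[OF linear_on_mul(1)[OF linear_on_id]] linear_on_add[OF linear_on_mul(2)[OF linear_on_id]]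
    linear_on_scale[OF linear_on_mul(1)[OF linear_on_id]] linear_on_scale[OF linear_on_mul(2)[OF linear_on_id]]
    linear_on_diff[OF linear_on_mul(1)[OF linear_on_id] subspace_carr] linear_on_diff[OF linear_on_mul(2)[OF linear_on_id] subspace_carr]
    linear_on_zero[OF linear_on_mul(1)[OF linear_on_id] subspace_carr] linear_on_zero[OF linear_on_mul(2)[OF linear_on_id] subspace_carr]
  by simp_all

lemma g_g_mul: "x \<in> V \<Longrightarrow> g \<cdot> (g \<cdot> x) = x" "x \<in> V \<Longrightarrow> x \<cdot> g \<cdot> g = x"
proof -
  show "x \<in> V \<Longrightarrow> g \<cdot> (g \<cdot> x) = x" by (simp add: mul_assoc[symmetric] g_closed g_square mul_unity)
  show "x \<in> V \<Longrightarrow> x \<cdot> g \<cdot> g = x" by (simp add: mul_assoc g_closed g_square mul_unity)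
qed

lemma inverse_g: "inverse_in H g = g"
  unfolding inverse_in_def
proof (rule the_equality)
  fix k assume k: "k \<in> V \<and> g \<cdot> k = e \<and> k \<cdot> g = e"
  then have "k = g \<cdot> e" using g_g_mul(1)[of k] by metis
  then show "k = g" by (simp add: mul_unity g_closed)
qed (simp add: g_closed g_square)

text \<open>
  Written without inverses, membership in the grading becomes a commutation rule with \<open>g\<close>.
\<close>

lemma in_grading_iff: "x \<in> P p \<longleftrightarrow> x \<in> V \<and> g \<cdot> x = psign p *\<^sub>C (x \<cdot> g)"
proof (cases "x \<in> V")
  case x: True
  have "g \<cdot> x \<cdot> g = psign p *\<^sub>C x \<longleftrightarrow> g \<cdot> x = psign p *\<^sub>C (x \<cdot> g)" (is "?l \<longleftrightarrow> ?r")
  proof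
    assume ?l
    then have "g \<cdot> x \<cdot> g \<cdot> g = (psign p *\<^sub>C x) \<cdot> g" by simp
    then show ?r using x by (simp add: g_g_mul mul_closed g_closed mul_distrib)
  next
    assume ?r
    then show ?l using x by (simp add: g_g_mul mul_closed g_closed mul_distrib)
  qed
  then show ?thesis using x by (simp add: adjoint_grading_def conjugate_def inverse_g)
qed (simp add: adjoint_grading_def)

lemma grading_closed: "x \<in> P p \<Longrightarrow> x \<in> V"
  by (simp add: in_grading_iff)

lemma subspace_grading: "cvec.subspace (P p)"
  by (rule cvec.subspaceI)
    (simp_all add: in_grading_iff carr_closed mul_distrib g_closed scaleC_add_right scaleC_scaleC mult.commute)

lemma psign_square: "psign p * psign p = 1"
  by (simp add: psign_def)

text \<open>
  The homogeneous components are the averages of an element and its conjugate, hence linear in it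
  and compatible with every map that commutes with conjugation.
\<close>

lemma hcomp_eq:
  assumes x: "x \<in> V"
  shows "hcomp P p x = (1 / 2) *\<^sub>C (x + psign p *\<^sub>C (g \<cdot> x \<cdot> g))" (is "_ = ?h p x")
  unfolding hcomp_def
proof (rule the_equality)
  have P: "?h q x \<in> P q" for q
    using x by (simp add: in_grading_iff carr_closed mul_closed g_closed mul_distrib g_g_mul mul_assoc g_square mul_unity
        scaleC_add_right scaleC_scaleC psign_square mult.left_commute add.commute)
  have "x = (1 / 2 + 1 / 2) *\<^sub>C x" by (simp add: scaleC_one)
  also have "\<dots> = ?h p x + ?h (\<not> p) x"
    unfolding scaleC_add_left
    by (cases p) (simp_all add: psign_def scaleC_add_right scaleC_one cvec.scale_right_diff_distrib)
  finally have "x - ?h p x = ?h (\<not> p) x" by (simp add: algebra_simps)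
  with P show *: "?h p x \<in> P p \<and> x - ?h p x \<in> P (\<not> p)" by metis
  fix y assume y: "y \<in> P p \<and> x - y \<in> P (\<not> p)"
  then have yV: "y \<in> V" "g \<cdot> y = psign p *\<^sub>C (y \<cdot> g)"
    and z: "x - y \<in> V" "g \<cdot> (x - y) = psign (\<not> p) *\<^sub>C ((x - y) \<cdot> g)"
    by (simp_all add: in_grading_iff)
  have "g \<cdot> x \<cdot> g = (g \<cdot> y + g \<cdot> (x - y)) \<cdot> g"
    using yV z mul_distrib(2)[OF yV(1) z(1) g_closed] by simp
  also have "\<dots> = psign p *\<^sub>C y + psign (\<not> p) *\<^sub>C (x - y)"
    using yV z by (simp add: mul_distrib mul_closed g_closed carr_closed g_g_mul)
  finally have "psign p *\<^sub>C (g \<cdot> x \<cdot> g) = y - (x - y)"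
    by (cases p) (simp_all add: psign_def scaleC_one scaleC_add_right)
  then have "?h p x = (1 / 2) *\<^sub>C (y + y)" by simp
  also have "\<dots> = (1 / 2 + 1 / 2) *\<^sub>C y" unfolding scaleC_add_left scaleC_add_right ..
  finally show "y = ?h p x" by (simp add: scaleC_one)
qed

lemma hcomp_closed: "x \<in> V \<Longrightarrow> hcomp P p x \<in> V"
  by (simp add: hcomp_eq carr_closed mul_closed g_closed)

lemma hcomp_homogeneous: "x \<in> P p \<Longrightarrow> hcomp P q x = (if q = p then x else 0)"
proof -
  assume x: "x \<in> P p"
  then have "g \<cdot> x \<cdot> g = psign p *\<^sub>C x" by (simp add: in_grading_iff mul_distrib g_closed mul_closed g_g_mul)
  then have "hcomp P q x = (1 / 2) *\<^sub>C ((1 + psign q * psign p) *\<^sub>C x)"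
    using x by (simp add: hcomp_eq grading_closed scaleC_add_left scaleC_scaleC scaleC_one)
  also have "\<dots> = (if q = p then x else 0)"
    by (simp add: scaleC_scaleC psign_def scaleC_one)
  finally show ?thesis .
qed

lemma hcomp_in_grading: "x \<in> V \<Longrightarrow> hcomp P q x \<in> P q"
  by (simp add: in_grading_iff hcomp_eq carr_closed mul_closed g_closed mul_distrib g_g_mul mul_assoc g_square mul_unity
        scaleC_add_right scaleC_scaleC psign_square mult.left_commute add.commute)

lemma hcomp_sum: "x \<in> V \<Longrightarrow> (\<Sum>p\<in>UNIV. hcomp P p x) = x"
proof -
  assume x: "x \<in> V"
  have "x = (1 / 2 + 1 / 2) *\<^sub>C x" by (simp add: scaleC_one)
  also have "\<dots> = (\<Sum>p\<in>UNIV. hcomp P p x)"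
    unfolding scaleC_add_left using x by (simp add: UNIV_bool hcomp_eq psign_def scaleC_add_right scaleC_one)
  finally show ?thesis ..
qed

lemma linear_on_hcomp_V: "linear_on V (hcomp P p)"
  by (rule linear_onI) (simp_all add: hcomp_eq carr_closed mul_closed g_closed mul_distrib
      scaleC_add_right scaleC_scaleC mult.commute algebra_simps)

lemma linear_on_hcomp: "linear_on U f \<Longrightarrow> (\<And>x. x \<in> U \<Longrightarrow> f x \<in> V) \<Longrightarrow> linear_on U (\<lambda>x. hcomp P p (f x))"
  by (rule linear_on_comp[OF linear_on_hcomp_V])

definition "gpow q = (if q then g else e)"

lemma gpow_closed: "gpow q \<in> V"
  by (simp add: gpow_def g_closed unity_closed)

lemma gpow_mul: "gpow p \<cdot> gpow q = gpow (p \<noteq> q)"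
  by (simp add: gpow_def g_square mul_unity g_closed unity_closed)

lemma gpow_mul2: "x \<in> V \<Longrightarrow> x \<cdot> gpow p \<cdot> gpow q = x \<cdot> gpow (p \<noteq> q)"
  by (simp add: mul_assoc gpow_closed gpow_mul)

lemma gpow_False: "gpow False = e"
  by (simp add: gpow_def)

lemma gpow_even: "gpow q \<in> P False"
  by (simp add: in_grading_iff gpow_def psign_def scaleC_one mul_unity unity_closed g_closed)

lemma gpow_commute: "x \<in> P p \<Longrightarrow> gpow q \<cdot> x = (if p \<and> q then -1 else 1) *\<^sub>C (x \<cdot> gpow q)"
  by (simp add: in_grading_iff gpow_def psign_def scaleC_one mul_unity)

lemma grading_mul: "x \<in> P p \<Longrightarrow> y \<in> P q \<Longrightarrow> x \<cdot> y \<in> P (p \<noteq> q)"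
proof -
  assume x: "x \<in> P p" and y: "y \<in> P q"
  then have V: "x \<in> V" "y \<in> V" by (simp_all add: grading_closed)
  have "g \<cdot> (x \<cdot> y) = (psign p *\<^sub>C (x \<cdot> g)) \<cdot> y"
    using x V by (simp add: mul_assoc[symmetric] g_closed in_grading_iff)
  also have "\<dots> = psign p *\<^sub>C (x \<cdot> (g \<cdot> y))"
    using V by (simp add: mul_distrib mul_closed g_closed mul_assoc)
  also have "\<dots> = (psign p * psign q) *\<^sub>C (x \<cdot> y \<cdot> g)"
    using y V by (simp add: in_grading_iff mul_distrib mul_closed g_closed mul_assoc scaleC_scaleC)
  also have "psign p * psign q = psign (p \<noteq> q)" by (simp add: psign_def)
  finally show ?thesis using V by (simp add: in_grading_iff mul_closed)
qed

lemma gpow_hom_closed: "x \<in> P p \<Longrightarrow> x \<cdot> gpow q \<in> P p" "x \<in> P p \<Longrightarrow> gpow q \<cdot> x \<in> P p"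
  using grading_mul[of x p "gpow q" False] grading_mul[of "gpow q" False x p] by (simp_all add: gpow_even)

lemma unity_even: "e \<in> P False" and g_even: "g \<in> P False"
  using gpow_even[of False] gpow_even[of True] by (simp_all add: gpow_def)

text \<open>
  Multilinear maps may be compared on homogeneous arguments, where the sums over components
  collapse and all signs are explicit. Most identities below are proved in this way.
\<close>

lemma linear_hom_ext:
  assumes f: "linear_on V f" and f': "linear_on V f'"
    and eq: "\<And>p x. x \<in> P p \<Longrightarrow> f x = f' x" and x: "x \<in> V"
  shows "f x = f' x"
proof -
  have "f (\<Sum>p\<in>UNIV. hcomp P p x) = f' (\<Sum>p\<in>UNIV. hcomp P p x)"
    using x by (simp add: linear_on_sum[OF f subspace_carr] linear_on_sum[OF f' subspace_carr] hcomp_closed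
        eq[OF hcomp_in_grading])
  then show ?thesis by (simp add: hcomp_sum x)
qed

lemma bilinear_hom_ext:
  assumes F: "bilinear F" and G: "bilinear G"
    and eq: "\<And>p q x y. x \<in> P p \<Longrightarrow> y \<in> P q \<Longrightarrow> F x y = G x y" and x: "x \<in> V" and y: "y \<in> V"
  shows "F x y = G x y"
  by (rule linear_hom_ext[OF bilinear_onD1[OF F y] bilinear_onD1[OF G y] _ x],
      rule linear_hom_ext[OF bilinear_onD2[OF F] bilinear_onD2[OF G] _ y])
    (simp_all add: grading_closed eq)

lemma trilinear_hom_ext:
  assumes F: "trilinear F" and G: "trilinear G"
    and eq: "\<And>p q r x y z. x \<in> P p \<Longrightarrow> y \<in> P q \<Longrightarrow> z \<in> P r \<Longrightarrow> F x y z = G x y z"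
    and x: "x \<in> V" and y: "y \<in> V" and z: "z \<in> V"
  shows "F x y z = G x y z"
  by (rule linear_hom_ext[OF trilinearD(1)[OF F y z] trilinearD(1)[OF G y z] _ x],
      rule bilinear_hom_ext[OF trilinearD(2)[OF F] trilinearD(2)[OF G] _ y z])
    (simp_all add: grading_closed eq)

lemma lift2_hom_cong:
  assumes F: "bilinear F" and G: "bilinear G"
    and eq: "\<And>p q x y. x \<in> P p \<Longrightarrow> y \<in> P q \<Longrightarrow> F x y = G x y"
  shows "lift2 H F t = lift2 H G t"
  by (rule lift2_cong, rule bilinear_hom_ext[OF F G eq])

definition quadrilinear :: "('a \<Rightarrow> 'a \<Rightarrow> 'a \<Rightarrow> 'a \<Rightarrow> 'c::complex_vector) \<Rightarrow> bool" where
  "quadrilinear F \<longleftrightarrow> (\<forall>a\<in>V. \<forall>b\<in>V. bilinear (F a b)) \<and> (\<forall>c\<in>V. \<forall>d\<in>V. bilinear (\<lambda>a b. F a b c d))"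

lemma lift2_lift2_hom_cong:
  assumes F: "quadrilinear F" and G: "quadrilinear G"
    and eq: "\<And>p q p' q' a b c d. a \<in> P p \<Longrightarrow> b \<in> P q \<Longrightarrow> c \<in> P p' \<Longrightarrow> d \<in> P q' \<Longrightarrow> F a b c d = G a b c d"
  shows "lift2 H (\<lambda>a b. lift2 H (F a b) t) s = lift2 H (\<lambda>a b. lift2 H (G a b) t) s"
proof (rule lift2_cong, rule lift2_cong)
  fix a b c d assume *: "a \<in> V" "b \<in> V" "c \<in> V" "d \<in> V"
  show "F a b c d = G a b c d"
  proof (rule bilinear_hom_ext[OF _ _ _ *(3,4)])
    show "bilinear (F a b)" "bilinear (G a b)" using F G * by (simp_all add: quadrilinear_def)
    fix p q c d assume cd: "c \<in> P p" "d \<in> P q"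
    show "F a b c d = G a b c d"
      by (rule bilinear_hom_ext[OF _ _ _ *(1,2), of "\<lambda>a b. F a b c d"])
        (use F G cd in \<open>simp_all add: quadrilinear_def grading_closed eq\<close>)
  qed
qed

lemma quadrilinearI:
  "(\<And>b c d. b \<in> V \<Longrightarrow> c \<in> V \<Longrightarrow> d \<in> V \<Longrightarrow> linear_on V (\<lambda>a. F a b c d)) \<Longrightarrow>
   (\<And>a c d. a \<in> V \<Longrightarrow> c \<in> V \<Longrightarrow> d \<in> V \<Longrightarrow> linear_on V (\<lambda>b. F a b c d)) \<Longrightarrow>
   (\<And>a b d. a \<in> V \<Longrightarrow> b \<in> V \<Longrightarrow> d \<in> V \<Longrightarrow> linear_on V (\<lambda>c. F a b c d)) \<Longrightarrow>
   (\<And>a b c. a \<in> V \<Longrightarrow> b \<in> V \<Longrightarrow> c \<in> V \<Longrightarrow> linear_on V (\<lambda>d. F a b c d)) \<Longrightarrow> quadrilinear F"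
  by (simp add: quadrilinear_def bilinear_onI)

text \<open>
  The homogeneous parts of the tensor square, for the total parity.
\<close>

definition "graded2 r = cvec.span {pure2 H x y | x y p q. x \<in> P p \<and> y \<in> P q \<and> (p \<noteq> q) = r}"

text \<open>
  A Sweedler sum over a homogeneous tensor only sees pairs of the right total parity.
\<close>

lemma lift2_graded_cong:
  assumes F: "bilinear F" and G: "bilinear G" and t: "t \<in> graded2 r"
    and eq: "\<And>p q x y. x \<in> P p \<Longrightarrow> y \<in> P q \<Longrightarrow> (p \<noteq> q) = r \<Longrightarrow> F x y = G x y"
  shows "t \<in> tensor2 H \<and> lift2 H F t = lift2 H G t"
  using t unfolding graded2_def
proof (induction rule: cvec.span_induct_alt)
  case base
  show ?case by (simp add: tensor2_closed lift2_zero F G)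
next
  case (step c s t)
  then obtain x y p q where xy: "s = pure2 H x y" "x \<in> P p" "y \<in> P q" "(p \<noteq> q) = r" by blast
  then have "x \<in> V" "y \<in> V" by (simp_all add: grading_closed)
  then show ?case
    using step.IH xy
    by (simp add: tensor2_closed pure2_in lift2_add lift2_scale F G lift2_pure eq[OF xy(2-4)])
qed

lemmas multilinear_intros =
  bilinear_onI trilinearI quadrilinearI linear_on_id linear_on_plus linear_on_minus linear_on_scaled linear_on_Sum
  linear_on_pure2_left linear_on_pure2_right linear_on_pure3 linear_on_mul linear_on_hcomp
  linear_on_lift2_arg linear_on_lift2_fun 

lemmas closures = carr_closed tensor2_closed pure2_in pure3_in mul_closed unity_closed g_closed gpow_closed hcomp_closed tensor2_sum
  carr_sum subspace_carr subspace_tensor2 grading_closed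

section \<open>The braided product on the tensor square\<close>

text \<open>
  The common generalisation of the flip (\<open>s = 1\<close>) and of the super braiding (\<open>s = -1\<close>); keeping
  \<open>s\<close> as a parameter lets twisting change its sign.
\<close>

definition braid :: "complex \<Rightarrow> 'a braiding" where
  "braid s x y = (\<Sum>p\<in>UNIV. \<Sum>q\<in>UNIV. (if p \<and> q then s else 1) *\<^sub>C pure2 H (hcomp P q y) (hcomp P p x))"

lemma braid_closed: "x \<in> V \<Longrightarrow> y \<in> V \<Longrightarrow> braid s x y \<in> tensor2 H"
  unfolding braid_def by (intro tensor2_sum tensor2_closed pure2_in hcomp_closed)

lemma bilinear_braid: "bilinear (braid s)"
  unfolding braid_def by (intro multilinear_intros; simp add: closures)

lemma braid_homogeneous:
  "x \<in> P p \<Longrightarrow> y \<in> P q \<Longrightarrow> braid s x y = (if p \<and> q then s else 1) *\<^sub>C pure2 H y x"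
  by (cases p; cases q) (simp_all add: braid_def UNIV_bool hcomp_homogeneous pure2_zero grading_closed closures)

lemma braid_one: "x \<in> V \<Longrightarrow> y \<in> V \<Longrightarrow> braid 1 x y = pure2 H y x"
  by (rule bilinear_hom_ext[OF bilinear_braid], (intro multilinear_intros; simp add: closures))
    (simp add: braid_homogeneous scaleC_one)

text \<open>
  The value of \<open>F\<close> on the product of \<open>a \<otimes> b\<close> and \<open>a' \<otimes> b'\<close>.
\<close>

abbreviation braided :: "complex \<Rightarrow> ('a \<Rightarrow> 'a \<Rightarrow> 'c::complex_vector) \<Rightarrow> 'a \<Rightarrow> 'a \<Rightarrow> 'a \<Rightarrow> 'a \<Rightarrow> 'c" where
  "braided s F a b a' b' \<equiv> \<Sum>p\<in>UNIV. \<Sum>q\<in>UNIV. (if p \<and> q then s else 1) *\<^sub>C F (a \<cdot> hcomp P q a') (hcomp P p b \<cdot> b')"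

lemma mul2_braid:
  assumes t: "t \<in> tensor2 H" and t': "t' \<in> tensor2 H"
  shows "mul2 (braid s) H t t' = lift2 H (\<lambda>a b. lift2 H (braided s (pure2 H) a b) t') t"
  unfolding mul2_def
proof (rule lift2_cong, rule lift2_cong)
  fix a b a' b' assume *: "a \<in> V" "b \<in> V" "a' \<in> V" "b' \<in> V"
  have bil: "bilinear (\<lambda>a1 b1. pure2 H (a \<cdot> a1) (b1 \<cdot> b'))"
    using * by (intro multilinear_intros; simp add: closures)
  show "lift2 H (\<lambda>a1 b1. pure2 H (a \<cdot> a1) (b1 \<cdot> b')) (braid s b a')
    = (braided s (pure2 H) a b a' b')"
    using * by (simp add: braid_def lift2_sum[OF bil] lift2_scale[OF bil] lift2_pure[OF bil] closures)
qed

lemma lift2_mul2_braid: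
  assumes t: "t \<in> tensor2 H" and t': "t' \<in> tensor2 H" and F: "bilinear F"
  shows "lift2 H F (mul2 (braid s) H t t') = lift2 H (\<lambda>a b. lift2 H (braided s F a b) t') t"
proof -
  let ?Q = "braided s (pure2 H)"
  have bil: "bilinear (\<lambda>a b. lift2 H (?Q a b) t')"
    using t' by (intro multilinear_intros; simp add: closures; intro multilinear_intros; simp add: closures)
  have bil2: "bilinear (?Q a b)" if "a \<in> V" "b \<in> V" for a b
    using that by (intro multilinear_intros; simp add: closures)
  have "lift2 H F (mul2 (braid s) H t t') = lift2 H (\<lambda>a b. lift2 H F (lift2 H (?Q a b) t')) t"
    unfolding mul2_braid[OF t t']
    by (rule lift2_lift2[OF t bil F]) (rule lift2_in[OF t' bil2 subspace_tensor2], simp_all add: closures)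
  also have "\<dots> = lift2 H (\<lambda>a b. lift2 H (\<lambda>a' b'. lift2 H F (?Q a b a' b')) t') t"
    by (intro lift2_cong lift2_lift2[OF t' bil2 F] tensor2_sum tensor2_closed pure2_in mul_closed hcomp_closed)
  also have "\<dots> = lift2 H (\<lambda>a b. lift2 H (braided s F a b) t') t"
    by (intro lift2_cong) (simp add: lift2_sum[OF F] lift2_scale[OF F] lift2_pure[OF F] closures)
  finally show ?thesis .
qed

text \<open>
  Even elements pass every factor without a sign, so multiplication by \<open>x \<otimes> y\<close> with even \<open>x\<close>, \<open>y\<close>
  is componentwise for every \<open>s\<close>. This applies to \<open>g \<otimes> g\<close> and to the summands of \<open>R\<^sub>g\<close>.
\<close>

lemma mul2_braid_even:
  assumes t: "t \<in> tensor2 H" and x: "x \<in> P False" and y: "y \<in> P False"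
  shows "mul2 (braid s) H (pure2 H x y) t = lift2 H (\<lambda>a b. pure2 H (x \<cdot> a) (y \<cdot> b)) t"
    and "mul2 (braid s) H t (pure2 H x y) = lift2 H (\<lambda>a b. pure2 H (a \<cdot> x) (b \<cdot> y)) t"
proof -
  note V = x[THEN grading_closed] y[THEN grading_closed]
  have 1: "bilinear (\<lambda>a b. lift2 H (braided s (pure2 H) a b) u)"
    if "u \<in> tensor2 H" for u
    using that by (intro multilinear_intros; simp add: closures; intro multilinear_intros; simp add: closures)
  show "mul2 (braid s) H (pure2 H x y) t = lift2 H (\<lambda>a b. pure2 H (x \<cdot> a) (y \<cdot> b)) t"
    unfolding mul2_braid[OF pure2_in[OF V] t] lift2_pure[OF 1[OF t] V]
  proof (rule lift2_hom_cong)
    fix p q a b assume *: "a \<in> P p" "b \<in> P q"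
    then show "(\<Sum>p\<in>UNIV. \<Sum>q\<in>UNIV. (if p \<and> q then s else 1) *\<^sub>C pure2 H (x \<cdot> hcomp P q a) (hcomp P p y \<cdot> b)) = pure2 H (x \<cdot> a) (y \<cdot> b)"
      using V by (cases p) (simp_all add: UNIV_bool hcomp_homogeneous[OF y] hcomp_homogeneous pure2_zero closures mul_distrib scaleC_one)
  qed (use V in \<open>intro multilinear_intros; simp add: closures\<close>)+
  have 2: "bilinear (braided s (pure2 H) a b)"
    if "a \<in> V" "b \<in> V" for a b
    using that by (intro multilinear_intros; simp add: closures)
  have "mul2 (braid s) H t (pure2 H x y) = lift2 H (\<lambda>a b. 
      \<Sum>p\<in>UNIV. \<Sum>q\<in>UNIV. (if p \<and> q then s else 1) *\<^sub>C pure2 H (a \<cdot> hcomp P q x) (hcomp P p b \<cdot> y)) t"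
    unfolding mul2_braid[OF t pure2_in[OF V]] by (rule lift2_cong) (rule lift2_pure[OF 2 V])
  also have "\<dots> = lift2 H (\<lambda>a b. pure2 H (a \<cdot> x) (b \<cdot> y)) t"
  proof (rule lift2_hom_cong)
    fix p q a b assume *: "a \<in> P p" "b \<in> P q"
    then show "(\<Sum>p\<in>UNIV. \<Sum>q\<in>UNIV. (if p \<and> q then s else 1) *\<^sub>C pure2 H (a \<cdot> hcomp P q x) (hcomp P p b \<cdot> y)) = pure2 H (a \<cdot> x) (b \<cdot> y)"
      using V by (cases q) (simp_all add: UNIV_bool hcomp_homogeneous[OF x] hcomp_homogeneous pure2_zero closures mul_distrib scaleC_one)
  qed (use V in \<open>intro multilinear_intros; simp add: closures\<close>)+
  finally show "mul2 (braid s) H t (pure2 H x y) = lift2 H (\<lambda>a b. pure2 H (a \<cdot> x) (b \<cdot> y)) t" .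
qed

end

section \<open>Hopf algebras with a parity element\<close>

lemma hopf_in_involutive_algebra:
  assumes "hopf_in c H" "g \<in> carr H" "mul H g g = unity H"
  shows "involutive_algebra H g"
  using assms unfolding hopf_in_def Let_def by unfold_locales simp_all

text \<open>
  Both sides of the correspondence at once: \<open>s = 1\<close> gives an ordinary Hopf algebra with a
  grouplike involution, \<open>s = -1\<close> a Hopf superalgebra with a parity element. The structure maps are
  even because they commute with conjugation by \<open>g\<close>.
\<close>

locale parity_hopf = involutive_algebra H g
  for H :: "('a::complex_vector, 'm) hopf_scheme" and g :: 'a +
  fixes s :: complex
  assumes hopf: "hopf_in (braid s) H"
    and comul_g: "comul H g = pure2 H g g"
    and g_nonzero: "g \<noteq> 0"
begin

abbreviation "D \<equiv> comul H"
abbreviation "\<epsilon> \<equiv> counit H"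
abbreviation "S \<equiv> antipode H"

lemma comul_linear: "linear_on V D"
  and comul_closed: "x \<in> V \<Longrightarrow> D x \<in> tensor2 H"
  and counit_linear: "linear_on V \<epsilon>"
  and coassoc: "h \<in> V \<Longrightarrow> lift2 H (\<lambda>x y. lift2 H (\<lambda>a b. pure3 H a b y) (D x)) (D h)
              = lift2 H (\<lambda>x y. lift2 H (\<lambda>a b. pure3 H x a b) (D y)) (D h)"
  and counit_left: "h \<in> V \<Longrightarrow> lift2 H (\<lambda>x y. \<epsilon> x *\<^sub>C y) (D h) = h"
  and counit_right: "h \<in> V \<Longrightarrow> lift2 H (\<lambda>x y. \<epsilon> y *\<^sub>C x) (D h) = h"
  and comul_unity: "D e = pure2 H e e"
  and comul_mul: "x \<in> V \<Longrightarrow> y \<in> V \<Longrightarrow> D (x \<cdot> y) = mul2 (braid s) H (D x) (D y)"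
  and counit_unity: "\<epsilon> e = 1"
  and counit_mul: "x \<in> V \<Longrightarrow> y \<in> V \<Longrightarrow> \<epsilon> (x \<cdot> y) = \<epsilon> x * \<epsilon> y"
  and antipode_linear: "linear_on V S"
  and antipode_closed: "x \<in> V \<Longrightarrow> S x \<in> V"
  and antipode_left: "h \<in> V \<Longrightarrow> lift2 H (\<lambda>x y. S x \<cdot> y) (D h) = \<epsilon> h *\<^sub>C e"
  and antipode_right: "h \<in> V \<Longrightarrow> lift2 H (\<lambda>x y. x \<cdot> S y) (D h) = \<epsilon> h *\<^sub>C e"
  using hopf unfolding hopf_in_def Let_def by blast+

lemmas comul_distrib = linear_on_add[OF comul_linear] linear_on_scale[OF comul_linear]
lemmas counit_distrib = linear_on_add[OF counit_linear] linear_on_scale[OF counit_linear, unfolded scaleC_complex_def]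
lemmas antipode_distrib = linear_on_add[OF antipode_linear] linear_on_scale[OF antipode_linear]

lemma linear_on_comul: "linear_on U f \<Longrightarrow> (\<And>x. x \<in> U \<Longrightarrow> f x \<in> V) \<Longrightarrow> linear_on U (\<lambda>x. D (f x))"
  and linear_on_antipode: "linear_on U f \<Longrightarrow> (\<And>x. x \<in> U \<Longrightarrow> f x \<in> V) \<Longrightarrow> linear_on U (\<lambda>x. S (f x))"
  and linear_on_counit: "linear_on U f \<Longrightarrow> (\<And>x. x \<in> U \<Longrightarrow> f x \<in> V) \<Longrightarrow> linear_on U (\<lambda>x. \<epsilon> (f x))"
  using linear_on_comp[OF comul_linear] linear_on_comp[OF antipode_linear] linear_on_comp[OF counit_linear] by blast+

lemmas hopf_intros = multilinear_intros linear_on_comul linear_on_antipode linear_on_counit linear_on_functional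
lemmas hopf_closures = closures comul_closed antipode_closed

lemma bilinear_pure3:
  "y \<in> V \<Longrightarrow> bilinear (\<lambda>a b. pure3 H a b y)" "y \<in> V \<Longrightarrow> bilinear (\<lambda>a b. pure3 H y a b)"
  "y \<in> V \<Longrightarrow> bilinear (\<lambda>a b. pure3 H a y b)"
  by (intro hopf_intros; simp add: hopf_closures)+

lemma bilinear_comul3:
  "bilinear (\<lambda>x y. lift2 H (\<lambda>a b. pure3 H a b y) (D x))"
  "bilinear (\<lambda>x y. lift2 H (\<lambda>a b. pure3 H x a b) (D y))"
  by (intro hopf_intros; simp add: hopf_closures bilinear_pure3; intro hopf_intros; simp add: hopf_closures)+

lemma comul3_closed:
  "x \<in> V \<Longrightarrow> y \<in> V \<Longrightarrow> lift2 H (\<lambda>a b. pure3 H a b y) (D x) \<in> tensor3"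
  "x \<in> V \<Longrightarrow> y \<in> V \<Longrightarrow> lift2 H (\<lambda>a b. pure3 H x a b) (D y) \<in> tensor3"
  by (rule lift2_in[OF comul_closed _ subspace_tensor3]; simp add: pure3_in bilinear_pure3)+

lemma lift3_comul:
  assumes T: "trilinear T" and uv: "u \<in> V" "v \<in> V"
  shows "lift3 H T (lift2 H (\<lambda>a b. pure3 H a b v) (D u)) = lift2 H (\<lambda>p q. T p q v) (D u)"
    and "lift3 H T (lift2 H (\<lambda>a b. pure3 H v a b) (D u)) = lift2 H (T v) (D u)"
proof -
  have "lift3 H T (lift2 H (\<lambda>a b. pure3 H a b v) (D u)) = lift2 H (\<lambda>p q. lift3 H T (pure3 H p q v)) (D u)"
    by (rule linear_lift2[OF _ bilinear_pure3(1) subspace_tensor3 _ lift3_linear[OF T]])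
      (simp_all add: uv pure3_in hopf_closures)
  also have "\<dots> = lift2 H (\<lambda>p q. T p q v) (D u)"
    using uv by (intro lift2_cong) (simp add: lift3_pure[OF T])
  finally show "lift3 H T (lift2 H (\<lambda>a b. pure3 H a b v) (D u)) = lift2 H (\<lambda>p q. T p q v) (D u)" .
  have "lift3 H T (lift2 H (\<lambda>a b. pure3 H v a b) (D u)) = lift2 H (\<lambda>p q. lift3 H T (pure3 H v p q)) (D u)"
    by (rule linear_lift2[OF _ bilinear_pure3(2) subspace_tensor3 _ lift3_linear[OF T]])
      (simp_all add: uv pure3_in hopf_closures)
  also have "\<dots> = lift2 H (T v) (D u)"
    using uv by (intro lift2_cong) (simp add: lift3_pure[OF T])
  finally show "lift3 H T (lift2 H (\<lambda>a b. pure3 H v a b) (D u)) = lift2 H (T v) (D u)" .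
qed

lemma lift3_comul3:
  assumes T: "trilinear T" and t: "t \<in> tensor2 H"
  shows "lift3 H T (lift2 H (\<lambda>x y. lift2 H (\<lambda>a b. pure3 H a b y) (D x)) t)
      = lift2 H (\<lambda>x y. lift2 H (\<lambda>a b. T a b y) (D x)) t"
    and "lift3 H T (lift2 H (\<lambda>x y. lift2 H (\<lambda>a b. pure3 H x a b) (D y)) t)
      = lift2 H (\<lambda>x y. lift2 H (T x) (D y)) t"
proof -
  show "lift3 H T (lift2 H (\<lambda>x y. lift2 H (\<lambda>a b. pure3 H a b y) (D x)) t)
      = lift2 H (\<lambda>x y. lift2 H (\<lambda>a b. T a b y) (D x)) t"
    by (rule trans[OF linear_lift2[OF t bilinear_comul3(1) subspace_tensor3 comul3_closed(1) lift3_linear[OF T]] lift2_cong],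
        assumption, assumption, rule lift3_comul(1)[OF T])
  show "lift3 H T (lift2 H (\<lambda>x y. lift2 H (\<lambda>a b. pure3 H x a b) (D y)) t)
      = lift2 H (\<lambda>x y. lift2 H (T x) (D y)) t"
    by (rule trans[OF linear_lift2[OF t bilinear_comul3(2) subspace_tensor3 comul3_closed(2) lift3_linear[OF T]] lift2_cong],
        assumption, assumption, rule lift3_comul(2)[OF T])
qed

text \<open>
  Coassociativity in the form in which it is used: it reassociates any trilinear Sweedler sum.
\<close>

lemma coassoc_lift:
  assumes T: "trilinear T" and h: "h \<in> V"
  shows "lift2 H (\<lambda>x y. lift2 H (\<lambda>a b. T a b y) (D x)) (D h) = lift2 H (\<lambda>x y. lift2 H (T x) (D y)) (D h)"
  using coassoc[OF h] lift3_comul3[OF T comul_closed[OF h]] by simp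

lemma counit_g: "\<epsilon> g = 1"
proof -
  have "g = \<epsilon> g *\<^sub>C g"
    using counit_left[OF g_closed] unfolding comul_g
    by (subst (asm) lift2_pure; (intro hopf_intros)?; simp add: hopf_closures)
  then have "(1 - \<epsilon> g) *\<^sub>C g = 0" by (simp add: cvec.scale_left_diff_distrib scaleC_one)
  then show ?thesis using g_nonzero by simp
qed

lemma counit_gpow: "\<epsilon> (gpow q) = 1"
  by (simp add: gpow_def counit_g counit_unity)

lemma counit_odd: "x \<in> P True \<Longrightarrow> \<epsilon> x = 0"
proof -
  assume x: "x \<in> P True"
  then have "\<epsilon> (g \<cdot> x) = \<epsilon> ((-1) *\<^sub>C (x \<cdot> g))" by (simp add: in_grading_iff psign_def)
  then have "\<epsilon> x = - \<epsilon> x"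
    using x by (simp add: counit_mul hopf_closures counit_g linear_on_scale[OF counit_linear, of "x \<cdot> g" "-1"] scaleC_complex_def
       del: cvec.scale_minus_left)
  then show ?thesis by simp
qed

lemma comul_mul_gpow:
  assumes x: "x \<in> V"
  shows "D (x \<cdot> gpow q) = lift2 H (\<lambda>a b. pure2 H (a \<cdot> gpow q) (b \<cdot> gpow q)) (D x)"
    and "D (gpow q \<cdot> x) = lift2 H (\<lambda>a b. pure2 H (gpow q \<cdot> a) (gpow q \<cdot> b)) (D x)"
proof -
  have *: "D (gpow q) = pure2 H (gpow q) (gpow q)" by (simp add: gpow_def comul_g comul_unity)
  show "D (x \<cdot> gpow q) = lift2 H (\<lambda>a b. pure2 H (a \<cdot> gpow q) (b \<cdot> gpow q)) (D x)"
    "D (gpow q \<cdot> x) = lift2 H (\<lambda>a b. pure2 H (gpow q \<cdot> a) (gpow q \<cdot> b)) (D x)"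
    using x by (simp_all add: comul_mul hopf_closures * mul2_braid_even gpow_even)
qed

lemma lift2_comul_mul_gpow:
  assumes x: "x \<in> V" and F: "bilinear F"
  shows "lift2 H F (D (x \<cdot> gpow q)) = lift2 H (\<lambda>a b. F (a \<cdot> gpow q) (b \<cdot> gpow q)) (D x)"
    and "lift2 H F (D (gpow q \<cdot> x)) = lift2 H (\<lambda>a b. F (gpow q \<cdot> a) (gpow q \<cdot> b)) (D x)"
proof -
  have 1: "bilinear (\<lambda>a b. pure2 H (a \<cdot> gpow q) (b \<cdot> gpow q))"
      "bilinear (\<lambda>a b. pure2 H (gpow q \<cdot> a) (gpow q \<cdot> b))"
    by (intro hopf_intros; simp add: hopf_closures)+
  show "lift2 H F (D (x \<cdot> gpow q)) = lift2 H (\<lambda>a b. F (a \<cdot> gpow q) (b \<cdot> gpow q)) (D x)"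
    "lift2 H F (D (gpow q \<cdot> x)) = lift2 H (\<lambda>a b. F (gpow q \<cdot> a) (gpow q \<cdot> b)) (D x)"
    unfolding comul_mul_gpow[OF x]
    using lift2_lift2[OF comul_closed[OF x] 1(1) F] lift2_lift2[OF comul_closed[OF x] 1(2) F]
    by (simp_all add: hopf_closures) (intro lift2_cong lift2_pure F; simp add: hopf_closures)+
qed

text \<open>
  \<open>\<Delta>\<close> commutes with conjugation by \<open>g\<close>, so \<open>\<Delta> x\<close> equals its own average over the conjugation of
  both factors, up to the sign of \<open>x\<close>; averaging kills the pairs of the wrong total parity.
\<close>

lemma comul_graded: "x \<in> P r \<Longrightarrow> D x \<in> graded2 r"
proof -
  assume x: "x \<in> P r"
  then have xV: "x \<in> V" by (rule grading_closed)
  let ?F = "\<lambda>a b. pure2 H (g \<cdot> a \<cdot> g) (g \<cdot> b \<cdot> g)"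
  let ?G = "\<lambda>a b. (1/2) *\<^sub>C (pure2 H a b + psign r *\<^sub>C ?F a b)"
  \<comment> \<open>the projection onto the pairs of total parity \<open>r\<close>\<close>
  let ?Q = "\<lambda>a b. \<Sum>p\<in>UNIV. \<Sum>q\<in>UNIV. if (p \<noteq> q) = r then pure2 H (hcomp P p a) (hcomp P q b) else 0"
  have "bilinear (\<lambda>a b. if (p \<noteq> q) = r then pure2 H (hcomp P p a) (hcomp P q b) else 0)" for p q
    by (cases "(p \<noteq> q) = r"; simp; (intro hopf_intros; simp add: hopf_closures)?; simp add: bilinear_on_def linear_on_def)
  then have Q: "bilinear ?Q"
    by (intro bilinear_onI linear_on_Sum) (simp_all add: bilinear_on_def)
  have F: "bilinear ?F" by (intro hopf_intros; simp add: hopf_closures)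
  have F1: "bilinear (\<lambda>a b. pure2 H (a \<cdot> gpow True) (b \<cdot> gpow True))" by (intro hopf_intros; simp add: hopf_closures)
  have G: "bilinear ?G" by (intro hopf_intros; simp add: hopf_closures)
  have I: "bilinear (pure2 H)" by (intro hopf_intros; simp add: hopf_closures)
  have "D (gpow True \<cdot> x \<cdot> gpow True) = lift2 H ?F (D x)"
    using lift2_comul_mul_gpow(2)[OF xV, of "\<lambda>a b. pure2 H (a \<cdot> gpow True) (b \<cdot> gpow True)" True] comul_mul_gpow(1)[of "gpow True \<cdot> x" True] F1
    by (simp add: hopf_closures xV gpow_def)
  moreover have "gpow True \<cdot> x \<cdot> gpow True = psign r *\<^sub>C x"
    using x by (simp add: gpow_def in_grading_iff mul_distrib hopf_closures g_g_mul)
  ultimately have "psign r *\<^sub>C D x = lift2 H ?F (D x)"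
    using xV by (simp add: linear_on_scale[OF comul_linear])
  \<comment> \<open>the sign is its own inverse\<close>
  then have "psign r *\<^sub>C psign r *\<^sub>C D x = psign r *\<^sub>C lift2 H ?F (D x)" by simp
  then have 1: "D x = psign r *\<^sub>C lift2 H ?F (D x)"
    unfolding scaleC_scaleC psign_square by (simp add: scaleC_one)
  have "lift2 H ?G (D x) = (1/2) *\<^sub>C (D x + psign r *\<^sub>C lift2 H ?F (D x))"
    by (rule lift2_ext[OF lift2_linear[OF G]])
     (intro hopf_intros lift2_linear F, auto simp: lift2_pure[OF G] lift2_pure[OF F] xV hopf_closures)
  also have "\<dots> = (1/2 + 1/2) *\<^sub>C D x"
    unfolding 1[symmetric] scaleC_add_left scaleC_add_right ..
  finally have "D x = lift2 H ?G (D x)" by (simp add: scaleC_one)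
  also have "\<dots> = lift2 H (?Q) (D x)"
  proof (rule lift2_hom_cong[OF G Q])
    fix p q a b assume *: "a \<in> P p" "b \<in> P q"
    then have V: "a \<in> V" "b \<in> V" by (simp_all add: grading_closed)
    have "?F a b = psign p *\<^sub>C psign q *\<^sub>C pure2 H a b"
      using * V linear_on_scale[OF linear_on_pure2_left[OF linear_on_id]] linear_on_scale[OF linear_on_pure2_right[OF linear_on_id]]
      by (simp add: in_grading_iff mul_distrib hopf_closures g_g_mul)
    then have "?G a b = (1/2) *\<^sub>C ((1 + psign r * psign p * psign q) *\<^sub>C pure2 H a b)"
      by (simp add: scaleC_add_left scaleC_scaleC scaleC_one mult.assoc)
    also have "\<dots> = (if (p \<noteq> q) = r then pure2 H a b else 0)"
      by (auto simp: scaleC_scaleC psign_def scaleC_one)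
    also have "\<dots> = (?Q a b)"
      using * V by (cases p; cases q; cases r) (simp_all add: UNIV_bool hcomp_homogeneous pure2_zero hopf_closures)
    finally show "?G a b = (?Q a b)" .
  qed
  also have "\<dots> \<in> graded2 r"
  proof (rule lift2_in[OF comul_closed[OF xV] Q])
    show "cvec.subspace (graded2 r)" by (simp add: graded2_def)
    fix a b assume "a \<in> V" "b \<in> V"
    then have "pure2 H (hcomp P p a) (hcomp P q b) \<in> graded2 r" if "(p \<noteq> q) = r" for p q
      unfolding graded2_def using that hcomp_in_grading by (intro cvec.span_base) blast
    moreover have "0 \<in> graded2 r" by (simp add: graded2_def cvec.span_zero)
    ultimately show "(?Q a b) \<in> graded2 r"
      by (intro cvec.subspace_sum) (simp_all add: graded2_def)
  qed
  finally show ?thesis .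
qed

lemma lift2_comul_cong:
  assumes "bilinear F" "bilinear G" "x \<in> P r"
    and "\<And>p q x y. x \<in> P p \<Longrightarrow> y \<in> P q \<Longrightarrow> (p \<noteq> q) = r \<Longrightarrow> F x y = G x y"
  shows "lift2 H F (D x) = lift2 H G (D x)"
  using lift2_graded_cong[OF assms(1,2) comul_graded[OF assms(3)] assms(4)] by simp

text \<open>
  As \<open>\<Delta>\<close> is even, taking a homogeneous component before \<open>\<Delta>\<close> amounts to keeping the terms of that
  total parity after it.
\<close>

lemma lift2_comul_hcomp:
  assumes F: "bilinear F" and y: "y \<in> V"
  shows "lift2 H F (D (hcomp P q y)) = lift2 H (\<lambda>a b. \<Sum>u\<in>UNIV. F (hcomp P u a) (hcomp P (u \<noteq> q) b)) (D y)"
proof (rule linear_hom_ext[OF _ _ _ y])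
  have G: "bilinear (\<lambda>a b. \<Sum>u\<in>UNIV. F (hcomp P u a) (hcomp P (u \<noteq> q) b))"
    by (intro hopf_intros linear_on_bilinear[OF F]; simp add: hopf_closures)
  show "linear_on V (\<lambda>y. lift2 H F (D (hcomp P q y)))"
    by (intro hopf_intros F; simp add: hopf_closures)
  show "linear_on V (\<lambda>y. lift2 H (\<lambda>a b. \<Sum>u\<in>UNIV. F (hcomp P u a) (hcomp P (u \<noteq> q) b)) (D y))"
    by (intro hopf_intros linear_on_bilinear[OF F]; simp add: hopf_closures)
  fix p x assume x: "x \<in> P p"
  show "lift2 H F (D (hcomp P q x)) = lift2 H (\<lambda>a b. \<Sum>u\<in>UNIV. F (hcomp P u a) (hcomp P (u \<noteq> q) b)) (D x)"
  proof (cases "q = p")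
    case True
    have "lift2 H F (D x) = lift2 H (\<lambda>a b. \<Sum>u\<in>UNIV. F (hcomp P u a) (hcomp P (u \<noteq> q) b)) (D x)"
      by (rule lift2_comul_cong[OF F G x])
       (use True in \<open>auto simp: UNIV_bool hcomp_homogeneous linear_on_zero[OF bilinear_onD1[OF F]] linear_on_zero[OF bilinear_onD2[OF F]] hopf_closures\<close>)
    then show ?thesis using True x by (simp add: hcomp_homogeneous)
  next
    case False
    have z: "bilinear (\<lambda>a b. 0)" by (simp add: bilinear_on_def linear_on_def)
    have "lift2 H (\<lambda>a b. \<Sum>u\<in>UNIV. F (hcomp P u a) (hcomp P (u \<noteq> q) b)) (D x) = lift2 H (\<lambda>a b. 0) (D x)"
      by (rule lift2_comul_cong[OF G z x])
       (use False in \<open>auto simp: UNIV_bool hcomp_homogeneous linear_on_zero[OF bilinear_onD1[OF F]] linear_on_zero[OF bilinear_onD2[OF F]] hopf_closures\<close>)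
    also have "\<dots> = 0"
      using lift2_sum_fun[of "D x" "{}" undefined] x by (simp add: hopf_closures)
    finally show ?thesis using False x
      by (simp add: hcomp_homogeneous linear_on_zero[OF comul_linear] subspace_carr lift2_zero F)
  qed
qed

text \<open>
  For the convolution product, \<open>f = f * (id * f') = (f * id) * f' = f'\<close>. With the antipode as one of the
  two maps this identifies the other one as the antipode.
\<close>

lemma convolution_inverse_unique:
  assumes f: "linear_on V f" "\<And>x. x \<in> V \<Longrightarrow> f x \<in> V" and f': "linear_on V f'" "\<And>x. x \<in> V \<Longrightarrow> f' x \<in> V"
    and left: "\<And>h. h \<in> V \<Longrightarrow> lift2 H (\<lambda>x y. f x \<cdot> y) (D h) = \<epsilon> h *\<^sub>C e"
    and right: "\<And>h. h \<in> V \<Longrightarrow> lift2 H (\<lambda>x y. x \<cdot> f' y) (D h) = \<epsilon> h *\<^sub>C e" and h: "h \<in> V"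
  shows "f h = f' h"
proof -
  note lin = linear_on_comp[OF f(1)] linear_on_comp[OF f'(1)]
  have "f h = f (lift2 H (\<lambda>x y. \<epsilon> y *\<^sub>C x) (D h))" by (simp add: counit_right h)
  also have "\<dots> = lift2 H (\<lambda>x y. f (\<epsilon> y *\<^sub>C x)) (D h)"
    by (rule linear_lift2[OF _ _ subspace_carr _ f(1)]) (intro hopf_intros | simp add: hopf_closures h)+
  also have "\<dots> = lift2 H (\<lambda>x y. f x \<cdot> lift2 H (\<lambda>a b. a \<cdot> f' b) (D y)) (D h)"
    by (rule lift2_cong) (simp add: right mul_distrib hopf_closures f mul_unity linear_on_scale[OF f(1)])
  also have "\<dots> = lift2 H (\<lambda>x y. lift2 H (\<lambda>a b. f x \<cdot> (a \<cdot> f' b)) (D y)) (D h)"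
  proof (rule lift2_cong)
    fix x y assume "x \<in> V" "y \<in> V"
    then show "f x \<cdot> lift2 H (\<lambda>a b. a \<cdot> f' b) (D y) = lift2 H (\<lambda>a b. f x \<cdot> (a \<cdot> f' b)) (D y)"
      by (intro linear_lift2[OF _ _ subspace_carr]) (intro hopf_intros f' | simp add: hopf_closures f f')+
  qed
  also have "\<dots> = lift2 H (\<lambda>x y. lift2 H (\<lambda>a b. f a \<cdot> (b \<cdot> f' y)) (D x)) (D h)"
    by (rule coassoc_lift[symmetric, OF _ h]) (intro hopf_intros lin; simp add: hopf_closures f f')
  also have "\<dots> = lift2 H (\<lambda>x y. lift2 H (\<lambda>a b. f a \<cdot> b) (D x) \<cdot> f' y) (D h)"
  proof (rule lift2_cong)
    fix x y assume *: "x \<in> V" "y \<in> V"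
    have "lift2 H (\<lambda>a b. f a \<cdot> b) (D x) \<cdot> f' y = lift2 H (\<lambda>a b. f a \<cdot> b \<cdot> f' y) (D x)"
      using * by (intro linear_lift2[OF _ _ subspace_carr, where f = "\<lambda>z. z \<cdot> f' y"])
        (intro hopf_intros f | simp add: hopf_closures f f')+
    also have "\<dots> = lift2 H (\<lambda>a b. f a \<cdot> (b \<cdot> f' y)) (D x)"
      using * by (intro lift2_cong) (simp add: mul_assoc hopf_closures f f')
    finally show "lift2 H (\<lambda>a b. f a \<cdot> (b \<cdot> f' y)) (D x) = lift2 H (\<lambda>a b. f a \<cdot> b) (D x) \<cdot> f' y" ..
  qed
  also have "\<dots> = lift2 H (\<lambda>x y. f' (\<epsilon> x *\<^sub>C y)) (D h)"
    by (rule lift2_cong) (simp add: left mul_distrib mul_unity hopf_closures f' linear_on_scale[OF f'(1)])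
  also have "\<dots> = f' (lift2 H (\<lambda>x y. \<epsilon> x *\<^sub>C y) (D h))"
    by (rule linear_lift2[OF _ _ subspace_carr _ f'(1), symmetric]) (intro hopf_intros | simp add: hopf_closures h)+
  finally show ?thesis by (simp add: counit_left h)
qed

end

section \<open>The twist\<close>

lemma hopf_in_cong:
  assumes "carr H' = carr H" "mul H' = mul H" "unity H' = unity H" "comul H' = comul H"
    "counit H' = counit H" "antipode H' = antipode H"
  shows "hopf_in c H' = hopf_in c H"
  using assms by (simp add: hopf_in_def mul2_def lift2_def lift3_def pure2_def pure3_def tensor2_def)

lemma mul2_cong:
  assumes "\<And>x y. x \<in> carr H \<Longrightarrow> y \<in> carr H \<Longrightarrow> c x y = c' x y"
  shows "mul2 c H = mul2 c' H"
proof (rule ext, rule ext)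
  fix s t
  show "mul2 c H s t = mul2 c' H s t"
    unfolding mul2_def lift2_def
    by (rule fun_cong[OF lift_cong], rule fun_cong[OF lift_cong]) (simp add: assms)
qed

lemma hopf_in_braiding_cong:
  assumes "\<And>x y. x \<in> carr H \<Longrightarrow> y \<in> carr H \<Longrightarrow> c x y = c' x y"
  shows "hopf_in c H = hopf_in c' H"
  using mul2_cong[of H c c'] assms by (simp add: hopf_in_def)

definition twist :: "('a::complex_vector, 'm) hopf_scheme \<Rightarrow> (bool \<Rightarrow> 'a set) \<Rightarrow> 'a \<Rightarrow> 'a hopf" where
  "twist H P g = \<lparr>carr = carr H, mul = mul H, unity = unity H, comul = twisted_comul H P g,
     counit = counit H, antipode = twisted_antipode H P g\<rparr>"

lemma twist_simps:
  "carr (twist H P g) = carr H" "mul (twist H P g) = mul H" "unity (twist H P g) = unity H"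
  "comul (twist H P g) = twisted_comul H P g" "counit (twist H P g) = counit H"
  "antipode (twist H P g) = twisted_antipode H P g"
  "pure2 (twist H P g) = pure2 H" "tensor2 (twist H P g) = tensor2 H" "lift2 (twist H P g) = lift2 H"
  "pure3 (twist H P g) = pure3 H"
  by (simp_all add: twist_def pure2_def tensor2_def lift2_def pure3_def fun_eq_iff)

lemma mul2_twist: "mul2 c (twist H P g) = mul2 c H"
  by (simp add: mul2_def twist_simps fun_eq_iff)

context involutive_algebra
begin

lemma mul2_flip: "mul2 (flip H) H = mul2 (braid 1) H"
  by (rule mul2_cong) (simp add: flip_def braid_one)

text \<open>
  The map \<open>\<tau> (a \<otimes> b) = a g\<^sup>q \<otimes> b\<close> for \<open>b\<close> of parity \<open>q\<close>. It is an involution because \<open>g\<^sup>2 = 1\<close>.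
\<close>

definition tau :: "'a tensor2 \<Rightarrow> 'a tensor2" where
  "tau = lift2 H (\<lambda>a b. \<Sum>q\<in>UNIV. pure2 H (a \<cdot> gpow q) (hcomp P q b))"

lemma bilinear_tau:
  assumes F: "bilinear F"
  shows "bilinear (\<lambda>a b. \<Sum>q\<in>UNIV. F (a \<cdot> gpow q) (hcomp P q b))"
  by (intro multilinear_intros linear_on_bilinear[OF F]; simp add: closures)

lemma bilinear_pure2: "bilinear (pure2 H)"
  by (intro multilinear_intros; simp)

lemma tau_closed: "t \<in> tensor2 H \<Longrightarrow> tau t \<in> tensor2 H"
  unfolding tau_def
  by (rule lift2_in[OF _ bilinear_tau[OF bilinear_pure2] subspace_tensor2]) (simp_all add: closures)

lemma tau_linear: "linear_on (tensor2 H) tau"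
  unfolding tau_def by (rule lift2_linear[OF bilinear_tau[OF bilinear_pure2]])

lemma lift2_tau:
  assumes F: "bilinear F" and t: "t \<in> tensor2 H"
  shows "lift2 H F (tau t) = lift2 H (\<lambda>a b. \<Sum>q\<in>UNIV. F (a \<cdot> gpow q) (hcomp P q b)) t"
proof -
  have "lift2 H F (tau t) = lift2 H (\<lambda>a b. lift2 H F (\<Sum>q\<in>UNIV. pure2 H (a \<cdot> gpow q) (hcomp P q b))) t"
    unfolding tau_def by (rule lift2_lift2[OF t bilinear_tau[OF bilinear_pure2] F]) (simp add: closures)
  also have "\<dots> = lift2 H (\<lambda>a b. \<Sum>q\<in>UNIV. F (a \<cdot> gpow q) (hcomp P q b)) t"
    by (rule lift2_cong) (simp add: lift2_sum[OF F] lift2_pure[OF F] closures)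
  finally show ?thesis .
qed

lemma tau_pure:
  assumes a: "a \<in> V" and b: "b \<in> P q"
  shows "tau (pure2 H a b) = pure2 H (a \<cdot> gpow q) b"
  using assms unfolding tau_def
  by (subst lift2_pure[OF bilinear_tau[OF bilinear_pure2]])
   (auto simp: closures UNIV_bool hcomp_homogeneous pure2_zero)

lemma tau_tau: "t \<in> tensor2 H \<Longrightarrow> tau (tau t) = t"
proof -
  assume t: "t \<in> tensor2 H"
  have "tau (tau t) = lift2 H (\<lambda>a b. \<Sum>q\<in>UNIV. \<Sum>r\<in>UNIV. pure2 H (a \<cdot> gpow q \<cdot> gpow r) (hcomp P r (hcomp P q b))) t"
    unfolding tau_def[THEN fun_cong, of "tau t"] by (rule lift2_tau[OF bilinear_tau[OF bilinear_pure2] t])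
  also have "\<dots> = lift2 H (pure2 H) t"
  proof (rule lift2_hom_cong)
    fix p q a b assume *: "a \<in> P p" "b \<in> P q"
    then show "(\<Sum>q\<in>UNIV. \<Sum>r\<in>UNIV. pure2 H (a \<cdot> gpow q \<cdot> gpow r) (hcomp P r (hcomp P q b))) = pure2 H a b"
      by (cases q) (simp_all add: UNIV_bool hcomp_homogeneous if_distrib[of "hcomp P _"] pure2_zero closures gpow_mul2 
         gpow_False mul_unity linear_on_zero[OF linear_on_hcomp_V])
  qed (intro multilinear_intros; simp add: closures)+
  also have "\<dots> = t" using lift2_pure_id[OF t] .
  finally show ?thesis .
qed

end

context parity_hopf
begin

lemma antipode_unity: "S e = e"
proof -
  have "bilinear (\<lambda>x y. S x \<cdot> y)"
    by (intro hopf_intros; simp add: hopf_closures)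
  then show ?thesis
    using antipode_left[OF unity_closed] by (simp add: comul_unity lift2_pure hopf_closures mul_unity counit_unity scaleC_one)
qed

text \<open>
  The antipode reverses products with \<open>g\<close>. As \<open>g\<close> is grouplike and even, \<open>x \<mapsto> g S(x g)\<close> is a left,
  and \<open>x \<mapsto> S(g x) g\<close> a right convolution inverse of the identity; both therefore equal \<open>S\<close>.
\<close>

lemma antipode_mul_g:
  assumes x: "x \<in> V"
  shows "S (x \<cdot> g) = g \<cdot> S x" and "S (g \<cdot> x) = S x \<cdot> g"
proof -
  have b: "bilinear (\<lambda>x y. S x \<cdot> y)" "bilinear (\<lambda>x y. x \<cdot> S y)"
    by (intro hopf_intros; simp add: hopf_closures)+
  note g = gpow_def[of True, simplified]
  have "g \<cdot> S (x \<cdot> g) = S x"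
  proof (rule convolution_inverse_unique[OF _ _ antipode_linear antipode_closed _ antipode_right x])
    fix h assume h: "h \<in> V"
    have "lift2 H (\<lambda>x y. g \<cdot> S (x \<cdot> g) \<cdot> y) (D h) = lift2 H (\<lambda>x y. g \<cdot> (S (x \<cdot> g) \<cdot> (y \<cdot> g)) \<cdot> g) (D h)"
      by (rule lift2_cong) (simp add: mul_assoc hopf_closures g_square mul_unity)
    also have "\<dots> = g \<cdot> lift2 H (\<lambda>x y. S (x \<cdot> g) \<cdot> (y \<cdot> g)) (D h) \<cdot> g"
      by (rule linear_lift2[OF _ _ subspace_carr, where f = "\<lambda>z. g \<cdot> z \<cdot> g", symmetric])
        (intro hopf_intros | simp add: hopf_closures h)+
    also have "lift2 H (\<lambda>x y. S (x \<cdot> g) \<cdot> (y \<cdot> g)) (D h) = lift2 H (\<lambda>x y. S x \<cdot> y) (D (h \<cdot> g))"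
      using lift2_comul_mul_gpow(1)[OF h b(1), of True] by (simp add: g)
    also have "g \<cdot> \<dots> \<cdot> g = \<epsilon> h *\<^sub>C e"
      using h by (simp add: antipode_left hopf_closures mul_distrib mul_unity g_square counit_mul counit_g)
    finally show "lift2 H (\<lambda>x y. g \<cdot> S (x \<cdot> g) \<cdot> y) (D h) = \<epsilon> h *\<^sub>C e" .
  qed (intro hopf_intros | simp add: hopf_closures)+
  then have "g \<cdot> (g \<cdot> S (x \<cdot> g)) = g \<cdot> S x" by simp
  then show "S (x \<cdot> g) = g \<cdot> S x" using x by (simp add: g_g_mul hopf_closures)
  have "S x = S (g \<cdot> x) \<cdot> g"
  proof (rule convolution_inverse_unique[OF antipode_linear antipode_closed _ _ antipode_left _ x])
    fix h assume h: "h \<in> V"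
    have "lift2 H (\<lambda>x y. x \<cdot> (S (g \<cdot> y) \<cdot> g)) (D h) = lift2 H (\<lambda>x y. g \<cdot> ((g \<cdot> x) \<cdot> S (g \<cdot> y)) \<cdot> g) (D h)"
      by (rule lift2_cong) (simp add: mul_assoc hopf_closures g_g_mul)
    also have "\<dots> = g \<cdot> lift2 H (\<lambda>x y. (g \<cdot> x) \<cdot> S (g \<cdot> y)) (D h) \<cdot> g"
      by (rule linear_lift2[OF _ _ subspace_carr, where f = "\<lambda>z. g \<cdot> z \<cdot> g", symmetric])
        (intro hopf_intros | simp add: hopf_closures h)+
    also have "lift2 H (\<lambda>x y. (g \<cdot> x) \<cdot> S (g \<cdot> y)) (D h) = lift2 H (\<lambda>x y. x \<cdot> S y) (D (g \<cdot> h))"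
      using lift2_comul_mul_gpow(2)[OF h b(2), of True] by (simp add: g)
    also have "g \<cdot> \<dots> \<cdot> g = \<epsilon> h *\<^sub>C e"
      using h by (simp add: antipode_right hopf_closures mul_distrib mul_unity g_square counit_mul counit_g)
    finally show "lift2 H (\<lambda>x y. x \<cdot> (S (g \<cdot> y) \<cdot> g)) (D h) = \<epsilon> h *\<^sub>C e" .
  qed (intro hopf_intros | simp add: hopf_closures)+
  then have "S (g \<cdot> x) \<cdot> g \<cdot> g = S x \<cdot> g" by simp
  then show "S (g \<cdot> x) = S x \<cdot> g" using x by (simp add: g_g_mul hopf_closures)
qed

lemma antipode_mul_gpow: "x \<in> V \<Longrightarrow> S (x \<cdot> gpow q) = gpow q \<cdot> S x"
  by (simp add: gpow_def antipode_mul_g mul_unity hopf_closures)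

lemma antipode_g: "S g = g"
  using antipode_mul_g(1)[OF unity_closed] by (simp add: mul_unity hopf_closures antipode_unity)

lemma antipode_grading: "x \<in> P p \<Longrightarrow> S x \<in> P p"
proof -
  assume x: "x \<in> P p"
  then have xV: "x \<in> V" by (rule grading_closed)
  have "S x \<cdot> g = S (psign p *\<^sub>C (x \<cdot> g))"
    using x by (simp add: antipode_mul_g[symmetric] xV in_grading_iff)
  also have "\<dots> = psign p *\<^sub>C (g \<cdot> S x)"
    using xV by (simp add: linear_on_scale[OF antipode_linear] antipode_mul_g hopf_closures)
  finally have "psign p *\<^sub>C (S x \<cdot> g) = g \<cdot> S x" by (simp add: scaleC_scaleC psign_square scaleC_one)
  then show ?thesis using xV by (simp add: in_grading_iff hopf_closures)
qed

text \<open>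
  For \<open>h\<close> of parity \<open>p\<close> and \<open>h\<^sub>2\<close> odd, \<open>h\<^sub>1\<close> has the parity opposite to \<open>p\<close>, and so \<open>- (-1)\<^sup>p g
  h\<^sub>1 = h\<^sub>1 g\<close>: the sign in the defining formula only serves to write \<open>g\<close> on the left.
\<close>

lemma twisted_comul_eq: 
  assumes h: "h \<in> V"
  shows "twisted_comul H P g h = tau (D h)"
proof -
  have cb: "bilinear (\<lambda>a b. pure2 H a (hcomp P i b))" "bilinear (\<lambda>a b. pure2 H (g \<cdot> a) b)" for i
    by (intro hopf_intros; simp add: hopf_closures)+
  have cb3: "bilinear (\<lambda>a b. pure2 H (g \<cdot> a) (hcomp P True b))"
    by (intro hopf_intros; simp add: hopf_closures)
  have cm: "comul_part H P i x \<in> tensor2 H" if "x \<in> V" for x i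
    unfolding comul_part_def by (rule lift2_in[OF _ cb(1) subspace_tensor2]) (simp_all add: hopf_closures that)
  have *: "comul_part H P False x - psign p *\<^sub>C mul2 (flip H) H (pure2 H g e) (comul_part H P True x) = tau (D x)"
    if x: "x \<in> P p" for p x
  proof -
    have xV: "x \<in> V" by (rule grading_closed[OF x])
    let ?F = "\<lambda>a b. pure2 H a (hcomp P False b) - psign p *\<^sub>C pure2 H (g \<cdot> a) (hcomp P True b)"
    have F: "bilinear ?F" by (intro hopf_intros; simp add: hopf_closures)
    have "mul2 (flip H) H (pure2 H g e) (comul_part H P True x) = lift2 H (\<lambda>a b. pure2 H (g \<cdot> a) (e \<cdot> b)) (comul_part H P True x)"
      unfolding mul2_flip by (rule mul2_braid_even) (simp_all add: cm xV g_even unity_even)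
    also have "\<dots> = lift2 H (\<lambda>a b. pure2 H (g \<cdot> a) b) (comul_part H P True x)"
      by (rule lift2_cong) (simp add: mul_unity)
    also have "\<dots> = lift2 H (\<lambda>a b. lift2 H (\<lambda>a b. pure2 H (g \<cdot> a) b) (pure2 H a (hcomp P True b))) (D x)"
      unfolding comul_part_def by (rule lift2_lift2[OF _ cb(1) cb(2)]) (simp_all add: hopf_closures xV)
    also have "\<dots> = lift2 H (\<lambda>a b. pure2 H (g \<cdot> a) (hcomp P True b)) (D x)"
      by (rule lift2_cong) (simp add: lift2_pure[OF cb(2)] hopf_closures)
    finally have 1: "mul2 (flip H) H (pure2 H g e) (comul_part H P True x) = lift2 H (\<lambda>a b. pure2 H (g \<cdot> a) (hcomp P True b)) (D x)" .
    have "comul_part H P False x - psign p *\<^sub>C mul2 (flip H) H (pure2 H g e) (comul_part H P True x) = lift2 H ?F (D x)"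
      unfolding 1 unfolding comul_part_def
      by (rule lift2_ext[OF _ lift2_linear[OF F] _ comul_closed[OF xV]])
        (intro linear_on_minus linear_on_scaled lift2_linear cb(1) cb3,
         simp add: lift2_pure[OF cb(1)] lift2_pure[OF cb3] lift2_pure[OF F])
    also have "\<dots> = tau (D x)"
      unfolding tau_def
    proof (rule lift2_comul_cong[OF F _ x])
      show "bilinear (\<lambda>a b. \<Sum>q\<in>UNIV. pure2 H (a \<cdot> gpow q) (hcomp P q b))"
        by (rule bilinear_tau[OF bilinear_pure2])
      fix r q a b assume *: "a \<in> P r" "b \<in> P q" "(r \<noteq> q) = p"
      show "?F a b = (\<Sum>q\<in>UNIV. pure2 H (a \<cdot> gpow q) (hcomp P q b))"
      proof (cases q)
        case True
        have "psign p *\<^sub>C pure2 H (g \<cdot> a) b = (psign p * psign r) *\<^sub>C pure2 H (a \<cdot> g) b"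
          using * by (simp add: in_grading_iff pure2_scale hopf_closures scaleC_scaleC)
        also have "psign p * psign r = -1" using * True by (auto simp: psign_def)
        finally show ?thesis using * True
          by (simp add: UNIV_bool hcomp_homogeneous pure2_zero hopf_closures gpow_def scaleC_one)
      next
        case False
        then show ?thesis using *
          by (simp add: UNIV_bool hcomp_homogeneous pure2_zero hopf_closures gpow_def mul_unity)
      qed
    qed
    finally show ?thesis .
  qed
  have "twisted_comul H P g h = (\<Sum>p\<in>UNIV. tau (D (hcomp P p h)))"
    unfolding twisted_comul_def by (intro sum.cong refl *) (simp add: hcomp_in_grading h)
  also have "\<dots> = tau (D (\<Sum>p\<in>UNIV. hcomp P p h))"
    using h by (simp add: linear_on_sum[OF tau_linear subspace_tensor2] linear_on_sum[OF comul_linear subspace_carr] hopf_closures)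
  finally show ?thesis using h by (simp add: hcomp_sum)
qed

abbreviation "Dt \<equiv> twisted_comul H P g"
abbreviation "St \<equiv> twisted_antipode H P g"

lemma twisted_antipode_eq: "St h = (\<Sum>p\<in>UNIV. gpow p \<cdot> S (hcomp P p h))"
  by (simp add: twisted_antipode_def gpow_def)

lemma twisted_comul_closed: "h \<in> V \<Longrightarrow> Dt h \<in> tensor2 H"
  by (simp add: twisted_comul_eq tau_closed hopf_closures)

lemma twisted_comul_linear: "linear_on V Dt"
  using linear_on_comp[OF tau_linear comul_linear comul_closed] 
  by (subst linear_on_cong[OF twisted_comul_eq]; simp add: subspace_carr)

lemma twisted_antipode_closed: "h \<in> V \<Longrightarrow> St h \<in> V"
  unfolding twisted_antipode_eq by (simp add: hopf_closures)

lemma twisted_antipode_linear: "linear_on V St"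
  unfolding twisted_antipode_eq by (intro hopf_intros; simp add: hopf_closures)

lemma lift2_twisted_comul:
  "bilinear F \<Longrightarrow> h \<in> V \<Longrightarrow> lift2 H F (Dt h) = lift2 H (\<lambda>a b. \<Sum>q\<in>UNIV. F (a \<cdot> gpow q) (hcomp P q b)) (D h)"
  by (simp add: twisted_comul_eq lift2_tau hopf_closures)

text \<open>
  Both iterated coproducts are \<open>\<Sum> h\<^sub>1 g\<^sup>q\<^sup>+\<^sup>r \<otimes> h\<^sub>2 g\<^sup>r \<otimes> h\<^sub>3\<close>, with \<open>q\<close> and \<open>r\<close> the parities of
  \<open>h\<^sub>2\<close> and \<open>h\<^sub>3\<close>. On the left this uses \<open>\<Delta>(x g) = \<Delta>(x) (g \<otimes> g)\<close>, on the right that \<open>\<Delta>\<close> is even.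
\<close>

lemma twisted_coassoc:
  assumes h: "h \<in> V"
  shows "lift2 H (\<lambda>x y. lift2 H (\<lambda>a b. pure3 H a b y) (Dt x)) (Dt h)
       = lift2 H (\<lambda>x y. lift2 H (\<lambda>a b. pure3 H x a b) (Dt y)) (Dt h)"
proof -
  note Dt_lin = linear_on_comp[OF twisted_comul_linear]
  \<comment> \<open>the summands of the two sides, before coassociativity is used\<close>
  let ?T = "\<lambda>a b y. \<Sum>q\<in>UNIV. \<Sum>r\<in>UNIV. pure3 H (a \<cdot> gpow q \<cdot> gpow r) (hcomp P r (b \<cdot> gpow q)) (hcomp P q y)"
  let ?U = "\<lambda>x a b. \<Sum>q\<in>UNIV. \<Sum>u\<in>UNIV. \<Sum>r\<in>UNIV. pure3 H (x \<cdot> gpow q) (hcomp P u a \<cdot> gpow r) (hcomp P r (hcomp P (u \<noteq> q) b))"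
  have T: "trilinear ?T" by (intro hopf_intros; simp add: hopf_closures)
  have U: "trilinear ?U" by (intro hopf_intros; simp add: hopf_closures)
  have B1: "bilinear (\<lambda>x y. lift2 H (\<lambda>a b. pure3 H a b y) (Dt x))"
    by (intro hopf_intros Dt_lin; simp add: hopf_closures twisted_comul_closed bilinear_pure3; intro hopf_intros; simp add: hopf_closures)
  have B2: "bilinear (\<lambda>x y. lift2 H (\<lambda>a b. pure3 H x a b) (Dt y))"
    by (intro hopf_intros Dt_lin; simp add: hopf_closures twisted_comul_closed bilinear_pure3; intro hopf_intros; simp add: hopf_closures)
  have "lift2 H (\<lambda>x y. lift2 H (\<lambda>a b. pure3 H a b y) (Dt x)) (Dt h)
      = lift2 H (\<lambda>x y. \<Sum>q\<in>UNIV. lift2 H (\<lambda>a b. pure3 H a b (hcomp P q y)) (Dt (x \<cdot> gpow q))) (D h)"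
    by (rule lift2_twisted_comul[OF B1 h])
  also have "\<dots> = lift2 H (\<lambda>x y. lift2 H (\<lambda>a b. ?T a b y) (D x)) (D h)"
  proof (rule lift2_cong)
    fix x y assume *: "x \<in> V" "y \<in> V"
    have "lift2 H (\<lambda>a b. pure3 H a b (hcomp P q y)) (Dt (x \<cdot> gpow q))
       = lift2 H (\<lambda>a b. \<Sum>r\<in>UNIV. pure3 H (a \<cdot> gpow q \<cdot> gpow r) (hcomp P r (b \<cdot> gpow q)) (hcomp P q y)) (D x)" for q
      using * by (simp add: lift2_twisted_comul[OF bilinear_pure3(1)] hopf_closures lift2_comul_mul_gpow(1)[OF _ bilinear_tau[OF bilinear_pure3(1)]])
    moreover have "bilinear (\<lambda>a b. \<Sum>r\<in>UNIV. pure3 H (a \<cdot> gpow q \<cdot> gpow r) (hcomp P r (b \<cdot> gpow q)) (hcomp P q y))" for q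
      using * by (intro hopf_intros; simp add: hopf_closures)
    ultimately show "(\<Sum>q\<in>UNIV. lift2 H (\<lambda>a b. pure3 H a b (hcomp P q y)) (Dt (x \<cdot> gpow q))) = lift2 H (\<lambda>a b. ?T a b y) (D x)"
      using * by (simp only: lift2_sum_fun comul_closed)
  qed
  also have "\<dots> = lift2 H (\<lambda>x y. lift2 H (?T x) (D y)) (D h)"
    by (rule coassoc_lift[OF T h])
  also have "\<dots> = lift2 H (\<lambda>x y. lift2 H (?U x) (D y)) (D h)"
  proof (rule lift2_cong, rule lift2_cong, rule trilinear_hom_ext[OF T U])
    fix p q r x a b assume *: "x \<in> P p" "a \<in> P q" "b \<in> P r"
    then show "?T x a b = ?U x a b"
      by (cases q; cases r) (simp_all add: UNIV_bool hcomp_homogeneous hcomp_homogeneous[OF gpow_hom_closed(1)] gpow_hom_closed pure3_zero 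
        mul_distrib hopf_closures gpow_mul2 linear_on_zero[OF linear_on_hcomp_V] gpow_False mul_unity)
  qed 
  also have "\<dots> = lift2 H (\<lambda>x y. \<Sum>q\<in>UNIV. lift2 H (\<lambda>a b. pure3 H (x \<cdot> gpow q) a b) (Dt (hcomp P q y))) (D h)"
  proof (rule lift2_cong)
    fix x y assume *: "x \<in> V" "y \<in> V"
    have "lift2 H (\<lambda>a b. pure3 H (x \<cdot> gpow q) a b) (Dt (hcomp P q y))
       = lift2 H (\<lambda>a b. \<Sum>u\<in>UNIV. \<Sum>r\<in>UNIV. pure3 H (x \<cdot> gpow q) (hcomp P u a \<cdot> gpow r) (hcomp P r (hcomp P (u \<noteq> q) b))) (D y)" for q
      using * by (simp add: lift2_twisted_comul[OF bilinear_pure3(2)] hopf_closures lift2_comul_hcomp[OF bilinear_tau[OF bilinear_pure3(2)]])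
    moreover have "bilinear (\<lambda>a b. \<Sum>u\<in>UNIV. \<Sum>r\<in>UNIV. pure3 H (x \<cdot> gpow q) (hcomp P u a \<cdot> gpow r) (hcomp P r (hcomp P (u \<noteq> q) b)))" for q
      using * by (intro hopf_intros; simp add: hopf_closures)
    ultimately show "lift2 H (?U x) (D y) = (\<Sum>q\<in>UNIV. lift2 H (\<lambda>a b. pure3 H (x \<cdot> gpow q) a b) (Dt (hcomp P q y)))"
      using * by (simp only: lift2_sum_fun comul_closed)
  qed
  also have "\<dots> = lift2 H (\<lambda>x y. lift2 H (\<lambda>a b. pure3 H x a b) (Dt y)) (Dt h)"
    by (rule lift2_twisted_comul[OF B2 h, symmetric])
  finally show ?thesis .
qed

text \<open>
  The step that changes the sign of \<open>s\<close>: in \<open>x\<^sub>1 g\<^sup>q y\<^sub>1 g\<^sup>r \<otimes> x\<^sub>2 y\<^sub>2\<close>, where \<open>q\<close> is the parity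
  of \<open>x\<^sub>2\<close>, moving \<open>g\<^sup>q\<close> past \<open>y\<^sub>1\<close> contributes -1 exactly when \<open>x\<^sub>2\<close> and \<open>y\<^sub>1\<close> are both odd,
  which is when the braiding that exchanges them contributes \<open>s\<close> or \<open>-s\<close>.
\<close>

lemma twisted_comul_mul:
  assumes x: "x \<in> V" and y: "y \<in> V"
  shows "Dt (x \<cdot> y) = mul2 (braid (- s)) H (Dt x) (Dt y)"
proof -
  let ?M = "\<lambda>a b a' b'. \<Sum>p\<in>UNIV. \<Sum>q\<in>UNIV. (if p \<and> q then - s else 1) *\<^sub>C pure2 H (a \<cdot> hcomp P q a') (hcomp P p b \<cdot> b')"
  let ?A = "\<lambda>a b a' b'. \<Sum>p\<in>UNIV. \<Sum>q\<in>UNIV. (if p \<and> q then s else 1) *\<^sub>C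
     (\<Sum>r\<in>UNIV. pure2 H (a \<cdot> hcomp P q a' \<cdot> gpow r) (hcomp P r (hcomp P p b \<cdot> b')))"
  let ?B = "\<lambda>a b a' b'. \<Sum>u\<in>UNIV. \<Sum>v\<in>UNIV. ?M (a \<cdot> gpow u) (hcomp P u b) (a' \<cdot> gpow v) (hcomp P v b')"
  have M: "bilinear (?M a b)" if "a \<in> V" "b \<in> V" for a b
    using that by (intro hopf_intros; simp add: hopf_closures)
  have M2: "bilinear (\<lambda>a b. lift2 H (?M a b) (Dt y))"
    using y by (intro hopf_intros; simp add: hopf_closures twisted_comul_closed; intro hopf_intros; simp add: hopf_closures)
  have "Dt (x \<cdot> y) = lift2 H (\<lambda>a b. \<Sum>r\<in>UNIV. pure2 H (a \<cdot> gpow r) (hcomp P r b)) (mul2 (braid s) H (D x) (D y))"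
    using x y by (simp add: twisted_comul_eq hopf_closures comul_mul tau_def)
  also have "\<dots> = lift2 H (\<lambda>a b. lift2 H (?A a b) (D y)) (D x)"
    using x y by (simp add: lift2_mul2_braid bilinear_tau bilinear_pure2 hopf_closures)
  also have "\<dots> = lift2 H (\<lambda>a b. lift2 H (?B a b) (D y)) (D x)"
  proof (rule lift2_lift2_hom_cong)
    show "quadrilinear ?A" "quadrilinear ?B" by (intro hopf_intros; simp add: hopf_closures)+
    fix p q p' q' a b c d assume *: "a \<in> P p" "b \<in> P q" "c \<in> P p'" "d \<in> P q'"
    have "?A a b c d = (if q \<and> p' then s else 1) *\<^sub>C pure2 H (a \<cdot> c \<cdot> gpow (q \<noteq> q')) (b \<cdot> d)"
      using * grading_mul[OF *(2,4)] by (cases p'; cases q; cases q')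
       (simp_all add: UNIV_bool hcomp_homogeneous pure2_zero mul_distrib hopf_closures linear_on_zero[OF linear_on_hcomp_V])
    also have "\<dots> = ?B a b c d"
    proof -
      have cg: "c \<cdot> gpow q' \<in> P p'" using * by (simp add: gpow_hom_closed)
      have "?B a b c d = (if q \<and> p' then - s else 1) *\<^sub>C pure2 H (a \<cdot> gpow q \<cdot> (c \<cdot> gpow q')) (b \<cdot> d)"
        using * cg by (cases p'; cases q; cases q')
         (simp_all add: UNIV_bool hcomp_homogeneous pure2_zero mul_distrib hopf_closures linear_on_zero[OF linear_on_hcomp_V])
      also have "a \<cdot> gpow q \<cdot> (c \<cdot> gpow q') = a \<cdot> (gpow q \<cdot> c) \<cdot> gpow q'"
        using * by (simp add: mul_assoc hopf_closures)
      also have "\<dots> = (if p' \<and> q then -1 else 1) *\<^sub>C (a \<cdot> c \<cdot> gpow (q \<noteq> q'))"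
        using * by (simp add: gpow_commute mul_distrib hopf_closures mul_assoc gpow_mul del: cvec.scale_minus_left)
      finally show ?thesis
        using * by (simp add: hopf_closures scaleC_scaleC pure2_scale del: cvec.scale_minus_left)
    qed
    finally show "?A a b c d = ?B a b c d" .
  qed
  also have "\<dots> = lift2 H (\<lambda>a b. \<Sum>u\<in>UNIV. lift2 H (?M (a \<cdot> gpow u) (hcomp P u b)) (Dt y)) (D x)"
  proof (rule lift2_cong)
    fix a b assume *: "a \<in> V" "b \<in> V"
    have "lift2 H (?M (a \<cdot> gpow u) (hcomp P u b)) (Dt y) = lift2 H (\<lambda>a' b'. \<Sum>v\<in>UNIV. ?M (a \<cdot> gpow u) (hcomp P u b) (a' \<cdot> gpow v) (hcomp P v b')) (D y)" for u
      using * by (intro lift2_twisted_comul M y; simp add: hopf_closures)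
    moreover have "bilinear (\<lambda>a' b'. \<Sum>v\<in>UNIV. ?M (a \<cdot> gpow u) (hcomp P u b) (a' \<cdot> gpow v) (hcomp P v b'))" for u
      using * by (intro hopf_intros; simp add: hopf_closures)
    ultimately show "lift2 H (?B a b) (D y) = (\<Sum>u\<in>UNIV. lift2 H (?M (a \<cdot> gpow u) (hcomp P u b)) (Dt y))"
      using y by (simp only: lift2_sum_fun comul_closed)
  qed
  also have "\<dots> = lift2 H (\<lambda>a b. lift2 H (?M a b) (Dt y)) (Dt x)"
    by (rule lift2_twisted_comul[OF M2 x, symmetric])
  also have "\<dots> = mul2 (braid (- s)) H (Dt x) (Dt y)"
    using x y by (simp add: mul2_braid twisted_comul_closed)
  finally show ?thesis .
qed

lemma twisted_counit:
  assumes h: "h \<in> V"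
  shows "lift2 H (\<lambda>x y. \<epsilon> x *\<^sub>C y) (Dt h) = h" "lift2 H (\<lambda>x y. \<epsilon> y *\<^sub>C x) (Dt h) = h"
proof -
  have b: "bilinear (\<lambda>x y. \<epsilon> x *\<^sub>C y)" "bilinear (\<lambda>x y. \<epsilon> y *\<^sub>C x)"
    by (intro hopf_intros; simp add: hopf_closures)+
  have "lift2 H (\<lambda>x y. \<epsilon> x *\<^sub>C y) (Dt h) = lift2 H (\<lambda>x y. \<epsilon> x *\<^sub>C y) (D h)"
    unfolding lift2_twisted_comul[OF b(1) h]
  proof (rule lift2_cong)
    fix a b assume "a \<in> V" "b \<in> V"
    then show "(\<Sum>q\<in>UNIV. \<epsilon> (a \<cdot> gpow q) *\<^sub>C hcomp P q b) = \<epsilon> a *\<^sub>C b"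
      by (simp add: counit_mul hopf_closures counit_gpow cvec.scale_sum_right[symmetric] hcomp_sum)
  qed
  then show "lift2 H (\<lambda>x y. \<epsilon> x *\<^sub>C y) (Dt h) = h" using h by (simp add: counit_left)
  have "lift2 H (\<lambda>x y. \<epsilon> y *\<^sub>C x) (Dt h) = lift2 H (\<lambda>x y. \<epsilon> y *\<^sub>C x) (D h)"
    unfolding lift2_twisted_comul[OF b(2) h]
  proof (rule lift2_hom_cong[OF bilinear_tau[OF b(2)] b(2)])
    fix p q a b assume *: "a \<in> P p" "b \<in> P q"
    then show "(\<Sum>q\<in>UNIV. \<epsilon> (hcomp P q b) *\<^sub>C (a \<cdot> gpow q)) = \<epsilon> b *\<^sub>C a"
      by (cases q) (simp_all add: UNIV_bool hcomp_homogeneous counit_odd linear_on_zero[OF counit_linear subspace_carr] gpow_def mul_unity grading_closed)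
  qed
  then show "lift2 H (\<lambda>x y. \<epsilon> y *\<^sub>C x) (Dt h) = h" using h by (simp add: counit_right)
qed

lemma twisted_antipode_homogeneous: "x \<in> P p \<Longrightarrow> St x = gpow p \<cdot> S x"
  unfolding twisted_antipode_eq
  by (cases p) (simp_all add: UNIV_bool hcomp_homogeneous linear_on_zero[OF antipode_linear subspace_carr] mul_distrib hopf_closures)

text \<open>
  For the first identity the powers of \<open>g\<close> combine to \<open>g\<^sup>p\<close> with \<open>p\<close> the parity of \<open>h\<close>, which is
  harmless as the counit vanishes on odd elements; for the second they cancel.
\<close>

lemma twisted_antipode:
  assumes h: "h \<in> V"
  shows "lift2 H (\<lambda>x y. St x \<cdot> y) (Dt h) = \<epsilon> h *\<^sub>C e" "lift2 H (\<lambda>x y. x \<cdot> St y) (Dt h) = \<epsilon> h *\<^sub>C e"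
proof -
  note St_lin = linear_on_comp[OF twisted_antipode_linear]
  have b: "bilinear (\<lambda>x y. St x \<cdot> y)" "bilinear (\<lambda>x y. x \<cdot> St y)"
    "bilinear (\<lambda>x y. S x \<cdot> y)" "bilinear (\<lambda>x y. x \<cdot> S y)" "bilinear (\<lambda>x y. gpow p \<cdot> (S x \<cdot> y))" for p
    by (intro hopf_intros St_lin; simp add: hopf_closures twisted_antipode_closed)+
  show "lift2 H (\<lambda>x y. St x \<cdot> y) (Dt h) = \<epsilon> h *\<^sub>C e"
  proof (rule linear_hom_ext[OF _ _ _ h])
    show "linear_on V (\<lambda>h. lift2 H (\<lambda>x y. St x \<cdot> y) (Dt h))"
      by (intro linear_on_lift2_arg b twisted_comul_linear twisted_comul_closed)
    show "linear_on V (\<lambda>h. \<epsilon> h *\<^sub>C e)" by (intro hopf_intros counit_linear)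
    fix p x assume x: "x \<in> P p"
    then have xV: "x \<in> V" by (rule grading_closed)
    have "lift2 H (\<lambda>x y. St x \<cdot> y) (Dt x) = lift2 H (\<lambda>x y. gpow p \<cdot> (S x \<cdot> y)) (D x)"
      unfolding lift2_twisted_comul[OF b(1) xV]
    proof (rule lift2_comul_cong[OF bilinear_tau[OF b(1)] b(5) x])
      fix r q a b assume *: "a \<in> P r" "b \<in> P q" "(r \<noteq> q) = p"
      have "(\<Sum>q\<in>UNIV. St (a \<cdot> gpow q) \<cdot> hcomp P q b) = St (a \<cdot> gpow q) \<cdot> b"
        using * by (cases q) (simp_all add: UNIV_bool hcomp_homogeneous mul_distrib twisted_antipode_closed hopf_closures)
      also have "\<dots> = gpow r \<cdot> (gpow q \<cdot> S a) \<cdot> b"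
        using * by (simp add: twisted_antipode_homogeneous[OF gpow_hom_closed(1)] antipode_mul_gpow grading_closed)
      also have "\<dots> = gpow r \<cdot> gpow q \<cdot> (S a \<cdot> b)"
        using * by (simp add: mul_assoc hopf_closures)
      finally show "(\<Sum>q\<in>UNIV. St (a \<cdot> gpow q) \<cdot> hcomp P q b) = gpow p \<cdot> (S a \<cdot> b)"
        using * by (simp add: gpow_mul)
    qed
    also have "\<dots> = gpow p \<cdot> lift2 H (\<lambda>x y. S x \<cdot> y) (D x)"
      by (rule linear_lift2[OF _ b(3) subspace_carr, symmetric]) (intro hopf_intros | simp add: hopf_closures xV)+
    also have "\<dots> = \<epsilon> x *\<^sub>C e"
      using x xV by (cases p) (simp_all add: antipode_left mul_distrib hopf_closures counit_odd gpow_False mul_unity)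
    finally show "lift2 H (\<lambda>x y. St x \<cdot> y) (Dt x) = \<epsilon> x *\<^sub>C e" .
  qed
  have "lift2 H (\<lambda>x y. x \<cdot> St y) (Dt h) = lift2 H (\<lambda>x y. x \<cdot> S y) (D h)"
    unfolding lift2_twisted_comul[OF b(2) h]
  proof (rule lift2_hom_cong[OF bilinear_tau[OF b(2)] b(4)])
    fix p q a b assume *: "a \<in> P p" "b \<in> P q"
    have "(\<Sum>q\<in>UNIV. a \<cdot> gpow q \<cdot> St (hcomp P q b)) = a \<cdot> gpow q \<cdot> St b"
      using * by (cases q) (simp_all add: UNIV_bool hcomp_homogeneous mul_distrib linear_on_zero[OF twisted_antipode_linear subspace_carr] hopf_closures)
    also have "\<dots> = a \<cdot> gpow q \<cdot> gpow q \<cdot> S b"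
      using * by (simp add: twisted_antipode_homogeneous mul_assoc hopf_closures)
    finally show "(\<Sum>q\<in>UNIV. a \<cdot> gpow q \<cdot> St (hcomp P q b)) = a \<cdot> S b"
      using * by (simp add: gpow_mul2 hopf_closures gpow_False mul_unity)
  qed
  then show "lift2 H (\<lambda>x y. x \<cdot> St y) (Dt h) = \<epsilon> h *\<^sub>C e" using h by (simp add: antipode_right)
qed

lemma twisted_comul_gpow: "Dt (gpow q) = pure2 H (gpow q) (gpow q)"
  by (simp add: twisted_comul_eq hopf_closures gpow_def comul_g comul_unity tau_pure[OF _ g_even] tau_pure[OF _ unity_even] mul_unity)

theorem hopf_in_twist: "hopf_in (braid (- s)) (twist H P g)"
  unfolding hopf_in_def Let_def twist_simps mul2_twist
  using twisted_coassoc twisted_comul_mul twisted_counit twisted_antipode twisted_comul_gpow[of False]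
    twisted_comul_closed twisted_comul_linear twisted_antipode_closed twisted_antipode_linear
  by (simp add: gpow_False subspace_carr mul_bilinear mul_closed unity_closed mul_assoc mul_unity counit_linear counit_unity counit_mul)

end

section \<open>Products of tensors and the matrices of involutions\<close>

context involutive_algebra
begin

lemma linear2_hom_ext:
  assumes f: "linear_on (tensor2 H) f" and f': "linear_on (tensor2 H) f'"
    and eq: "\<And>p q a b. a \<in> P p \<Longrightarrow> b \<in> P q \<Longrightarrow> f (pure2 H a b) = f' (pure2 H a b)" and t: "t \<in> tensor2 H"
  shows "f t = f' t"
proof (rule lift2_ext[OF f f' _ t])
  have b: "bilinear (\<lambda>x y. h (pure2 H x y))" if h: "linear_on (tensor2 H) h" for h :: "_ \<Rightarrow> 'c::complex_vector"
    by (rule bilinear_onI)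
     (rule linear_on_comp[OF h linear_on_pure2_left[OF linear_on_id]] linear_on_comp[OF h linear_on_pure2_right[OF linear_on_id]]; simp add: pure2_in)+
  fix x y assume xy: "x \<in> V" "y \<in> V"
  show "f (pure2 H x y) = f' (pure2 H x y)"
    by (rule bilinear_hom_ext[OF b[OF f] b[OF f'] eq xy])
qed

lemma mul2_linear_left:
  assumes t: "t \<in> tensor2 H"
  shows "linear_on (tensor2 H) (\<lambda>u. mul2 (braid s) H u t)"
proof (rule iffD2[OF linear_on_cong[OF mul2_braid[OF _ t] subspace_tensor2]])
  show "linear_on (tensor2 H) (lift2 H (\<lambda>a b. lift2 H (braided s (pure2 H) a b) t))"
    using t by (intro lift2_linear multilinear_intros; simp add: closures; intro multilinear_intros; simp add: closures)
qed

lemma mul2_linear_right: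
  assumes t: "t \<in> tensor2 H"
  shows "linear_on (tensor2 H) (\<lambda>u. mul2 (braid s) H t u)"
proof (rule iffD2[OF linear_on_cong[OF mul2_braid[OF t] subspace_tensor2]])
  show "linear_on (tensor2 H) (\<lambda>u. lift2 H (\<lambda>a b. lift2 H (braided s (pure2 H) a b) u) t)"
    using t by (intro multilinear_intros; simp add: closures; intro multilinear_intros; simp add: closures)
qed

lemma mul2_closed:
  assumes t: "t \<in> tensor2 H" and u: "u \<in> tensor2 H"
  shows "mul2 (braid s) H t u \<in> tensor2 H"
  unfolding mul2_braid[OF t u] using u
  by (intro lift2_in[OF t _ subspace_tensor2] lift2_in[OF u _ subspace_tensor2] multilinear_intros; simp add: closures; intro multilinear_intros; simp add: closures)

lemma mul2_pure_one:
  assumes "a \<in> V" "b \<in> V" "c \<in> V" "d \<in> V"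
  shows "mul2 (braid 1) H (pure2 H a b) (pure2 H c d) = pure2 H (a \<cdot> c) (b \<cdot> d)"
proof -
  have 1: "bilinear (\<lambda>a1 b1. pure2 H (a \<cdot> a1) (b1 \<cdot> d))" if "a \<in> V" "d \<in> V" for a d
    using that by (intro multilinear_intros; simp add: closures)
  have 2: "bilinear (\<lambda>a' b'. pure2 H (a \<cdot> a') (b \<cdot> b'))" if "a \<in> V" "b \<in> V" for a b
    using that by (intro multilinear_intros; simp add: closures)
  have 3: "bilinear (\<lambda>a b. pure2 H (a \<cdot> c) (b \<cdot> d))"
    using assms by (intro multilinear_intros; simp add: closures)
  have "mul2 (braid 1) H (pure2 H a b) (pure2 H c d) =
     lift2 H (\<lambda>a b. lift2 H (\<lambda>a' b'. pure2 H (a \<cdot> a') (b \<cdot> b')) (pure2 H c d)) (pure2 H a b)"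
    unfolding mul2_def by (intro lift2_cong) (simp add: braid_one lift2_pure[OF 1])
  also have "\<dots> = lift2 H (\<lambda>a b. pure2 H (a \<cdot> c) (b \<cdot> d)) (pure2 H a b)"
    by (intro lift2_cong) (simp add: lift2_pure[OF 2] assms)
  also have "\<dots> = pure2 H (a \<cdot> c) (b \<cdot> d)"
    using assms by (simp add: lift2_pure[OF 3])
  finally show ?thesis .
qed

lemma linear_on_braid: "linear_on U f \<Longrightarrow> (\<And>x. x \<in> U \<Longrightarrow> f x \<in> V) \<Longrightarrow> y \<in> V \<Longrightarrow> linear_on U (\<lambda>x. braid s (f x) y)"
  "linear_on U f \<Longrightarrow> (\<And>x. x \<in> U \<Longrightarrow> f x \<in> V) \<Longrightarrow> y \<in> V \<Longrightarrow> linear_on U (\<lambda>x. braid s y (f x))"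
  by (rule linear_on_bilinear[OF bilinear_braid]; assumption)+

text \<open>
  The triple product applies three braidings in succession; it is cut into one definition per
  braiding so that multilinearity can be proved one layer at a time.
\<close>

definition "mul3_inner s x z' x2 y1 z1 y' = lift2 H (\<lambda>y2 z2. pure3 H (x \<cdot> x2) (y1 \<cdot> y2) (z2 \<cdot> z')) (braid s z1 y')"

definition "mul3_mid s x z' y' z1 y x1 = lift2 H (\<lambda>x2 y1. mul3_inner s x z' x2 y1 z1 y') (braid s y x1)"

definition "mul3_core s x y z x' y' z' = lift2 H (\<lambda>x1 z1. mul3_mid s x z' y' z1 y x1) (braid s z x')"

lemma mul3_inner_linear:
  assumes "x \<in> V" "z' \<in> V" "x2 \<in> V" "y1 \<in> V" "z1 \<in> V" "y' \<in> V"
  shows "linear_on V (\<lambda>x. mul3_inner s x z' x2 y1 z1 y')" "linear_on V (\<lambda>z'. mul3_inner s x z' x2 y1 z1 y')"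
    "linear_on V (\<lambda>x2. mul3_inner s x z' x2 y1 z1 y')" "linear_on V (\<lambda>y1. mul3_inner s x z' x2 y1 z1 y')"
    "linear_on V (\<lambda>z1. mul3_inner s x z' x2 y1 z1 y')" "linear_on V (\<lambda>y'. mul3_inner s x z' x2 y1 z1 y')"
  unfolding mul3_inner_def using assms
  by (intro multilinear_intros linear_on_braid; simp add: closures braid_closed; intro multilinear_intros; simp add: closures)+

lemma mul3_mid_linear:
  assumes "x \<in> V" "z' \<in> V" "y' \<in> V" "z1 \<in> V" "y \<in> V" "x1 \<in> V"
  shows "linear_on V (\<lambda>x. mul3_mid s x z' y' z1 y x1)" "linear_on V (\<lambda>z'. mul3_mid s x z' y' z1 y x1)"
    "linear_on V (\<lambda>y'. mul3_mid s x z' y' z1 y x1)" "linear_on V (\<lambda>z1. mul3_mid s x z' y' z1 y x1)"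
    "linear_on V (\<lambda>y. mul3_mid s x z' y' z1 y x1)" "linear_on V (\<lambda>x1. mul3_mid s x z' y' z1 y x1)"
  unfolding mul3_mid_def using assms
  by (intro bilinear_onI linear_on_lift2_fun linear_on_lift2_arg linear_on_id linear_on_braid mul3_inner_linear; simp add: closures braid_closed;
      intro bilinear_onI mul3_inner_linear; simp)+

lemma mul3_core_linear:
  assumes "x \<in> V" "y \<in> V" "z \<in> V" "x' \<in> V" "y' \<in> V" "z' \<in> V"
  shows "linear_on V (\<lambda>x. mul3_core s x y z x' y' z')" "linear_on V (\<lambda>y. mul3_core s x y z x' y' z')"
    "linear_on V (\<lambda>z. mul3_core s x y z x' y' z')" "linear_on V (\<lambda>x'. mul3_core s x y z x' y' z')"
    "linear_on V (\<lambda>y'. mul3_core s x y z x' y' z')" "linear_on V (\<lambda>z'. mul3_core s x y z x' y' z')"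
  unfolding mul3_core_def using assms
  by (intro bilinear_onI linear_on_lift2_fun linear_on_lift2_arg linear_on_id linear_on_braid mul3_mid_linear; simp add: closures braid_closed;
      intro bilinear_onI mul3_mid_linear; simp)+

lemma mul3_braid: "mul3 (braid s) H t u = lift3 H (\<lambda>x y z. lift3 H (mul3_core s x y z) u) t"
  unfolding mul3_def mul3_core_def mul3_mid_def mul3_inner_def ..

lemma mul3_trilinear:
  "x \<in> V \<Longrightarrow> y \<in> V \<Longrightarrow> z \<in> V \<Longrightarrow> trilinear (mul3_core s x y z)"
  "u \<in> tensor3 \<Longrightarrow> trilinear (\<lambda>x y z. lift3 H (mul3_core s x y z) u)"
proof -
  show 1: "trilinear (mul3_core s x y z)" if "x \<in> V" "y \<in> V" "z \<in> V" for x y z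
    using that by (intro trilinearI mul3_core_linear)
  show "trilinear (\<lambda>x y z. lift3 H (mul3_core s x y z) u)" if "u \<in> tensor3"
    using that by (intro trilinearI linear_on_lift3_fun 1 subspace_carr mul3_core_linear)
qed

lemma mul3_linear_left: "u \<in> tensor3 \<Longrightarrow> linear_on tensor3 (\<lambda>t. mul3 (braid s) H t u)"
  unfolding mul3_braid by (intro lift3_linear mul3_trilinear)

lemma mul3_linear_right: "t \<in> tensor3 \<Longrightarrow> linear_on tensor3 (\<lambda>u. mul3 (braid s) H t u)"
  unfolding mul3_braid
  by (intro linear_on_lift3_fun subspace_tensor3 mul3_trilinear lift3_linear)

lemma mul3_pure:
  "x \<in> V \<Longrightarrow> y \<in> V \<Longrightarrow> z \<in> V \<Longrightarrow> x' \<in> V \<Longrightarrow> y' \<in> V \<Longrightarrow> z' \<in> V \<Longrightarrow>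
    mul3 (braid s) H (pure3 H x y z) (pure3 H x' y' z') = mul3_core s x y z x' y' z'"
  unfolding mul3_braid by (simp add: lift3_pure mul3_trilinear pure3_in)

text \<open>
  If the three pairs that have to be exchanged are exchanged without a sign, the triple product is
  componentwise.
\<close>

lemma mul3_core_flip:
  assumes "x \<in> V" "y \<in> V" "z \<in> V" "x' \<in> V" "y' \<in> V" "z' \<in> V"
    and b: "braid s z x' = pure2 H x' z" "braid s y x' = pure2 H x' y" "braid s z y' = pure2 H y' z"
  shows "mul3_core s x y z x' y' z' = pure3 H (x \<cdot> x') (y \<cdot> y') (z \<cdot> z')"
proof -
  have "bilinear (\<lambda>x1 z1. mul3_mid s x z' y' z1 y x1)" "bilinear (\<lambda>x2 y1. mul3_inner s x z' x2 y1 z y')"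
    "bilinear (\<lambda>y2 z2. pure3 H (x \<cdot> x') (y \<cdot> y2) (z2 \<cdot> z'))"
    using assms by (intro bilinear_onI mul3_mid_linear mul3_inner_linear multilinear_intros; simp add: closures)+
  then show ?thesis
    using assms by (simp add: mul3_core_def mul3_mid_def[of s x z' y' z y x'] mul3_inner_def[of s x z' x' y z y'] lift2_pure)
qed

lemma mul3_pure_one:
  "x \<in> V \<Longrightarrow> y \<in> V \<Longrightarrow> z \<in> V \<Longrightarrow> x' \<in> V \<Longrightarrow> y' \<in> V \<Longrightarrow> z' \<in> V \<Longrightarrow>
    mul3 (braid 1) H (pure3 H x y z) (pure3 H x' y' z') = pure3 H (x \<cdot> x') (y \<cdot> y') (z \<cdot> z')"
  by (simp add: mul3_pure mul3_core_flip braid_one)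

lemma mul3_flip: "mul3 (flip H) H t u = mul3 (braid 1) H t u"
  unfolding mul3_def
proof (rule fun_cong[OF lift3_cong], rule fun_cong[OF lift3_cong])
  fix x y z x' y' z' assume *: "x \<in> V" "y \<in> V" "z \<in> V" "x' \<in> V" "y' \<in> V" "z' \<in> V"
  then have z: "flip H z x' = braid 1 z x'" "flip H y x1 = braid 1 y x1" if "x1 \<in> V" for x1
    using that by (simp_all add: flip_def braid_one)
  show "lift2 H (\<lambda>x1 z1. lift2 H (\<lambda>x2 y1. lift2 H (\<lambda>y2 z2.
         pure3 H (x \<cdot> x2) (y1 \<cdot> y2) (z2 \<cdot> z')) (flip H z1 y')) (flip H y x1)) (flip H z x')
     = lift2 H (\<lambda>x1 z1. lift2 H (\<lambda>x2 y1. lift2 H (\<lambda>y2 z2.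
         pure3 H (x \<cdot> x2) (y1 \<cdot> y2) (z2 \<cdot> z')) (braid 1 z1 y')) (braid 1 y x1)) (braid 1 z x')"
    unfolding z[OF *(1)]
  proof (rule lift2_cong)
    fix x1 z1 assume **: "x1 \<in> V" "z1 \<in> V"
    have "flip H z1 y' = braid 1 z1 y'" using * ** by (simp add: flip_def braid_one)
    then show "lift2 H (\<lambda>x2 y1. lift2 H (\<lambda>y2 z2.
         pure3 H (x \<cdot> x2) (y1 \<cdot> y2) (z2 \<cdot> z')) (flip H z1 y')) (flip H y x1)
      = lift2 H (\<lambda>x2 y1. lift2 H (\<lambda>y2 z2.
         pure3 H (x \<cdot> x2) (y1 \<cdot> y2) (z2 \<cdot> z')) (braid 1 z1 y')) (braid 1 y x1)"
      unfolding z(2)[OF **(1)] by simp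
  qed
qed

lemmas mul2_distrib = linear_on_scale[OF mul2_linear_left] linear_on_add[OF mul2_linear_left]
  linear_on_scale[OF mul2_linear_right] linear_on_add[OF mul2_linear_right]

lemmas mul3_distrib = linear_on_scale[OF mul3_linear_left] linear_on_add[OF mul3_linear_left]
  linear_on_diff[OF mul3_linear_left subspace_tensor3]
  linear_on_scale[OF mul3_linear_right] linear_on_add[OF mul3_linear_right]
  linear_on_diff[OF mul3_linear_right subspace_tensor3]

lemmas tensor3_closed = cvec.subspace_add[OF subspace_tensor3] cvec.subspace_diff[OF subspace_tensor3]
  cvec.subspace_scale[OF subspace_tensor3]

abbreviation "R \<equiv> R_elem H g"

lemma R_closed: "R \<in> tensor2 H"
  by (simp add: R_elem_def closures)

lemma R_mul:
  assumes t: "t \<in> tensor2 H"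
  shows "mul2 (braid 1) H R t = (1/2) *\<^sub>C (t + mul2 (braid 1) H (pure2 H e g) t
            + mul2 (braid 1) H (pure2 H g e) t - mul2 (braid 1) H (pure2 H g g) t)"
    and "mul2 (braid 1) H t R = (1/2) *\<^sub>C (t + mul2 (braid 1) H t (pure2 H e g)
            + mul2 (braid 1) H t (pure2 H g e) - mul2 (braid 1) H t (pure2 H g g))"
proof -
  have "mul2 (braid 1) H (pure2 H e e) t = lift2 H (pure2 H) t" "mul2 (braid 1) H t (pure2 H e e) = lift2 H (pure2 H) t"
    unfolding mul2_braid_even[OF t unity_even unity_even] by (rule lift2_cong; simp add: mul_unity)+
  then have e: "mul2 (braid 1) H (pure2 H e e) t = t" "mul2 (braid 1) H t (pure2 H e e) = t"
    by (simp_all add: lift2_pure_id t)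
  show "mul2 (braid 1) H R t = (1/2) *\<^sub>C (t + mul2 (braid 1) H (pure2 H e g) t
            + mul2 (braid 1) H (pure2 H g e) t - mul2 (braid 1) H (pure2 H g g) t)"
    unfolding R_elem_def using mul2_linear_left[OF t]
    by (simp add: linear_on_scale[OF mul2_linear_left[OF t]] linear_on_add[OF mul2_linear_left[OF t]] 
     linear_on_diff[OF mul2_linear_left[OF t]] closures e)
  show "mul2 (braid 1) H t R = (1/2) *\<^sub>C (t + mul2 (braid 1) H t (pure2 H e g)
            + mul2 (braid 1) H t (pure2 H g e) - mul2 (braid 1) H t (pure2 H g g))"
    unfolding R_elem_def using mul2_linear_left[OF t]
    by (simp add: linear_on_scale[OF mul2_linear_right[OF t]] linear_on_add[OF mul2_linear_right[OF t]] 
     linear_on_diff[OF mul2_linear_right[OF t]] closures e)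
qed

lemma R_mul_pure:
  assumes "a \<in> V" "b \<in> V"
  shows "mul2 (braid 1) H R (pure2 H a b) = (1/2) *\<^sub>C (pure2 H a b + pure2 H a (g \<cdot> b) + pure2 H (g \<cdot> a) b - pure2 H (g \<cdot> a) (g \<cdot> b))"
   and "mul2 (braid 1) H (pure2 H a b) R = (1/2) *\<^sub>C (pure2 H a b + pure2 H a (b \<cdot> g) + pure2 H (a \<cdot> g) b - pure2 H (a \<cdot> g) (b \<cdot> g))"
  using assms by (simp_all add: R_mul closures mul2_pure_one mul_unity)

end

context involutive_algebra
begin

lemma lift2_flip: "lift2 H (flip H) t = lift2 H (braid 1) t"
  by (rule lift2_cong) (simp add: flip_def braid_one)

lemma lift2_R:
  assumes F: "bilinear F"
  shows "lift2 H F R = (1/2) *\<^sub>C (F e e + F e g + F g e - F g g)"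
  unfolding R_elem_def
  by (simp add: lift2_scale[OF F] lift2_add[OF F] lift2_diff[OF F] lift2_pure[OF F] closures)

lemma R_flip: "lift2 H (braid 1) R = R"
  unfolding lift2_R[OF bilinear_braid] by (simp add: braid_one closures R_elem_def add.commute add.left_commute)

text \<open>
  The square of \<open>R\<^sub>g\<close> is \<open>1 \<otimes> 1\<close>, so right multiplication by it can be cancelled.
\<close>

lemma R_mul_R_right:
  assumes t: "t \<in> tensor2 H"
  shows "mul2 (braid 1) H (mul2 (braid 1) H t R) R = t"
proof (rule lift2_ext[OF _ linear_on_id _ t])
  show "linear_on (tensor2 H) (\<lambda>t. mul2 (braid 1) H (mul2 (braid 1) H t R) R)"
    by (rule linear_on_comp[OF mul2_linear_left[OF R_closed] mul2_linear_left[OF R_closed] mul2_closed[OF _ R_closed]])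
  fix a b assume *: "a \<in> V" "b \<in> V"
  note l = mul2_linear_left[OF R_closed, of 1]
  show "mul2 (braid 1) H (mul2 (braid 1) H (pure2 H a b) R) R = pure2 H a b"
    using * by (simp add: R_mul_pure linear_on_scale[OF l] linear_on_add[OF l] linear_on_diff[OF l subspace_tensor2] closures g_g_mul)
      (rule ext, simp add: tensor_eval field_simps)
qed

lemma R_square: "mul2 (braid 1) H R R = pure2 H e e" and unity_mul_R: "mul2 (braid 1) H (pure2 H e e) R = R"
proof -
  show l: "mul2 (braid 1) H (pure2 H e e) R = R"
    by (simp add: R_mul_pure closures mul_unity) (simp add: R_elem_def)
  show "mul2 (braid 1) H R R = pure2 H e e"
    using R_mul_R_right[OF pure2_in[OF unity_closed unity_closed]] unfolding l .
qed

text \<open>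
  Conjugation by \<open>R\<^sub>g\<close>, given by its formula on homogeneous tensors.
\<close>

definition conj_R :: "'a tensor2 \<Rightarrow> 'a tensor2" where
  "conj_R = lift2 H (\<lambda>a b. \<Sum>p\<in>UNIV. \<Sum>q\<in>UNIV. psign (p \<and> q) *\<^sub>C pure2 H (hcomp P p a \<cdot> gpow q) (hcomp P q b \<cdot> gpow p))"

lemma bilinear_conj_R:
  "bilinear (\<lambda>a b. \<Sum>p\<in>UNIV. \<Sum>q\<in>UNIV. psign (p \<and> q) *\<^sub>C pure2 H (hcomp P p a \<cdot> gpow q) (hcomp P q b \<cdot> gpow p))"
  by (intro multilinear_intros; simp add: closures)

lemma conj_R_linear: "linear_on (tensor2 H) conj_R"
  unfolding conj_R_def by (rule lift2_linear[OF bilinear_conj_R])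

lemma conj_R_closed: "t \<in> tensor2 H \<Longrightarrow> conj_R t \<in> tensor2 H"
  unfolding conj_R_def by (rule lift2_in[OF _ bilinear_conj_R subspace_tensor2]) (simp_all add: closures)

lemma conj_R_pure:
  "a \<in> P p \<Longrightarrow> b \<in> P q \<Longrightarrow> conj_R (pure2 H a b) = psign (p \<and> q) *\<^sub>C pure2 H (a \<cdot> gpow q) (b \<cdot> gpow p)"
  unfolding conj_R_def using lift2_pure[OF bilinear_conj_R, of a b]
  by (cases p; cases q) (simp_all add: closures UNIV_bool hcomp_homogeneous pure2_zero mul_distrib)

text \<open>
  In terms of the idempotents \<open>(1 \<plusminus> g) / 2\<close>, left multiplication by \<open>R\<^sub>g\<close> is the identity where
  the first factor is fixed by \<open>g\<close> and multiplies the second factor by \<open>g\<close> where it is negated;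
  odd elements exchange the idempotents. On pure tensors this is a check of the four combinations
  of parities.
\<close>

lemma R_mul_left:
  assumes t: "t \<in> tensor2 H"
  shows "mul2 (braid 1) H R t = mul2 (braid 1) H (conj_R t) R"
proof (rule linear2_hom_ext[OF mul2_linear_right[OF R_closed] _ _ t])
  show "linear_on (tensor2 H) (\<lambda>t. mul2 (braid 1) H (conj_R t) R)"
    by (rule linear_on_comp[OF mul2_linear_left[OF R_closed] conj_R_linear conj_R_closed])
  fix p q a b assume *: "a \<in> P p" "b \<in> P q"
  have V: "a \<in> V" "b \<in> V" using * by (simp_all add: grading_closed)
  have ga: "g \<cdot> a = psign p *\<^sub>C (a \<cdot> g)" and gb: "g \<cdot> b = psign q *\<^sub>C (b \<cdot> g)" using * by (simp_all add: in_grading_iff)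
  note l = mul2_linear_left[OF R_closed, of 1]
  show "mul2 (braid 1) H R (pure2 H a b) = mul2 (braid 1) H (conj_R (pure2 H a b)) R"
    unfolding conj_R_pure[OF *]
    using V by (simp add: linear_on_scale[OF l] R_mul_pure closures ga gb pure2_scale)
      (rule ext, cases p; cases q; simp add: tensor_eval psign_def gpow_def g_g_mul mul_unity field_simps)
qed

lemma braid_lift_linear: "linear_on (tensor2 H) (lift2 H (braid s))"
  by (rule lift2_linear[OF bilinear_braid])

lemma braid_lift_closed: "t \<in> tensor2 H \<Longrightarrow> lift2 H (braid s) t \<in> tensor2 H"
  by (rule lift2_in[OF _ bilinear_braid subspace_tensor2 braid_closed])

lemma flip_flip:
  assumes t: "t \<in> tensor2 H"
  shows "lift2 H (braid 1) (lift2 H (braid 1) t) = t"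
  by (rule lift2_ext[OF linear_on_comp[OF braid_lift_linear braid_lift_linear braid_lift_closed] linear_on_id _ t])
    (simp_all add: lift2_pure[OF bilinear_braid] braid_one)

text \<open>
  Applying \<open>\<tau>\<close>, the super flip and \<open>\<tau>\<close> again sends \<open>a \<otimes> b\<close> first to \<open>a g\<^sup>q \<otimes> b\<close>, then to \<open>(-1)\<^sup>p\<^sup>q
  b \<otimes> a g\<^sup>q\<close>, then to \<open>(-1)\<^sup>p\<^sup>q b g\<^sup>p \<otimes> a g\<^sup>q\<close>, which is the flip of the conjugate by \<open>R\<^sub>g\<close>.
\<close>

lemma tau_superflip_tau:
  assumes t: "t \<in> tensor2 H"
  shows "tau (lift2 H (braid (-1)) (tau t)) = lift2 H (braid 1) (conj_R t)"
proof (rule linear2_hom_ext[OF _ _ _ t])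
  show "linear_on (tensor2 H) (\<lambda>t. tau (lift2 H (braid (-1)) (tau t)))"
    by (intro linear_on_comp[OF tau_linear] linear_on_comp[OF braid_lift_linear] tau_linear braid_lift_closed tau_closed)
  show "linear_on (tensor2 H) (\<lambda>t. lift2 H (braid 1) (conj_R t))"
    by (rule linear_on_comp[OF braid_lift_linear conj_R_linear conj_R_closed])
  fix p q a b assume *: "a \<in> P p" "b \<in> P q"
  have V: "a \<in> V" "b \<in> V" using * by (simp_all add: grading_closed)
  show "tau (lift2 H (braid (-1)) (tau (pure2 H a b))) = lift2 H (braid 1) (conj_R (pure2 H a b))"
    using * V gpow_hom_closed(1)[OF *(1), of q]
    by (simp add: tau_pure[OF _ *(2)] conj_R_pure[OF *] lift2_pure[OF bilinear_braid] braid_homogeneous[OF gpow_hom_closed(1) *(2)]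
       linear_on_scale[OF tau_linear] linear_on_scale[OF braid_lift_linear] tau_pure[OF _ gpow_hom_closed(1)[OF *(1)]] closures braid_one psign_def)
qed

text \<open>
  The heart of the restriction of the correspondence. Since \<open>\<tau>\<close> is bijective, \<open>\<tau> t\<close> is invariant
  under the super flip if
  and only if the conjugate of \<open>t\<close> by \<open>R\<^sub>g\<close> is the flip of \<open>t\<close>, which is almost cocommutativity.
\<close>

lemma super_cocommutative_iff:
  assumes t: "t \<in> tensor2 H"
  shows "lift2 H (braid (-1)) (tau t) = tau t
    \<longleftrightarrow> mul2 (braid 1) H (lift2 H (braid 1) t) R = mul2 (braid 1) H R t" (is "?l \<longleftrightarrow> ?r")
proof -
  note c = t tau_closed[OF t] braid_lift_closed[OF tau_closed[OF t], of "-1"] conj_R_closed[OF t] braid_lift_closed[OF t, of 1]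
  have "?l \<longleftrightarrow> tau (lift2 H (braid (-1)) (tau t)) = t"
    by (metis tau_tau c)
  also have "\<dots> \<longleftrightarrow> conj_R t = lift2 H (braid 1) t"
    unfolding tau_superflip_tau[OF t] by (metis flip_flip c)
  also have "\<dots> \<longleftrightarrow> mul2 (braid 1) H (lift2 H (braid 1) t) R = mul2 (braid 1) H (conj_R t) R"
    by (metis R_mul_R_right c)
  finally show ?thesis by (simp add: R_mul_left t)
qed

end

locale pointed_hopf = parity_hopf H g 1
  for H :: "('a::complex_vector, 'm) hopf_scheme" and g :: 'a
begin

lemma hopf_flip: "hopf_in (flip H) H"
  using hopf hopf_in_braiding_cong[of H "braid 1" "flip H"] by (simp add: flip_def braid_one)

lemma drinfeld_R: "drinfeld_in (flip H) H R = g"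
proof -
  have F: "bilinear (\<lambda>x y. pure2 H x (S y))" by (intro hopf_intros; simp add: hopf_closures)
  have "lift2 H (\<lambda>x y. pure2 H x (S y)) R = R"
    unfolding lift2_R[OF F] antipode_unity antipode_g by (simp add: R_elem_def)
  then have "drinfeld_in (flip H) H R = lift2 H (mul H) R"
    unfolding drinfeld_in_def lift2_flip by (simp add: R_flip)
  also have "\<dots> = (1/2) *\<^sub>C (g + g)"
    unfolding lift2_R[OF mul_bilinear] by (simp add: hopf_closures mul_unity g_square)
  also have "\<dots> = (1/2 + 1/2) *\<^sub>C g" unfolding scaleC_add_left scaleC_add_right ..
  finally show ?thesis by (simp add: scaleC_one)
qed

text \<open>
  All axioms other than almost cocommutativity only involve the span of 1 and \<open>g\<close>, where they are
  finite computations.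
\<close>

lemma triangular_R:
  assumes comm: "\<And>h. h \<in> V \<Longrightarrow> mul2 (braid 1) H (lift2 H (braid 1) (D h)) R = mul2 (braid 1) H R (D h)"
  shows "triangular_in (flip H) H R"
proof -
  note F = bilinear_pure3(3)[OF unity_closed] bilinear_pure3(2)[OF unity_closed] bilinear_pure3(1)[OF unity_closed]
  have h1: "lift2 H (\<lambda>x y. lift2 H (\<lambda>a b. pure3 H a b y) (D x)) R
     = mul3 (braid 1) H (lift2 H (\<lambda>x y. pure3 H x e y) R) (lift2 H (\<lambda>x y. pure3 H e x y) R)"
    unfolding lift2_R[OF bilinear_comul3(1)] lift2_R[OF F(1)] lift2_R[OF F(2)] comul_g comul_unity
    by (simp add: lift2_pure[OF bilinear_pure3(1)] hopf_closures mul3_distrib tensor3_closed mul3_pure_one mul_unity g_square)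
     (rule ext, simp add: tensor_eval field_simps)
  have h2: "lift2 H (\<lambda>x y. lift2 H (\<lambda>a b. pure3 H x a b) (D y)) R
     = mul3 (braid 1) H (lift2 H (\<lambda>x y. pure3 H x e y) R) (lift2 H (\<lambda>x y. pure3 H x y e) R)"
    unfolding lift2_R[OF bilinear_comul3(2)] lift2_R[OF F(1)] lift2_R[OF F(3)] comul_g comul_unity
    by (simp add: lift2_pure[OF bilinear_pure3(2)] hopf_closures mul3_distrib tensor3_closed mul3_pure_one mul_unity g_square)
     (rule ext, simp add: tensor_eval field_simps)
  show ?thesis
    unfolding triangular_in_def quasitriangular_in_def Let_def mul2_flip mul3_flip lift2_flip R_flip
    using R_square R_closed comm h1 h2 by blast
qed

end

lemma pointed_hopfI:
  assumes "hopf_in (flip H) H" "grouplike H g" "mul H g g = unity H"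
  shows "pointed_hopf H g"
proof -
  have g: "g \<in> carr H" using assms by (simp add: grouplike_def)
  interpret involutive_algebra H g by (rule hopf_in_involutive_algebra[OF assms(1) g assms(3)])
  show ?thesis
    using assms hopf_in_braiding_cong[of H "braid 1" "flip H"]
    by unfold_locales (simp_all add: flip_def braid_one grouplike_def)
qed

lemma in_span_pair: "z \<in> cvec.span {x, y} \<longleftrightarrow> (\<exists>a b. z = a *\<^sub>C x + b *\<^sub>C y)"
proof
  assume "z \<in> cvec.span {x, y}"
  then obtain a b where "z - a *\<^sub>C x = b *\<^sub>C y"
    using cvec.span_breakdown_eq[of z x "{y}"] cvec.span_breakdown_eq[of _ y "{}"] by (auto simp: cvec.span_empty)
  then have "z = a *\<^sub>C x + b *\<^sub>C y" by (simp add: algebra_simps)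
  then show "\<exists>a b. z = a *\<^sub>C x + b *\<^sub>C y" by blast
next
  assume "\<exists>a b. z = a *\<^sub>C x + b *\<^sub>C y"
  then show "z \<in> cvec.span {x, y}" by (auto intro: cvec.span_add cvec.span_scale cvec.span_base)
qed

text \<open>
  The span of 1 and \<open>g\<close> is a Hopf subalgebra that contains the tensorands of \<open>R\<^sub>g\<close>.
\<close>

lemma rank_R_elem:
  fixes H :: "'a::complex_vector hopf"
  assumes "pointed_hopf H g"
  shows "R_rank H (R_elem H g) \<le> 2"
proof -
  interpret pointed_hopf H g by fact
  let ?A = "cvec.span {e, g}"
  have AV: "?A \<subseteq> V"
    by (rule cvec.span_minimal) (simp_all add: closures)
  have "hopf_subalgebra H ?A"
    unfolding hopf_subalgebra_def
  proof (intro conjI ballI)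
    show "unity H \<in> ?A" by (rule cvec.span_base) simp
    fix x assume x: "x \<in> ?A"
    then obtain a b where ab: "x = a *\<^sub>C e + b *\<^sub>C g" by (auto simp: in_span_pair)
    show "S x \<in> ?A"
      unfolding in_span_pair ab
      by (intro exI[of _ a] exI[of _ b]) (simp add: antipode_distrib closures antipode_unity antipode_g)
    have "pure2 H e e \<in> cvec.span {pure2 H a b | a b. a \<in> ?A \<and> b \<in> ?A}" "pure2 H g g \<in> cvec.span {pure2 H a b | a b. a \<in> ?A \<and> b \<in> ?A}"
      using cvec.span_base[of e "{e, g}"] cvec.span_base[of g "{e, g}"] by (intro cvec.span_base; blast)+
    then show "D x \<in> cvec.span {pure2 H a b | a b. a \<in> ?A \<and> b \<in> ?A}"
      unfolding ab by (simp add: comul_distrib closures comul_unity comul_g cvec.span_add cvec.span_scale)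
    fix y assume "y \<in> ?A"
    then obtain c d where "y = c *\<^sub>C e + d *\<^sub>C g" by (auto simp: in_span_pair)
    then show "x \<cdot> y \<in> ?A"
      unfolding ab by (simp add: mul_distrib closures mul_unity g_square cvec.span_add cvec.span_scale cvec.span_base)
  qed (use AV in auto)
  moreover have "tensorands H R \<subseteq> ?A"
  proof -
    have b: "bilinear (\<lambda>x y. f y *\<^sub>C x)" "bilinear (\<lambda>x y. f x *\<^sub>C y)" if "linear_on V f" for f
      using that by (intro bilinear_onI linear_on_functional linear_on_scaled linear_on_id; simp)+
    have A: "e \<in> ?A" "g \<in> ?A" by (rule cvec.span_base, simp)+
    have "lift2 H (\<lambda>x y. f y *\<^sub>C x) R \<in> ?A" "lift2 H (\<lambda>x y. f x *\<^sub>C y) R \<in> ?A" if "linear_on V f" for f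
      unfolding lift2_R[OF b(1)[OF that]] lift2_R[OF b(2)[OF that]]
      by (intro cvec.span_scale[of _ "{e, g}"] cvec.span_diff[of _ "{e, g}"] cvec.span_add[of _ "{e, g}"] A)+
    then show ?thesis unfolding tensorands_def by blast
  qed
  ultimately have m: "minimal_part H R \<subseteq> ?A" by (auto simp: minimal_part_def)
  then have "cvec.dim (minimal_part H R) \<le> card {e, g}" by (intro cvec.dim_le_card) auto
  also have "\<dots> \<le> 2" by (simp add: card_insert_if)
  finally have "cvec.dim (minimal_part H R) \<le> 2" .
  moreover have "\<exists>B. finite B \<and> minimal_part H R \<subseteq> cvec.span B"
    by (rule exI[of _ "{e, g}"]) (simp add: m)
  ultimately show ?thesis by (simp add: R_rank_def edim_def numeral_eq_enat)
qed

section \<open>R-matrices of rank at most two\<close>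

lemma nonzero_functional:
  fixes x :: "'a::complex_vector"
  assumes "x \<noteq> 0"
  obtains f :: "'a \<Rightarrow> complex" where "\<And>V. linear_on V f" "f x = 1"
proof -
  have "cvec.independent {x}" using assms by simp
  then have "\<exists>f :: 'a \<Rightarrow> complex. Vector_Spaces.linear scaleC scaleC f \<and> (\<forall>y\<in>{x}. f y = 1)"
    by (rule cvec_pair.linear_independent_extend)
  then obtain f :: "'a \<Rightarrow> complex" where f: "Vector_Spaces.linear scaleC scaleC f" "f x = 1" by blast
  show ?thesis
    by (rule that[of f]) (simp_all add: linear_on_def cvec_pair.linear_add[OF f(1)] cvec_pair.linear_scale[OF f(1)] f(2))
qed

context carrier_space
begin

lemma bilinear_contract:
  "linear_on V f \<Longrightarrow> bilinear (\<lambda>x y. f x *\<^sub>C y)" "linear_on V f \<Longrightarrow> bilinear (\<lambda>x y. f y *\<^sub>C x)"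
  by (intro bilinear_onI linear_on_functional linear_on_scaled linear_on_id; simp)+

lemma contract_closed:
  "linear_on V f \<Longrightarrow> t \<in> tensor2 H \<Longrightarrow> lift2 H (\<lambda>x y. f x *\<^sub>C y) t \<in> V"
  "linear_on V f \<Longrightarrow> t \<in> tensor2 H \<Longrightarrow> lift2 H (\<lambda>x y. f y *\<^sub>C x) t \<in> V"
  by (rule lift2_in[OF _ _ subspace_carr]; simp add: bilinear_contract carr_closed)+

text \<open>
  Expansion of a tensor along a basis of the first factor; the coefficients are contractions with
  the coordinate functionals. The statement allows any sufficiently large finite part of the
  basis, since two expansions have to be brought to the same index set when tensors are added.
\<close>

lemma tensor2_expand_in_basis:
  assumes B: "cvec.independent B" "B \<subseteq> V" "V \<subseteq> cvec.span B" and t: "t \<in> tensor2 H"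
  defines "coord b x \<equiv> cvec.representation B x b"
  shows "linear_on V (coord b)"
    and "\<exists>I. finite I \<and> I \<subseteq> B \<and> (\<forall>J. finite J \<longrightarrow> I \<subseteq> J \<longrightarrow> J \<subseteq> B \<longrightarrow>
      t = (\<Sum>b\<in>J. pure2 H b (lift2 H (\<lambda>x y. coord b x *\<^sub>C y) t)))"
proof -
  show lin: "linear_on V (coord b)" for b
    by (rule linear_onI)
     (simp_all add: coord_def cvec.representation_add[OF B(1) subsetD[OF B(3)] subsetD[OF B(3)]]
       cvec.representation_scale[OF B(1) subsetD[OF B(3)]] scaleC_complex_def)
  note bl = bilinear_contract(1)[OF lin]
  show "\<exists>I. finite I \<and> I \<subseteq> B \<and> (\<forall>J. finite J \<longrightarrow> I \<subseteq> J \<longrightarrow> J \<subseteq> B \<longrightarrow>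
      t = (\<Sum>b\<in>J. pure2 H b (lift2 H (\<lambda>x y. coord b x *\<^sub>C y) t)))"
    using t
  proof (induction rule: tensor2_induct)
    case zero
    have "pure2 H b 0 = 0" if "b \<in> B" for b
      using that B linear_on_zero[OF linear_on_pure2_right[OF linear_on_id, of V b] subspace_carr] by auto
    then show ?case
      by (intro exI[of _ "{}"]) (auto simp: linear_on_zero[OF lift2_linear[OF bl] subspace_tensor2] intro!: sum.neutral)
  next
    case (add x y t)
    then obtain I where I: "finite I" "I \<subseteq> B" and IJ: "\<And>J. finite J \<Longrightarrow> I \<subseteq> J \<Longrightarrow> J \<subseteq> B \<Longrightarrow>
      t = (\<Sum>b\<in>J. pure2 H b (lift2 H (\<lambda>x y. coord b x *\<^sub>C y) t))" by blast
    let ?K = "{b. coord b x \<noteq> 0}"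
    have K: "finite ?K" "?K \<subseteq> B"
      unfolding coord_def using cvec.finite_representation cvec.representation_ne_zero by blast+
    have "pure2 H x y + t = (\<Sum>b\<in>J. pure2 H b (lift2 H (\<lambda>x y. coord b x *\<^sub>C y) (pure2 H x y + t)))"
      if J: "finite J" "I \<union> ?K \<subseteq> J" "J \<subseteq> B" for J
    proof -
      have "x = (\<Sum>b | coord b x \<noteq> 0. coord b x *\<^sub>C b)"
        unfolding coord_def using B add.hyps by (intro cvec.sum_nonzero_representation_eq[symmetric]) auto
      also have "\<dots> = (\<Sum>b\<in>J. coord b x *\<^sub>C b)"
        using J by (intro sum.mono_neutral_left) auto
      finally have "pure2 H x y = pure2 H (\<Sum>b\<in>J. coord b x *\<^sub>C b) y" by (rule arg_cong)
      also have "\<dots> = (\<Sum>b\<in>J. pure2 H (coord b x *\<^sub>C b) y)"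
        using J B add.hyps by (intro linear_on_sum[OF linear_on_pure2_left[OF linear_on_id] subspace_carr]) (auto simp: carr_closed)
      also have "\<dots> = (\<Sum>b\<in>J. pure2 H b (coord b x *\<^sub>C y))"
        using J B add.hyps linear_on_scale[OF linear_on_pure2_left[OF linear_on_id]] linear_on_scale[OF linear_on_pure2_right[OF linear_on_id]]
        by (intro sum.cong refl) (auto simp: subset_iff)
      finally have 1: "pure2 H x y = (\<Sum>b\<in>J. pure2 H b (coord b x *\<^sub>C y))" .
      have 2: "pure2 H b (lift2 H (\<lambda>x y. coord b x *\<^sub>C y) (pure2 H x y + t))
         = pure2 H b (coord b x *\<^sub>C y) + pure2 H b (lift2 H (\<lambda>x y. coord b x *\<^sub>C y) t)" if "b \<in> J" for b
        using that J B add.hyps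
        by (subst linear_on_add[OF linear_on_pure2_right[OF linear_on_id], symmetric])
          (auto simp: linear_on_add[OF lift2_linear[OF bl]] lift2_pure[OF bl] pure2_in carr_closed contract_closed[OF lin])
      show ?thesis
        using IJ[of J] J by (simp add: 2 sum.distrib 1[symmetric])
    qed
    then show ?case using I K by (intro exI[of _ "I \<union> ?K"]) auto
  qed
qed

text \<open>
  Expand the tensor along a basis that extends one of \<open>M\<close>: the coefficients are contractions, so they lie in \<open>M\<close>; and a coefficient at a basis
  vector outside \<open>M\<close> is killed by every functional, because contracting with that functional leads
  into \<open>M\<close>.
\<close>

lemma tensor_of_tensorands:
  assumes t: "t \<in> tensor2 H" and M: "cvec.subspace M" "M \<subseteq> V"
    and right: "\<And>f. linear_on V f \<Longrightarrow> lift2 H (\<lambda>x y. f y *\<^sub>C x) t \<in> M"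
    and left: "\<And>f. linear_on V f \<Longrightarrow> lift2 H (\<lambda>x y. f x *\<^sub>C y) t \<in> M"
  shows "t \<in> cvec.span {pure2 H a b | a b. a \<in> M \<and> b \<in> M}"
proof -
  obtain C where C: "C \<subseteq> M" "cvec.independent C" "M \<subseteq> cvec.span C"
    using cvec.maximal_independent_subset[of M] by blast
  have CV: "C \<subseteq> V" using C M by blast
  obtain B where B: "C \<subseteq> B" "B \<subseteq> V" "cvec.independent B" "V \<subseteq> cvec.span B"
    using cvec.maximal_independent_subset_extend[OF CV C(2)] by blast
  define z where "z b = lift2 H (\<lambda>x y. cvec.representation B x b *\<^sub>C y) t" for b
  obtain J where J: "finite J" "J \<subseteq> B" "t = (\<Sum>b\<in>J. pure2 H b (z b))"
    using tensor2_expand_in_basis(2)[OF B(3,2,4) t] unfolding z_def by blast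
  have zM: "z b \<in> M" for b
    unfolding z_def by (rule left[OF tensor2_expand_in_basis(1)[OF B(3,2,4) t]])
  then have zV: "z b \<in> V" for b using M by blast
  have z0: "z b = 0" if b: "b \<in> J" "b \<notin> C" for b
  proof (rule functionals_separate)
    fix f :: "'a \<Rightarrow> complex" assume f: "Vector_Spaces.linear scaleC scaleC f"
    then have fl: "linear_on V f"
      by (simp add: linear_on_def cvec_pair.linear_add[OF f] cvec_pair.linear_scale[OF f])
    have "lift2 H (\<lambda>x y. f y *\<^sub>C x) t = (\<Sum>c\<in>J. lift2 H (\<lambda>x y. f y *\<^sub>C x) (pure2 H c (z c)))"
      unfolding J(3) using J B
      by (intro linear_on_sum[OF lift2_linear[OF bilinear_contract(2)[OF fl]] subspace_tensor2]) (auto simp: pure2_in zV)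
    also have "\<dots> = (\<Sum>c\<in>J. f (z c) *\<^sub>C c)"
      using J B by (intro sum.cong refl lift2_pure[OF bilinear_contract(2)[OF fl]]) (auto simp: zV)
    finally have m: "(\<Sum>c\<in>J. f (z c) *\<^sub>C c) \<in> M" using right[OF fl] by simp
    then have mC: "(\<Sum>c\<in>J. f (z c) *\<^sub>C c) \<in> cvec.span C" using C by blast
    have "cvec.representation B (\<Sum>c\<in>J. f (z c) *\<^sub>C c) b = cvec.representation C (\<Sum>c\<in>J. f (z c) *\<^sub>C c) b"
      using cvec.representation_extend[OF B(3) mC B(1)] by simp
    also have "\<dots> = 0" using cvec.representation_ne_zero b by blast
    finally have "cvec.representation B (\<Sum>c\<in>J. f (z c) *\<^sub>C c) b = 0" .
    moreover have "cvec.representation B (\<Sum>c\<in>J. f (z c) *\<^sub>C c) b = (\<Sum>c\<in>J. if b = c then f (z c) else 0)"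
    proof -
      have c: "c \<in> cvec.span B" "c \<in> B" if "c \<in> J" for c using that J by (auto intro: cvec.span_base)
      show ?thesis
        by (subst cvec.representation_sum[OF B(3)])
          (auto intro!: sum.cong cvec.span_scale[OF c(1)] simp: cvec.representation_scale[OF B(3) c(1)] cvec.representation_basis[OF B(3) c(2)])
    qed
    ultimately have "f (z b) = 0" using b J by simp
    then show "f (z b) = f 0" using cvec_pair.linear_0[OF f] by simp
  qed
  have "pure2 H b (z b) \<in> cvec.span {pure2 H a b | a b. a \<in> M \<and> b \<in> M}" if "b \<in> J" for b
  proof (cases "b \<in> C")
    case True
    then show ?thesis using C zM by (intro cvec.span_base) blast
  next
    case False
    then show ?thesis using z0[OF that] J B that pure2_zero(2)[of b] by (auto simp: cvec.span_zero)
  qed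
  then show ?thesis unfolding J(3) by (rule cvec.span_sum)
qed

lemma span_pure2_pair:
  assumes x: "x \<in> V" and y: "y \<in> V"
    and t: "t \<in> cvec.span {pure2 H u v | u v. u \<in> M \<and> v \<in> M}" and M: "M \<subseteq> cvec.span {x, y}"
  shows "\<exists>a b c d. t = a *\<^sub>C pure2 H x x + b *\<^sub>C pure2 H x y + c *\<^sub>C pure2 H y x + d *\<^sub>C pure2 H y y"
  using t
proof (induction rule: cvec.span_induct_alt)
  case base
  show ?case by (rule exI[of _ 0], rule exI[of _ 0], rule exI[of _ 0], rule exI[of _ 0]) simp
next
  case (step k s t)
  then obtain u v a b c d where s: "s = pure2 H u v" "u \<in> M" "v \<in> M"
    and t: "t = a *\<^sub>C pure2 H x x + b *\<^sub>C pure2 H x y + c *\<^sub>C pure2 H y x + d *\<^sub>C pure2 H y y" by blast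
  then have "u \<in> cvec.span {x, y}" "v \<in> cvec.span {x, y}" using M by blast+
  then obtain p q p' q' where uv: "u = p *\<^sub>C x + q *\<^sub>C y" "v = p' *\<^sub>C x + q' *\<^sub>C y"
    unfolding in_span_pair by blast
  have "s = (p * p') *\<^sub>C pure2 H x x + (p * q') *\<^sub>C pure2 H x y + (q * p') *\<^sub>C pure2 H y x + (q * q') *\<^sub>C pure2 H y y"
    unfolding s(1) uv using x y
    by (simp add: pure2_distrib carr_closed)
      (rule ext, simp add: tensor_eval algebra_simps)
  then show ?case
    unfolding t
    by (intro exI[of _ "k * (p * p') + a"] exI[of _ "k * (p * q') + b"] exI[of _ "k * (q * p') + c"] exI[of _ "k * (q * q') + d"])
      (simp, rule ext, simp add: tensor_eval algebra_simps)
qed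

end

lemma subspace_minimal_part: "cvec.subspace (minimal_part H R)"
  unfolding minimal_part_def by (rule cvec.subspace_Inter) (auto simp: hopf_subalgebra_def)

lemma span_of_dim_le_two:
  assumes dim: "edim M \<le> 2" and x: "x \<in> M" "x \<noteq> 0" and y: "y \<in> M" "y \<notin> cvec.span {x}"
  shows "M \<subseteq> cvec.span {x, y}"
proof -
  have i: "cvec.independent {x, y}"
    using x y by (simp add: cvec.independent_insert insert_commute[of x])
  have sub: "{x, y} \<subseteq> M" using x y by simp
  obtain B where B: "{x, y} \<subseteq> B" "B \<subseteq> M" "cvec.independent B" "M \<subseteq> cvec.span B"
    using cvec.maximal_independent_subset_extend[OF sub i] by blast
  have fin: "\<exists>F. finite F \<and> M \<subseteq> cvec.span F"
    using dim by (auto simp: edim_def split: if_splits)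
  then have "cvec.dim M \<le> 2" using dim by (auto simp: edim_def numeral_eq_enat)
  moreover have "finite B" using fin B cvec.independent_span_bound by (meson subset_trans)
  moreover have "cvec.dim M = card B" using cvec.dim_unique[OF B(2,4,3) refl] .
  moreover have "x \<noteq> y" using y cvec.span_base[of x "{x}"] by blast
  ultimately have "{x, y} = B" using B(1) by (intro card_seteq) simp_all
  then show ?thesis using B by simp
qed

context pointed_hopf
begin

text \<open>
  Subtracting \<open>\<epsilon>(y) 1\<close> from a second spanning vector \<open>y\<close> moves it into the augmentation ideal, the
  kernel of the counit, without changing the span.
\<close>

lemma spanned_by_unity_and_augmentation:
  assumes dim: "edim M \<le> 2" and M: "cvec.subspace M" "e \<in> M" "M \<subseteq> V"
  shows "\<exists>x\<in>M. \<epsilon> x = 0 \<and> M \<subseteq> cvec.span {e, x}"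
proof (cases "M \<subseteq> cvec.span {e}")
  case True
  then show ?thesis
    using cvec.subspace_0[OF M(1)] linear_on_zero[OF counit_linear subspace_carr] cvec.span_mono[of "{e}" "{e, 0}"]
    by (intro bexI[of _ 0] conjI) auto
next
  case False
  then obtain y where y: "y \<in> M" "y \<notin> cvec.span {e}" by blast
  then have yV: "y \<in> V" using M by blast
  have "e \<noteq> 0" using counit_unity linear_on_zero[OF counit_linear subspace_carr] by auto
  then have "M \<subseteq> cvec.span {e, y}" by (rule span_of_dim_le_two[OF dim M(2) _ y])
  moreover have "cvec.span {e, y} \<subseteq> cvec.span {e, y - \<epsilon> y *\<^sub>C e}"
  proof
    fix z assume "z \<in> cvec.span {e, y}"
    then obtain a b where "z = a *\<^sub>C e + b *\<^sub>C y" by (auto simp: in_span_pair)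
    then have "z = (a + b * \<epsilon> y) *\<^sub>C e + b *\<^sub>C (y - \<epsilon> y *\<^sub>C e)"
      by (simp add: scaleC_add_left scaleC_scaleC cvec.scale_right_diff_distrib)
    then show "z \<in> cvec.span {e, y - \<epsilon> y *\<^sub>C e}" by (auto simp: in_span_pair)
  qed
  moreover have "\<epsilon> (y - \<epsilon> y *\<^sub>C e) = 0"
    using yV by (simp add: linear_on_diff[OF counit_linear subspace_carr] counit_distrib closures counit_unity)
  ultimately show ?thesis
    using M y by (intro bexI[of _ "y - \<epsilon> y *\<^sub>C e"]) (auto simp: cvec.subspace_diff cvec.subspace_scale)
qed

text \<open>
  With \<open>r = (\<epsilon> \<otimes> 1)(Q)\<close> and \<open>r' = (1 \<otimes> \<epsilon>)(Q)\<close>, applying \<open>\<epsilon> \<otimes> \<epsilon> \<otimes> 1\<close> to the hexagon identity gives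
  \<open>r = r r\<close>, and applying \<open>\<epsilon> \<otimes> 1\<close> to \<open>Q Q\<^sub>2\<^sub>1 = 1\<close> gives \<open>r r' = 1\<close>; hence \<open>r = r' = 1\<close>, and this
  removes the mixed terms of \<open>Q\<close>.
\<close>

lemma R_matrix_without_mixed_terms:
  assumes x: "x \<in> V" "\<epsilon> x = 0"
    and Q: "Q = a *\<^sub>C pure2 H e e + b *\<^sub>C pure2 H e x + c *\<^sub>C pure2 H x e + d *\<^sub>C pure2 H x x"
    and hex: "lift2 H (\<lambda>x y. lift2 H (\<lambda>a b. pure3 H a b y) (D x)) Q
      = mul3 (braid 1) H (lift2 H (\<lambda>x y. pure3 H x e y) Q) (lift2 H (\<lambda>x y. pure3 H e x y) Q)"
    and inv: "mul2 (braid 1) H Q (lift2 H (braid 1) Q) = pure2 H e e"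
  shows "Q = pure2 H e e + d *\<^sub>C pure2 H x x"
proof -
  have QV: "Q \<in> tensor2 H" unfolding Q using x by (simp add: closures)
  have lift: "lift2 H F Q = a *\<^sub>C F e e + b *\<^sub>C F e x + c *\<^sub>C F x e + d *\<^sub>C F x x"
    if "bilinear F" for F :: "'a \<Rightarrow> 'a \<Rightarrow> 'b::complex_vector"
    unfolding Q using x by (simp add: lift2_add lift2_scale lift2_pure that closures)
  note F = bilinear_pure3(3)[OF unity_closed] bilinear_pure3(2)[OF unity_closed]
  define r where "r = a *\<^sub>C e + b *\<^sub>C x"
  define r' where "r' = a *\<^sub>C e + c *\<^sub>C x"
  have rV: "r \<in> V" "r' \<in> V" using x by (simp_all add: r_def r'_def closures)
  have eps: "bilinear (\<lambda>u v. \<epsilon> u *\<^sub>C v)" by (rule bilinear_contract[OF counit_linear])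
  have rr: "r \<cdot> r = r"
  proof -
    let ?T = "\<lambda>p q v. \<epsilon> p *\<^sub>C \<epsilon> q *\<^sub>C v"
    have T: "trilinear ?T" by (intro hopf_intros; simp add: hopf_closures)
    have *: "lift3 H ?T (lift2 H (\<lambda>a b. pure3 H a b v) (D u)) = \<epsilon> u *\<^sub>C v" if uv: "u \<in> V" "v \<in> V" for u v
    proof -
      have "bilinear (\<lambda>p q. \<epsilon> q *\<^sub>C p)" by (intro hopf_intros; simp add: hopf_closures)
      then have "\<epsilon> (lift2 H (\<lambda>p q. \<epsilon> q *\<^sub>C p) (D u)) *\<^sub>C v = lift2 H (\<lambda>p q. \<epsilon> (\<epsilon> q *\<^sub>C p) *\<^sub>C v) (D u)"
        by (rule linear_lift2[OF _ _ subspace_carr, where f = "\<lambda>z. \<epsilon> z *\<^sub>C v", rotated])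
          (simp_all add: uv hopf_closures linear_on_functional[OF counit_linear])
      also have "\<dots> = lift2 H (\<lambda>p q. ?T p q v) (D u)"
        by (rule lift2_cong) (simp add: counit_distrib mult.commute)
      finally show ?thesis using uv unfolding lift3_comul(1)[OF T uv] by (simp add: counit_right)
    qed
    have "lift3 H ?T (lift2 H (\<lambda>x y. lift2 H (\<lambda>a b. pure3 H a b y) (D x)) Q)
      = lift2 H (\<lambda>x y. lift3 H ?T (lift2 H (\<lambda>a b. pure3 H a b y) (D x))) Q"
      by (rule linear_lift2[OF QV bilinear_comul3(1) subspace_tensor3 comul3_closed(1) lift3_linear[OF T]])
    also have "\<dots> = lift2 H (\<lambda>u v. \<epsilon> u *\<^sub>C v) Q" by (rule lift2_cong) (rule *)
    also have "\<dots> = r" unfolding lift[OF eps] by (simp add: x(2) counit_unity scaleC_one r_def)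
    finally have 1: "lift3 H ?T (mul3 (braid 1) H (lift2 H (\<lambda>x y. pure3 H x e y) Q) (lift2 H (\<lambda>x y. pure3 H e x y) Q)) = r"
      unfolding hex .
    have "lift3 H ?T (mul3 (braid 1) H (lift2 H (\<lambda>x y. pure3 H x e y) Q) (lift2 H (\<lambda>x y. pure3 H e x y) Q)) = r \<cdot> r"
      unfolding lift[OF F(1)] lift[OF F(2)] r_def using x(1)
      by (simp add: hopf_closures mul3_distrib tensor3_closed mul3_pure_one mul_unity
         linear_on_scale[OF lift3_linear[OF T]] linear_on_add[OF lift3_linear[OF T]] lift3_pure[OF T]
         counit_mul counit_unity x(2) mul_distrib scaleC_one scaleC_add_right del: cvec.scale_scale)
    with 1 show ?thesis by simp
  qed
  have rr': "r \<cdot> r' = e"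
  proof -
    define E where "E t = lift2 H (\<lambda>u v. \<epsilon> u *\<^sub>C v) t" for t
    have E: "E (s + t) = E s + E t" "E (k *\<^sub>C s) = k *\<^sub>C E s" if "s \<in> tensor2 H" "t \<in> tensor2 H" for s t k
      using that by (simp_all add: E_def lift2_add[OF eps] lift2_scale[OF eps])
    have Ep: "E (pure2 H u v) = \<epsilon> u *\<^sub>C v" if "u \<in> V" "v \<in> V" for u v
      using that by (simp add: E_def lift2_pure[OF eps])
    have flip: "lift2 H (braid 1) Q = a *\<^sub>C pure2 H e e + b *\<^sub>C pure2 H x e + c *\<^sub>C pure2 H e x + d *\<^sub>C pure2 H x x"
      unfolding lift[OF bilinear_braid] using x by (simp add: braid_one closures)
    have "E (mul2 (braid 1) H Q (lift2 H (braid 1) Q)) = r \<cdot> r'"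
      unfolding flip unfolding Q r_def r'_def using x(1)
      by (simp add: hopf_closures mul2_distrib mul2_pure_one mul_unity E(1) E(2)[OF _ tensor2_closed(1)] Ep
        counit_mul counit_unity x(2) mul_distrib scaleC_one scaleC_add_right del: cvec.scale_scale)
    then show ?thesis unfolding inv by (simp add: Ep closures counit_unity scaleC_one)
  qed
  have re: "r = e" using rr rr' rV by (metis mul_assoc mul_unity(2))
  then have re': "r' = e" using rr' rV by (simp add: mul_unity)
  have "\<epsilon> r = a" unfolding r_def using x by (simp add: counit_distrib closures counit_unity)
  then have a: "a = 1" unfolding re by (simp add: counit_unity)
  have "b *\<^sub>C x = 0" "c *\<^sub>C x = 0" using re re' unfolding r_def r'_def a by (simp_all add: scaleC_one)
  then have bc: "b *\<^sub>C pure2 H e x = 0" "c *\<^sub>C pure2 H x e = 0"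
    using pure2_zero[of e] x by (auto simp: closures)
  show ?thesis unfolding Q bc unfolding a scaleC_one by simp
qed

text \<open>
  Contracting the third tensor factor of the hexagon identity with a functional that is 1 at \<open>x\<close>
  computes \<open>\<Delta> x\<close>; it says that \<open>u = 1 + d\<alpha> x\<close> is grouplike. The identity \<open>Q Q\<^sub>2\<^sub>1 = 1\<close> gives \<open>d\<alpha>\<^sup>2
  = -2\<close>, which makes \<open>u\<close> an involution and turns \<open>Q = 1 \<otimes> 1 - (1 - u) \<otimes> (1 - u) / 2\<close> into the
  matrix of \<open>u\<close>.
\<close>

lemma two_term_R_matrix:
  assumes x: "x \<in> V" "\<epsilon> x = 0" "x \<cdot> x = \<alpha> *\<^sub>C x" and Q: "Q = pure2 H e e + d *\<^sub>C pure2 H x x"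
    and hex: "lift2 H (\<lambda>x y. lift2 H (\<lambda>a b. pure3 H a b y) (D x)) Q
      = mul3 (braid 1) H (lift2 H (\<lambda>x y. pure3 H x e y) Q) (lift2 H (\<lambda>x y. pure3 H e x y) Q)"
    and inv: "mul2 (braid 1) H Q (lift2 H (braid 1) Q) = pure2 H e e"
  shows "\<exists>u. grouplike H u \<and> u \<cdot> u = e \<and> Q = R_elem H u"
proof (cases "x = 0 \<or> d = 0")
  case True
  then have "Q = pure2 H e e" using Q pure2_zero[of 0] by (auto simp: closures)
  moreover have "R_elem H e = (1/2) *\<^sub>C (pure2 H e e + pure2 H e e)" by (simp add: R_elem_def)
  moreover have "\<dots> = (1/2 + 1/2) *\<^sub>C pure2 H e e" unfolding scaleC_add_left scaleC_add_right ..
  ultimately have "Q = R_elem H e" by (simp add: scaleC_one)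
  moreover have "e \<noteq> 0" using counit_unity linear_on_zero[OF counit_linear subspace_carr] by auto
  ultimately show ?thesis using comul_unity unity_closed mul_unity(1)[OF unity_closed] by (auto simp: grouplike_def)
next
  case False
  have lift: "lift2 H F Q = F e e + d *\<^sub>C F x x" if "bilinear F" for F :: "'a \<Rightarrow> 'a \<Rightarrow> 'b::complex_vector"
    unfolding Q using x(1) by (simp add: lift2_add lift2_scale lift2_pure that closures)
  note F = bilinear_pure3(3)[OF unity_closed] bilinear_pure3(2)[OF unity_closed]
  obtain f :: "'a \<Rightarrow> complex" where f: "linear_on V f" "f x = 1"
    using nonzero_functional[of x] False by metis
  let ?T = "\<lambda>p q v. f v *\<^sub>C pure2 H p q"
  have T: "trilinear ?T" by (intro hopf_intros f(1); simp add: hopf_closures)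
  have *: "lift3 H ?T (lift2 H (\<lambda>a b. pure3 H a b v) (D u)) = f v *\<^sub>C D u" if uv: "u \<in> V" "v \<in> V" for u v
  proof -
    have "lift2 H (\<lambda>p q. f v *\<^sub>C pure2 H p q) (D u) = f v *\<^sub>C lift2 H (pure2 H) (D u)"
      by (rule linear_lift2[OF _ bilinear_pure2 subspace_tensor2, where f = "\<lambda>z. f v *\<^sub>C z", symmetric])
        (simp_all add: uv hopf_closures linear_on_scaled linear_on_id)
    then show ?thesis unfolding lift3_comul(1)[OF T uv] using uv by (simp add: lift2_pure_id hopf_closures)
  qed
  have "lift3 H ?T (lift2 H (\<lambda>x y. lift2 H (\<lambda>a b. pure3 H a b y) (D x)) Q) = f e *\<^sub>C pure2 H e e + d *\<^sub>C D x"
    unfolding lift[OF bilinear_comul3(1)] using x(1)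
    by (simp add: linear_on_scale[OF lift3_linear[OF T]] linear_on_add[OF lift3_linear[OF T]] comul3_closed closures
        tensor3_closed * f(2) scaleC_one)
      (simp add: comul_unity)
  moreover have "lift3 H ?T (mul3 (braid 1) H (lift2 H (\<lambda>x y. pure3 H x e y) Q) (lift2 H (\<lambda>x y. pure3 H e x y) Q))
     = f e *\<^sub>C pure2 H e e + d *\<^sub>C (pure2 H e x + pure2 H x e + (d * \<alpha>) *\<^sub>C pure2 H x x)"
    unfolding lift[OF F(1)] lift[OF F(2)] using x(1)
    by (simp add: hopf_closures mul3_distrib tensor3_closed mul3_pure_one mul_unity x(3) lift3_pure[OF T]
       linear_on_scale[OF lift3_linear[OF T]] linear_on_add[OF lift3_linear[OF T]]
       linear_on_scale[OF f(1)] f(2) scaleC_complex_def scaleC_one)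
      (rule ext, simp add: tensor_eval algebra_simps)
  ultimately have "d *\<^sub>C D x = d *\<^sub>C (pure2 H e x + pure2 H x e + (d * \<alpha>) *\<^sub>C pure2 H x x)"
    using hex by auto
  then have Dx: "D x = pure2 H e x + pure2 H x e + (d * \<alpha>) *\<^sub>C pure2 H x x"
    using False by (simp only: cvec.scale_cancel_left) simp
  have "mul2 (braid 1) H Q Q = pure2 H e e + (2 * d + d * d * \<alpha> * \<alpha>) *\<^sub>C pure2 H x x"
    unfolding Q using x(1)
    by (simp add: hopf_closures mul2_distrib mul2_pure_one mul_unity x(3) pure2_distrib)
      (rule ext, simp add: tensor_eval algebra_simps)
  moreover have "lift2 H (braid 1) Q = Q"
    unfolding lift[OF bilinear_braid] using x by (simp add: braid_one closures Q)
  ultimately have "(2 * d + d * d * \<alpha> * \<alpha>) *\<^sub>C pure2 H x x = 0" using inv by simp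
  moreover have ff: "bilinear (\<lambda>p q. f p *\<^sub>C f q)" by (intro hopf_intros f(1))
  have "lift2 H (\<lambda>p q. f p *\<^sub>C f q) (pure2 H x x) = 1"
    unfolding lift2_pure[OF ff x(1) x(1)] by (simp add: f(2) scaleC_complex_def)
  then have "pure2 H x x \<noteq> 0" using lift2_zero[OF ff] by auto
  ultimately have "2 * d + d * d * \<alpha> * \<alpha> = 0" by (simp only: cvec.scale_eq_0_iff) simp
  then have "d * (d * (\<alpha> * \<alpha>) + 2) = 0" by (simp add: algebra_simps)
  then have d: "d * (\<alpha> * \<alpha>) = -2" using False by (simp add: eq_neg_iff_add_eq_0)
  define k where "k = d * \<alpha>"
  define u where "u = e + k *\<^sub>C x"
  have uV: "u \<in> V" using x by (simp add: u_def closures)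
  have "D u = pure2 H u u"
    unfolding u_def k_def using x(1)
    by (simp add: comul_distrib closures Dx comul_unity pure2_distrib) (rule ext, simp add: tensor_eval algebra_simps)
  moreover have "u \<noteq> 0"
  proof -
    have "\<epsilon> u = 1" unfolding u_def using x by (simp add: counit_distrib closures counit_unity)
    then show ?thesis using linear_on_zero[OF counit_linear subspace_carr] by auto
  qed
  moreover have "u \<cdot> u = e"
  proof -
    have "u \<cdot> u = e + (k *\<^sub>C x + (k *\<^sub>C x + (k * (k * \<alpha>)) *\<^sub>C x))"
      unfolding u_def using x(1) by (simp add: mul_distrib closures mul_unity x(3) scaleC_add_right add.assoc)
    also have "\<dots> = e + (k * (2 + d * (\<alpha> * \<alpha>))) *\<^sub>C x"
      unfolding scaleC_add_left[symmetric] by (simp add: k_def algebra_simps)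
    finally show ?thesis unfolding d by simp
  qed
  moreover have "Q = R_elem H u"
  proof -
    have "R_elem H u = pure2 H e e + (- (1/2) * d * (d * (\<alpha> * \<alpha>))) *\<^sub>C pure2 H x x"
      unfolding R_elem_def u_def k_def using x(1)
      by (simp add: closures pure2_distrib) (rule ext, simp add: tensor_eval field_simps)
    then show ?thesis unfolding d Q by simp
  qed
  ultimately show ?thesis using uV by (auto simp: grouplike_def)
qed

end

text \<open>
  The minimal part \<open>M\<close> is closed under multiplication and contains all tensorands, so \<open>R\<close> lies in
  \<open>M \<otimes> M\<close> and the square of an element of the augmentation ideal of \<open>M\<close> is a multiple of it.
\<close>

lemma rank_le_two_R_elem:
  fixes H :: "'a::complex_vector hopf"
  assumes tri: "triangular_hopf_algebra H R" and rank: "R_rank H R \<le> 2"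
  shows "\<exists>u. grouplike H u \<and> mul H u u = unity H \<and> R = R_elem H u"
proof -
  have hopf: "hopf_in (flip H) H" and qt: "quasitriangular_in (flip H) H R"
    and RR: "mul2 (flip H) H R (lift2 H (flip H) R) = pure2 H (unity H) (unity H)"
    using tri by (simp_all add: triangular_hopf_algebra_def triangular_in_def)
  have h: "comul H (unity H) = pure2 H (unity H) (unity H)" "unity H \<in> carr H" "mul H (unity H) (unity H) = unity H"
    "counit H (unity H) = 1" "linear_on (carr H) (counit H)" "cvec.subspace (carr H)"
    using hopf unfolding hopf_in_def Let_def by simp_all
  have "unity H \<noteq> 0" using linear_on_zero[OF h(5,6)] h(4) by auto
  then interpret pointed_hopf H "unity H"
    using h hopf by (intro pointed_hopfI) (simp_all add: grouplike_def)
  have R: "R \<in> tensor2 H" using qt by (simp add: quasitriangular_in_def Let_def)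
  define M where "M = minimal_part H R"
  have "hopf_subalgebra H V"
    using hopf_closures subspace_carr unfolding hopf_subalgebra_def
    by (auto simp: tensor2_def tensor_def pure2_def[symmetric]
        intro: comul_closed[unfolded tensor2_def tensor_def, folded pure2_def])
  moreover have "tensorands H R \<subseteq> V"
    unfolding tensorands_def using contract_closed[OF _ R] by blast
  ultimately have MV: "M \<subseteq> V" by (auto simp: M_def minimal_part_def)
  have M: "cvec.subspace M" "e \<in> M" "\<And>x y. x \<in> M \<Longrightarrow> y \<in> M \<Longrightarrow> x \<cdot> y \<in> M" "tensorands H R \<subseteq> M"
    unfolding M_def using subspace_minimal_part[of H R] by (auto simp: minimal_part_def hopf_subalgebra_def)
  have RM: "R \<in> cvec.span {pure2 H a b | a b. a \<in> M \<and> b \<in> M}"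
    using M(4) by (intro tensor_of_tensorands[OF R M(1) MV]) (auto simp: tensorands_def)
  obtain x where x: "x \<in> M" "\<epsilon> x = 0" "M \<subseteq> cvec.span {e, x}"
    using spanned_by_unity_and_augmentation[OF _ M(1,2) MV] rank by (auto simp: R_rank_def M_def)
  have xV: "x \<in> V" using x MV by blast
  have "x \<cdot> x \<in> cvec.span {e, x}" using M(3)[OF x(1) x(1)] x(3) by blast
  then obtain \<beta> \<alpha> where xx: "x \<cdot> x = \<beta> *\<^sub>C e + \<alpha> *\<^sub>C x" by (auto simp: in_span_pair)
  have "\<epsilon> (x \<cdot> x) = 0" using xV x(2) by (simp add: counit_mul)
  then have "\<beta> = 0" unfolding xx using xV x(2) by (simp add: counit_distrib closures counit_unity)
  then have xx': "x \<cdot> x = \<alpha> *\<^sub>C x" using xx by simp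
  obtain a b c d where Rc: "R = a *\<^sub>C pure2 H e e + b *\<^sub>C pure2 H e x + c *\<^sub>C pure2 H x e + d *\<^sub>C pure2 H x x"
    using span_pure2_pair[OF unity_closed xV RM x(3)] by blast
  have hex: "lift2 H (\<lambda>x y. lift2 H (\<lambda>a b. pure3 H a b y) (D x)) R
     = mul3 (braid 1) H (lift2 H (\<lambda>x y. pure3 H x e y) R) (lift2 H (\<lambda>x y. pure3 H e x y) R)"
    using qt unfolding quasitriangular_in_def Let_def mul3_flip by blast
  have inv: "mul2 (braid 1) H R (lift2 H (braid 1) R) = pure2 H e e"
    using RR unfolding mul2_flip lift2_flip .
  show ?thesis
    by (rule two_term_R_matrix[OF xV x(2) xx' R_matrix_without_mixed_terms[OF xV x(2) Rc hex inv] hex inv])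
qed

section \<open>The two kinds of objects\<close>

text \<open>
  Stated by components, because the twist of an ordinary Hopf algebra is wanted as a record with a
  grading and that of a superalgebra as one without.
\<close>

definition is_twist :: "('a::complex_vector, 'm) hopf_scheme \<Rightarrow> 'a \<Rightarrow> ('a, 'n) hopf_scheme \<Rightarrow> bool" where
  "is_twist H g T \<longleftrightarrow> carr T = carr H \<and> mul T = mul H \<and> unity T = unity H \<and> counit T = counit H
     \<and> comul T = twisted_comul H (adjoint_grading H g) g \<and> antipode T = twisted_antipode H (adjoint_grading H g) g"

lemma tensor_cong:
  assumes "carr T = carr H"
  shows "pure2 T = pure2 H" "lift2 T = lift2 H" "tensor2 T = tensor2 H" "pure3 T = pure3 H" "lift3 T = lift3 H"
  using assms by (simp_all add: pure2_def lift2_def tensor2_def pure3_def lift3_def fun_eq_iff)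

lemma adjoint_grading_cong:
  "carr T = carr H \<Longrightarrow> mul T = mul H \<Longrightarrow> unity T = unity H \<Longrightarrow> adjoint_grading T g = adjoint_grading H g"
  by (simp add: adjoint_grading_def conjugate_def inverse_in_def fun_eq_iff)

lemma involutive_algebra_cong:
  "involutive_algebra H g \<Longrightarrow> carr T = carr H \<Longrightarrow> mul T = mul H \<Longrightarrow> unity T = unity H \<Longrightarrow> involutive_algebra T g"
  by (simp add: involutive_algebra_def involutive_algebra_axioms_def carrier_space_def)

context involutive_algebra
begin

lemma cong_algebra:
  fixes T :: "('a, 'n) hopf_scheme"
  assumes "carr T = carr H" "mul T = mul H" "unity T = unity H"
  shows "involutive_algebra.braid T g = braid" "involutive_algebra.tau T g = tau"
    "involutive_algebra.gpow T g = gpow" "R_elem T g = R" "mul2 c T = mul2 c H"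
    "twisted_R T (adjoint_grading T g) g = twisted_R H P g"
proof -
  note c = assms tensor_cong[OF assms(1)] adjoint_grading_cong[OF assms, of g]
  interpret T: involutive_algebra T g
    by (rule involutive_algebra_cong[OF involutive_algebra_axioms assms])
  show "T.braid = braid" by (rule ext, rule ext, rule ext) (simp add: T.braid_def braid_def c)
  show g: "T.gpow = gpow" by (rule ext) (simp add: T.gpow_def gpow_def c)
  show "T.tau = tau" unfolding T.tau_def tau_def c g ..
  show R: "R_elem T g = R" by (simp add: R_elem_def c)
  show m: "mul2 c T = mul2 c H" for c by (rule ext, rule ext) (simp add: mul2_def c)
  have "flip T = flip H" by (rule ext, rule ext) (simp add: flip_def c)
  then show "twisted_R T (adjoint_grading T g) g = twisted_R H P g"
    by (intro ext[of "twisted_R T _ g"]) (simp only: twisted_R_def tensor_part_def R m c)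
qed

lemma twisted_R_R: "twisted_R H P g R = pure2 H e e"
  and twisted_R_unity: "twisted_R H P g (pure2 H e e) = R"
proof -
  have b: "bilinear (\<lambda>x y. pure2 H (hcomp P i x) (hcomp P i y))" for i
    by (intro multilinear_intros; simp add: closures)
  have "tensor_part H P False R = R" "tensor_part H P True R = 0"
    unfolding tensor_part_def lift2_R[OF b]
    by (simp_all add: hcomp_homogeneous[OF unity_even] hcomp_homogeneous[OF g_even] R_elem_def pure2_zero closures)
  then show "twisted_R H P g R = pure2 H e e"
    by (simp add: twisted_R_def mul2_flip linear_on_zero[OF mul2_linear_right] closures subspace_tensor2 R_square)
  have "tensor_part H P False (pure2 H e e) = pure2 H e e" "tensor_part H P True (pure2 H e e) = 0"
    unfolding tensor_part_def 
    by (simp_all add: lift2_pure[OF b] hcomp_homogeneous[OF unity_even] pure2_zero closures)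
  then show "twisted_R H P g (pure2 H e e) = R"
    by (simp add: twisted_R_def mul2_flip linear_on_zero[OF mul2_linear_right] closures subspace_tensor2 unity_mul_R)
qed

end

context parity_hopf
begin

lemma parity_hopf_twist:
  assumes T: "is_twist H g T"
  shows "parity_hopf T g (- s)"
proof -
  have c: "carr T = carr H" "mul T = mul H" "unity T = unity H" and T': "counit T = counit H"
     "comul T = Dt" "antipode T = St" using T by (simp_all add: is_twist_def)
  interpret T: involutive_algebra T g
    by (rule involutive_algebra_cong[OF involutive_algebra_axioms c])
  have "hopf_in (T.braid (- s)) T = hopf_in (braid (- s)) (twist H P g)"
    unfolding cong_algebra[OF c] by (rule hopf_in_cong) (simp_all add: twist_simps c T')
  then show ?thesis
    using hopf_in_twist twisted_comul_gpow[of True] g_nonzero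
    by unfold_locales (simp_all add: T' tensor_cong[OF c(1)] gpow_def)
qed

lemma twist_twist:
  assumes T: "is_twist H g T" and h: "h \<in> V"
  shows "twisted_comul T (adjoint_grading T g) g h = D h" "twisted_antipode T (adjoint_grading T g) g h = S h"
proof -
  have c: "carr T = carr H" "mul T = mul H" "unity T = unity H" and T': "counit T = counit H"
     "comul T = Dt" "antipode T = St" using T by (simp_all add: is_twist_def)
  interpret T: parity_hopf T g "- s" by (rule parity_hopf_twist[OF T])
  show "T.Dt h = D h"
    using h by (subst T.twisted_comul_eq) (simp_all add: c T' cong_algebra[OF c] twisted_comul_eq tau_tau hopf_closures)
  note P = adjoint_grading_cong[OF c, of g]
  show "T.St h = S h"
  proof (rule linear_hom_ext[OF _ antipode_linear _ h])
    show "linear_on V T.St" using T.twisted_antipode_linear by (simp add: c)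
    fix p x assume x: "x \<in> P p"
    then have "T.St x = gpow p \<cdot> St x"
      by (subst T.twisted_antipode_homogeneous[of x p]) (simp_all add: P c T' cong_algebra[OF c])
    also have "\<dots> = gpow p \<cdot> gpow p \<cdot> S x"
      using x by (simp add: twisted_antipode_homogeneous mul_assoc hopf_closures)
    finally show "T.St x = S x" using x by (simp add: gpow_mul gpow_False mul_unity hopf_closures)
  qed
qed

end

lemma superflip_eq_braid:
  assumes "involutive_algebra K g" "part K = adjoint_grading K g"
  shows "superflip K = involutive_algebra.braid K g (-1)"
proof -
  interpret involutive_algebra K g by fact
  show ?thesis by (rule ext, rule ext) (simp add: superflip_def braid_def assms(2) psign_def)
qed

text \<open>
  The grading of a superalgebra with a parity element is determined by that element: the given
  parts lie in the eigenspaces of conjugation, and since they span the carrier they exhaust them.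
\<close>

lemma parity_element_grading:
  assumes K: "hopf_superalgebra K" and g: "parity_element K g"
  shows "parity_hopf K g (-1)" "part K = adjoint_grading K g"
proof -
  have h: "hopf_in (superflip K) K" and sub: "\<And>p. cvec.subspace (part K p)"
    and carr: "carr K = {x + y | x y. x \<in> part K False \<and> y \<in> part K True}"
    using K by (simp_all add: hopf_superalgebra_def all_bool_eq) (metis (full_types))
  have gl: "g \<in> carr K" "g \<noteq> 0" "comul K g = pure2 K g g" and gg: "mul K g g = unity K"
    and conj: "\<And>p x. x \<in> part K p \<Longrightarrow> conjugate K g x = psign p *\<^sub>C x"
    using g by (simp_all add: parity_element_def grouplike_def)
  interpret involutive_algebra K g by (rule hopf_in_involutive_algebra[OF h gl(1) gg])
  have sum: "x + y \<in> V" if "x \<in> part K False" "y \<in> part K True" for x y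
    using that carr by blast
  have partV: "x \<in> V" if "x \<in> part K p" for x p
    using sum[of x 0] sum[of 0 x] that sub[THEN cvec.subspace_0] by (cases p) auto
  have le: "part K p \<subseteq> P p" for p
    using conj partV by (auto simp: adjoint_grading_def)
  have ge: "P p \<subseteq> part K p" for p
  proof
    fix x assume x: "x \<in> P p"
    then obtain y z where yz: "y \<in> part K False" "z \<in> part K True" "x = y + z"
      using grading_closed[OF x] carr by blast
    then have PP: "y \<in> P False" "z \<in> P True" using le by blast+
    have "hcomp P q x = hcomp P q y + hcomp P q z" for q
      using PP unfolding yz(3) by (intro linear_on_add[OF linear_on_hcomp_V] grading_closed)
    then have "hcomp P False x = y" "hcomp P True x = z"
      using PP by (simp_all add: hcomp_homogeneous)
    then show "x \<in> part K p"
      using hcomp_homogeneous[OF x] yz by (cases p) auto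
  qed
  show part: "part K = P" using le ge by (intro ext) blast
  show "parity_hopf K g (-1)"
    using h gl superflip_eq_braid[OF involutive_algebra_axioms part] by unfold_locales simp_all
qed

lemma hopf_superalgebraI:
  assumes "parity_hopf K g (-1)" and part: "part K = adjoint_grading K g"
  shows "hopf_superalgebra K" "parity_element K g"
proof -
  interpret parity_hopf K g "-1" by fact
  have "tensor2_part K r = graded2 r" for r by (simp add: tensor2_part_def graded2_def part)
  moreover have carr: "V = {y + z | y z. y \<in> P False \<and> z \<in> P True}"
  proof (intro equalityI subsetI)
    fix x assume x: "x \<in> V"
    have "x = hcomp P False x + hcomp P True x" using hcomp_sum[OF x] by (simp add: UNIV_bool add.commute)
    then show "x \<in> {y + z | y z. y \<in> P False \<and> z \<in> P True}" using hcomp_in_grading[OF x] by blast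
  qed (auto intro: carr_closed grading_closed)
  moreover have "P False \<inter> P True = {0}"
  proof -
    have "x = 0" if "x \<in> P False" "x \<in> P True" for x
      using hcomp_homogeneous[OF that(1), of False] hcomp_homogeneous[OF that(2), of False] by simp
    then show ?thesis using cvec.subspace_0[OF subspace_grading] by blast
  qed
  ultimately show "hopf_superalgebra K"
    unfolding hopf_superalgebra_def part superflip_eq_braid[OF involutive_algebra_axioms part]
    using hopf by (intro conjI allI ballI)
      (fact carr | erule (1) grading_mul | simp add: subspace_grading unity_even comul_graded counit_odd antipode_grading)+
  show "parity_element K g"
    unfolding parity_element_def grouplike_def part
    by (simp add: g_closed g_nonzero comul_g g_square adjoint_grading_def)
qed

text \<open>
  The equivalence serves both directions: \<open>K\<close> is the superalgebra obtained from \<open>H\<close>, or the one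
  from which \<open>H\<close> was obtained.
\<close>

lemma cocommutative_twist:
  assumes H: "pointed_hopf H g" and K: "parity_hopf K g (-1)" and part: "part K = adjoint_grading K g"
    and c: "carr K = carr H" "mul K = mul H" "unity K = unity H"
    and tw: "\<And>h. h \<in> carr H \<Longrightarrow> comul K h = involutive_algebra.tau H g (comul H h)"
  shows "cocommutative_super K \<longleftrightarrow> (\<forall>h\<in>carr H. mul2 (flip H) H (lift2 H (flip H) (comul H h)) (R_elem H g)
      = mul2 (flip H) H (R_elem H g) (comul H h))"
proof -
  interpret pointed_hopf H g by fact
  interpret K: parity_hopf K g "-1" by fact
  show ?thesis
    unfolding cocommutative_super_def superflip_eq_braid[OF K.involutive_algebra_axioms part]
    using super_cocommutative_iff[OF comul_closed]
    by (simp add: cong_algebra[OF c] tensor_cong[OF c(1)] c tw mul2_flip lift2_flip)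
qed

definition twist_super :: "('a::complex_vector, 'm) hopf_scheme \<Rightarrow> 'a \<Rightarrow> 'a hopf_super" where
  "twist_super H g = \<lparr>carr = carr H, mul = mul H, unity = unity H, comul = twisted_comul H (adjoint_grading H g) g,
     counit = counit H, antipode = twisted_antipode H (adjoint_grading H g) g, part = adjoint_grading H g\<rparr>"

lemma is_twist_super: "is_twist H g (twist_super H g)"
  by (simp add: is_twist_def twist_super_def)

lemma is_twist_twist: "is_twist H g (twist H (adjoint_grading H g) g)"
  by (simp add: is_twist_def twist_simps)

lemma part_twist_super: "part (twist_super H g) = adjoint_grading (twist_super H g) g"
  by (simp add: twist_super_def adjoint_grading_def conjugate_def inverse_in_def fun_eq_iff)

text \<open>
  The class of objects on the ordinary side, freed from the notion of rank.
\<close>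

lemma rank_le_two_iff:
  "(H, R) \<in> rank_le_two_objects \<longleftrightarrow> (\<exists>u. pointed_hopf H u \<and> R = R_elem H u \<and> triangular_hopf_algebra H R)"
proof
  assume "(H, R) \<in> rank_le_two_objects"
  then have t: "triangular_hopf_algebra H R" "R_rank H R \<le> 2" by (simp_all add: rank_le_two_objects_def)
  then obtain u where "grouplike H u" "mul H u u = unity H" "R = R_elem H u" using rank_le_two_R_elem by blast
  then show "\<exists>u. pointed_hopf H u \<and> R = R_elem H u \<and> triangular_hopf_algebra H R"
    using t pointed_hopfI[of H u] by (auto simp: triangular_hopf_algebra_def)
next
  assume "\<exists>u. pointed_hopf H u \<and> R = R_elem H u \<and> triangular_hopf_algebra H R"
  then show "(H, R) \<in> rank_le_two_objects" using rank_R_elem by (auto simp: rank_le_two_objects_def)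
qed

lemma drinfeld_R_elem: "pointed_hopf H u \<Longrightarrow> drinfeld H (R_elem H u) = u"
  unfolding drinfeld_def by (rule pointed_hopf.drinfeld_R)

lemma cocommutative_iff:
  "(K, R, g) \<in> cocommutative_objects \<longleftrightarrow> parity_hopf K g (-1) \<and> part K = adjoint_grading K g
     \<and> cocommutative_super K \<and> R = pure2 K (unity K) (unity K)"
  using parity_element_grading[of K g] hopf_superalgebraI[of K g] by (auto simp: cocommutative_objects_def)

lemma superize_R_elem:
  fixes H :: "'a::complex_vector hopf"
  assumes "pointed_hopf H u"
  shows "superize (H, R_elem H u) = (twist_super H u, pure2 H (unity H) (unity H), u)"
proof -
  interpret pointed_hopf H u by fact
  show ?thesis by (simp add: superize_def Let_def drinfeld_R_elem[OF assms] twist_super_def twisted_R_R)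
qed

lemma superize_object:
  assumes "(H, R) \<in> rank_le_two_objects"
  shows "superize (H, R) \<in> cocommutative_objects"
proof -
  obtain u where u: "pointed_hopf H u" "R = R_elem H u" and t: "triangular_hopf_algebra H R"
    using assms rank_le_two_iff by blast
  let ?K = "twist_super H u"
  interpret pointed_hopf H u by fact
  have K: "parity_hopf ?K u (-1)" using parity_hopf_twist[OF is_twist_super] .
  have c: "carr ?K = carr H" "mul ?K = mul H" "unity ?K = unity H" "comul ?K = Dt"
    by (simp_all add: twist_super_def)
  have "cocommutative_super ?K"
    using t cocommutative_twist[OF u(1) K part_twist_super c(1-3)]
    by (simp add: c twisted_comul_eq u(2) triangular_hopf_algebra_def triangular_in_def quasitriangular_in_def Let_def)
  then show ?thesis
    unfolding u(2) superize_R_elem[OF u(1)] cocommutative_iff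
    by (simp add: K part_twist_super c tensor_cong[OF c(1)])
qed

lemma unsuperize_unit:
  assumes "parity_hopf K g (-1)" "part K = adjoint_grading K g"
  shows "unsuperize (K, pure2 K (unity K) (unity K), g) = (twist K (part K) g, R_elem K g)"
proof -
  interpret parity_hopf K g "-1" by fact
  show ?thesis by (simp add: unsuperize_def Let_def twist_def assms(2) twisted_R_unity)
qed

lemma unsuperize_object:
  assumes "(K, R, g) \<in> cocommutative_objects"
  shows "unsuperize (K, R, g) = (twist K (part K) g, R_elem (twist K (part K) g) g)"
    and "pointed_hopf (twist K (part K) g) g"
    and "unsuperize (K, R, g) \<in> rank_le_two_objects"
proof -
  let ?H = "twist K (part K) g"
  have K: "parity_hopf K g (-1)" and part: "part K = adjoint_grading K g" and coc: "cocommutative_super K"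
    and R: "R = pure2 K (unity K) (unity K)" using assms by (simp_all add: cocommutative_iff)
  interpret K: parity_hopf K g "-1" by (rule K)
  have H: "is_twist K g ?H" unfolding part by (rule is_twist_twist)
  have c: "carr ?H = carr K" "mul ?H = mul K" "unity ?H = unity K" by (simp_all add: twist_simps)
  have "parity_hopf ?H g 1" using K.parity_hopf_twist[OF H] by simp
  then show p: "pointed_hopf ?H g" by (simp add: pointed_hopf_def)
  interpret pointed_hopf ?H g by (rule p)
  show u: "unsuperize (K, R, g) = (?H, R_elem ?H g)"
    using unsuperize_unit[OF K part] K.cong_algebra(4)[OF c] by (simp add: R)
  have tw: "comul K h = tau (comul ?H h)" if "h \<in> carr ?H" for h
    using K.twist_twist(1)[OF H, of h] twisted_comul_eq[OF that] that by (simp add: c)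
  have "triangular_in (flip ?H) ?H (R_elem ?H g)"
  proof (rule triangular_R)
    show "mul2 (braid 1) ?H (lift2 ?H (braid 1) (comul ?H h)) (R_elem ?H g) = mul2 (braid 1) ?H (R_elem ?H g) (comul ?H h)"
      if "h \<in> carr ?H" for h
      using coc cocommutative_twist[OF p K part c[symmetric] tw] that by (simp add: mul2_flip lift2_flip)
  qed
  then show "unsuperize (K, R, g) \<in> rank_le_two_objects"
    unfolding u rank_le_two_iff using p hopf_flip by (auto simp: triangular_hopf_algebra_def)
qed

lemma rank_le_two_objects_triangular: "rank_le_two_objects \<subseteq> triangular_objects"
proof clarify
  fix H :: "'a hopf" and R assume "(H, R) \<in> rank_le_two_objects"
  then obtain u where u: "pointed_hopf H u" "R = R_elem H u" and t: "triangular_hopf_algebra H R"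
    using rank_le_two_iff by blast
  interpret pointed_hopf H u by fact
  show "(H, R) \<in> triangular_objects"
    using t by (simp add: triangular_objects_def u(2) drinfeld_R_elem[OF u(1)] g_square)
qed

text \<open>
  For the R-matrix \<open>1 \<otimes> 1\<close> all axioms are trivial except almost cocommutativity, which is
  cocommutativity.
\<close>

lemma cocommutative_objects_triangular: "cocommutative_objects \<subseteq> super_objects"
proof clarify
  fix K :: "'a hopf_super" and R g assume "(K, R, g) \<in> cocommutative_objects"
  then have K: "parity_hopf K g (-1)" and part: "part K = adjoint_grading K g" and coc: "cocommutative_super K"
    and R: "R = pure2 K (unity K) (unity K)" by (simp_all add: cocommutative_iff)
  interpret parity_hopf K g "-1" by (rule K)
  have sf: "superflip K = braid (-1)" by (rule superflip_eq_braid[OF involutive_algebra_axioms part])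
  have one: "mul2 (braid (-1)) K (pure2 K e e) t = t" "mul2 (braid (-1)) K t (pure2 K e e) = t" if t: "t \<in> tensor2 K" for t
  proof -
    have "mul2 (braid (-1)) K (pure2 K e e) t = lift2 K (pure2 K) t" "mul2 (braid (-1)) K t (pure2 K e e) = lift2 K (pure2 K) t"
      unfolding mul2_braid_even[OF t unity_even unity_even] by (rule lift2_cong; simp add: mul_unity)+
    then show "mul2 (braid (-1)) K (pure2 K e e) t = t" "mul2 (braid (-1)) K t (pure2 K e e) = t"
      by (simp_all add: lift2_pure_id t)
  qed
  have ee: "pure2 K e e \<in> tensor2 K" "braid (-1) e e = pure2 K e e"
    using braid_homogeneous[OF unity_even unity_even] by (simp_all add: closures scaleC_one)
  have three: "mul3 (braid (-1)) K (pure3 K e e e) (pure3 K e e e) = pure3 K e e e"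
    by (simp add: mul3_pure mul3_core_flip ee closures mul_unity)
  have "quasitriangular_in (braid (-1)) K R"
    unfolding quasitriangular_in_def Let_def R lift2_pure[OF bilinear_comul3(1) unity_closed unity_closed] lift2_pure[OF bilinear_comul3(2) unity_closed unity_closed]
    using coc by (auto simp: ee one three lift2_pure bilinear_pure3 unity_closed comul_unity comul_closed cocommutative_super_def sf braid_lift_closed
        intro!: bexI[of _ "pure2 K e e"])
  moreover have "mul2 (braid (-1)) K R (lift2 K (braid (-1)) R) = pure2 K e e"
    by (simp add: R lift2_pure[OF bilinear_braid] unity_closed ee one)
  moreover have "drinfeld_in (braid (-1)) K R = e"
  proof -
    have "bilinear (\<lambda>x y. pure2 K x (S y))" by (intro hopf_intros; simp add: hopf_closures)
    then show ?thesis
      by (simp add: drinfeld_in_def R lift2_pure lift2_pure[OF bilinear_braid] lift2_pure[OF mul_bilinear] unity_closed ee antipode_unity mul_unity)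
  qed
  moreover have "R \<in> tensor2_part K False"
    unfolding tensor2_part_def R part using unity_even by (intro cvec.span_base) blast
  ultimately show "(K, R, g) \<in> super_objects"
    using hopf_superalgebraI[OF K part]
    by (simp add: super_objects_def triangular_hopf_superalgebra_def triangular_in_def drinfeld_super_def sf R)
qed

section \<open>Isomorphisms\<close>

lemma hopf_in_closed:
  assumes "hopf_in c H"
  shows "carrier_space H" "x \<in> carr H \<Longrightarrow> comul H x \<in> tensor2 H" "x \<in> carr H \<Longrightarrow> antipode H x \<in> carr H"
    "x \<in> carr H \<Longrightarrow> y \<in> carr H \<Longrightarrow> mul H x y \<in> carr H" "unity H \<in> carr H"
  using assms unfolding hopf_in_def Let_def carrier_space_def by blast+

locale hopf_isomorphism =
  fixes H :: "('a::complex_vector, 'm) hopf_scheme" and H' :: "('a, 'n) hopf_scheme" and \<phi> :: "'a \<Rightarrow> 'a"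
  assumes source: "carrier_space H" and target: "carrier_space H'" and iso: "hopf_iso H H' \<phi>"
begin

sublocale H: carrier_space H by (rule source)
sublocale H': carrier_space H' by (rule target)

lemma iso_linear: "linear_on (carr H) \<phi>"
  and iso_bij: "bij_betw \<phi> (carr H) (carr H')"
  and iso_mul: "x \<in> carr H \<Longrightarrow> y \<in> carr H \<Longrightarrow> \<phi> (mul H x y) = mul H' (\<phi> x) (\<phi> y)"
  and iso_unity: "\<phi> (unity H) = unity H'"
  and iso_comul: "x \<in> carr H \<Longrightarrow> comul H' (\<phi> x) = lift2 H (\<lambda>a b. pure2 H' (\<phi> a) (\<phi> b)) (comul H x)"
  and iso_counit: "x \<in> carr H \<Longrightarrow> counit H' (\<phi> x) = counit H x"
  and iso_antipode: "x \<in> carr H \<Longrightarrow> \<phi> (antipode H x) = antipode H' (\<phi> x)"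
  using iso by (auto simp: hopf_iso_def)

lemma iso_closed: "x \<in> carr H \<Longrightarrow> \<phi> x \<in> carr H'"
  using iso_bij bij_betwE by blast

lemma iso_surj: "y \<in> carr H' \<Longrightarrow> \<exists>x\<in>carr H. y = \<phi> x"
  using bij_betw_imp_surj_on[OF iso_bij] by blast

text \<open>
  The map \<open>\<phi> \<otimes> \<phi>\<close>.
\<close>

definition push :: "'a tensor2 \<Rightarrow> 'a tensor2" where
  "push = lift2 H (\<lambda>a b. pure2 H' (\<phi> a) (\<phi> b))"

lemma bilinear_comp_iso: "bilinear_on (carr H') (carr H') F \<Longrightarrow> bilinear_on (carr H) (carr H) (\<lambda>a b. F (\<phi> a) (\<phi> b))"
  by (intro bilinear_onI) (rule H'.linear_on_bilinear[OF _ iso_linear iso_closed]; simp add: iso_closed)+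

lemma bilinear_pure: "bilinear_on (carr H') (carr H') (pure2 H')"
  by (intro bilinear_onI H'.linear_on_pure2_left H'.linear_on_pure2_right linear_on_id)

lemma push_linear: "linear_on (tensor2 H) push"
  unfolding push_def by (rule H.lift2_linear[OF bilinear_comp_iso[OF bilinear_pure]])

lemma push_pure: "a \<in> carr H \<Longrightarrow> b \<in> carr H \<Longrightarrow> push (pure2 H a b) = pure2 H' (\<phi> a) (\<phi> b)"
  unfolding push_def by (rule H.lift2_pure[OF bilinear_comp_iso[OF bilinear_pure]])

lemma lift2_push:
  assumes F: "bilinear_on (carr H') (carr H') F" and t: "t \<in> tensor2 H"
  shows "lift2 H' F (push t) = lift2 H (\<lambda>a b. F (\<phi> a) (\<phi> b)) t"
proof -
  have "lift2 H' F (push t) = lift2 H (\<lambda>a b. lift2 H' F (pure2 H' (\<phi> a) (\<phi> b))) t"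
    unfolding push_def
    by (rule H.linear_lift2[OF t bilinear_comp_iso[OF bilinear_pure] H'.subspace_tensor2 _ H'.lift2_linear[OF F]])
      (simp add: H'.pure2_in iso_closed)
  also have "\<dots> = lift2 H (\<lambda>a b. F (\<phi> a) (\<phi> b)) t"
    by (rule H.lift2_cong) (simp add: H'.lift2_pure[OF F] iso_closed)
  finally show ?thesis .
qed

lemma push_R: "g \<in> carr H \<Longrightarrow> unity H \<in> carr H \<Longrightarrow> push (R_elem H g) = R_elem H' (\<phi> g)"
  unfolding R_elem_def
  by (simp add: linear_on_scale[OF push_linear] linear_on_add[OF push_linear] linear_on_diff[OF push_linear]
      H.subspace_tensor2 H.tensor2_closed H.pure2_in push_pure iso_unity)

definition inverse :: "'a \<Rightarrow> 'a" where
  "inverse = inv_into (carr H) \<phi>"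

lemma inverse_iso: "x \<in> carr H \<Longrightarrow> inverse (\<phi> x) = x"
  and inverse_closed: "y \<in> carr H' \<Longrightarrow> inverse y \<in> carr H"
  unfolding inverse_def
  using bij_betw_inv_into_left[OF iso_bij] bij_betwE[OF bij_betw_inv_into[OF iso_bij]]
  by blast+

lemma inverse_linear: "linear_on (carr H') inverse"
proof (rule linear_onI)
  fix x y assume "x \<in> carr H'" "y \<in> carr H'"
  then obtain a b where ab: "a \<in> carr H" "b \<in> carr H" "x = \<phi> a" "y = \<phi> b" using iso_surj by metis
  have "inverse (\<phi> (a + b)) = a + b" using ab by (intro inverse_iso H.carr_closed)
  then show "inverse (x + y) = inverse x + inverse y"
    using ab by (simp add: linear_on_add[OF iso_linear] inverse_iso)
next
  fix c x assume "x \<in> carr H'"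
  then obtain a where a: "a \<in> carr H" "x = \<phi> a" using iso_surj by metis
  have "inverse (\<phi> (c *\<^sub>C a)) = c *\<^sub>C a" using a by (intro inverse_iso H.carr_closed)
  then show "inverse (c *\<^sub>C x) = c *\<^sub>C inverse x"
    using a by (simp add: linear_on_scale[OF iso_linear] inverse_iso)
qed

lemma pull_push:
  assumes t: "t \<in> tensor2 H"
  shows "lift2 H' (\<lambda>a b. pure2 H (inverse a) (inverse b)) (push t) = t"
proof -
  have b: "bilinear_on (carr H') (carr H') (\<lambda>a b. pure2 H (inverse a) (inverse b))"
    by (intro bilinear_onI H.linear_on_pure2_left H.linear_on_pure2_right inverse_linear inverse_closed)
  have "lift2 H' (\<lambda>a b. pure2 H (inverse a) (inverse b)) (push t) = lift2 H (pure2 H) t"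
    unfolding lift2_push[OF b t] by (rule H.lift2_cong) (simp add: inverse_iso)
  then show ?thesis by (simp add: H.lift2_pure_id t)
qed

lemma hopf_iso_inverse:
  assumes comul: "\<And>x. x \<in> carr H \<Longrightarrow> comul H x \<in> tensor2 H"
    and closed: "\<And>x y. x \<in> carr H \<Longrightarrow> y \<in> carr H \<Longrightarrow> mul H x y \<in> carr H" "unity H \<in> carr H"
      "\<And>x. x \<in> carr H \<Longrightarrow> antipode H x \<in> carr H"
  shows "hopf_iso H' H inverse"
  unfolding hopf_iso_def
proof (intro conjI ballI inverse_linear)
  show "bij_betw inverse (carr H') (carr H)"
    unfolding inverse_def by (rule bij_betw_inv_into[OF iso_bij])
  show "inverse (unity H') = unity H"
    using inverse_iso[OF closed(2)] by (simp add: iso_unity)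
  fix y assume "y \<in> carr H'"
  then obtain x where x: "x \<in> carr H" "y = \<phi> x" using iso_surj by metis
  show "comul H (inverse y) = lift2 H' (\<lambda>a b. pure2 H (inverse a) (inverse b)) (comul H' y)"
    using pull_push[OF comul[OF x(1)]] x by (simp add: inverse_iso iso_comul push_def)
  show "counit H (inverse y) = counit H' y" using x by (simp add: inverse_iso iso_counit)
  show "inverse (antipode H' y) = antipode H (inverse y)"
    using inverse_iso[OF closed(3)[OF x(1)]] x by (simp add: inverse_iso iso_antipode)
  fix z assume "z \<in> carr H'"
  then obtain w where w: "w \<in> carr H" "z = \<phi> w" using iso_surj by metis
  show "inverse (mul H' y z) = mul H (inverse y) (inverse z)"
    using inverse_iso[OF closed(1)[OF x(1) w(1)]] x w by (simp add: inverse_iso iso_mul)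
qed

lemma push_push:
  assumes "hopf_isomorphism H' H'' \<psi>" and t: "t \<in> tensor2 H"
  shows "lift2 H (\<lambda>a b. pure2 H'' (\<psi> (\<phi> a)) (\<psi> (\<phi> b))) t = lift2 H' (\<lambda>a b. pure2 H'' (\<psi> a) (\<psi> b)) (push t)"
proof -
  interpret psi: hopf_isomorphism H' H'' \<psi> by fact
  show ?thesis by (rule lift2_push[OF psi.bilinear_comp_iso[OF psi.bilinear_pure] t, symmetric])
qed

lemma hopf_iso_comp:
  assumes psi: "hopf_isomorphism H' H'' \<psi>" and comul: "\<And>x. x \<in> carr H \<Longrightarrow> comul H x \<in> tensor2 H"
    and closed: "\<And>x. x \<in> carr H \<Longrightarrow> antipode H x \<in> carr H"
  shows "hopf_iso H H'' (\<lambda>x. \<psi> (\<phi> x))"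
proof -
  interpret psi: hopf_isomorphism H' H'' \<psi> by (rule psi)
  show ?thesis
    unfolding hopf_iso_def
  proof (intro conjI ballI)
    show "linear_on (carr H) (\<lambda>x. \<psi> (\<phi> x))" by (rule linear_on_comp[OF psi.iso_linear iso_linear iso_closed])
    show "bij_betw (\<lambda>x. \<psi> (\<phi> x)) (carr H) (carr H'')"
      using bij_betw_trans[OF iso_bij psi.iso_bij] by (simp add: comp_def)
    fix x assume x: "x \<in> carr H"
    show "comul H'' (\<psi> (\<phi> x)) = lift2 H (\<lambda>a b. pure2 H'' (\<psi> (\<phi> a)) (\<psi> (\<phi> b))) (comul H x)"
      using x by (simp add: psi.iso_comul iso_closed iso_comul push_push[OF psi comul] push_def)
  qed (simp_all add: iso_mul psi.iso_mul iso_closed iso_unity psi.iso_unity iso_counit psi.iso_counit iso_antipode psi.iso_antipode)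
qed

end

lemma hopf_iso_id:
  assumes "carrier_space H" and c: "carr H' = carr H" "mul H' = mul H" "unity H' = unity H" "counit H' = counit H"
    and D: "\<And>x. x \<in> carr H \<Longrightarrow> comul H' x = comul H x" "\<And>x. x \<in> carr H \<Longrightarrow> comul H x \<in> tensor2 H"
    and S: "\<And>x. x \<in> carr H \<Longrightarrow> antipode H' x = antipode H x"
  shows "hopf_iso H H' (\<lambda>x. x)"
proof -
  interpret carrier_space H by fact
  show ?thesis
    using bij_betw_id[of "carr H"]
    by (simp add: hopf_iso_def c linear_on_id D S tensor_cong[OF c(1)] lift2_pure_id id_def)
qed

context hopf_isomorphism
begin

text \<open>
  Gradings, homogeneous components and twists are given by formulas in the structure maps and \<open>g\<close>,
  so an isomorphism that matches the involutions matches them too.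
\<close>

lemma twist_iso:
  assumes g: "parity_hopf H g s" and g': "parity_hopf H' (\<phi> g) s"
  shows "\<And>p. \<phi> ` adjoint_grading H g p = adjoint_grading H' (\<phi> g) p"
    and "\<And>p x. x \<in> carr H \<Longrightarrow> \<phi> (hcomp (adjoint_grading H g) p x) = hcomp (adjoint_grading H' (\<phi> g)) p (\<phi> x)"
    and "is_twist H g T \<Longrightarrow> is_twist H' (\<phi> g) T' \<Longrightarrow> hopf_iso T T' \<phi>"
proof -
  interpret A: parity_hopf H g s by (rule g)
  interpret B: parity_hopf H' "\<phi> g" s by (rule g')
  show hc: "\<phi> (hcomp A.P p x) = hcomp B.P p (\<phi> x)" if "x \<in> carr H" for p x
    using that by (simp add: A.hcomp_eq B.hcomp_eq iso_closed linear_on_scale[OF iso_linear] linear_on_add[OF iso_linear]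
        A.closures iso_mul)
  show "\<phi> ` A.P p = B.P p" for p
  proof (intro equalityI subsetI)
    fix y assume "y \<in> \<phi> ` A.P p"
    then obtain x where x: "x \<in> A.P p" "y = \<phi> x" by blast
    then have "\<phi> x = hcomp B.P p (\<phi> x)" using hc[of x p] A.hcomp_homogeneous[of x p p] A.grading_closed[of x p] by simp
    also have "\<dots> \<in> B.P p" using x by (intro B.hcomp_in_grading iso_closed A.grading_closed)
    finally show "y \<in> B.P p" by (simp add: x(2))
  next
    fix y assume y: "y \<in> B.P p"
    then obtain x where x: "x \<in> carr H" "y = \<phi> x" using iso_surj B.grading_closed by metis
    then have "y = \<phi> (hcomp A.P p x)" using hc[of x p] B.hcomp_homogeneous[OF y, of p] by simp
    then show "y \<in> \<phi> ` A.P p" using A.hcomp_in_grading[OF x(1)] by blast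
  qed
  have gp: "\<phi> (A.gpow q) = B.gpow q" for q by (simp add: A.gpow_def B.gpow_def iso_unity)
  assume T: "is_twist H g T" and T': "is_twist H' (\<phi> g) T'"
  then have c: "carr T = carr H" "mul T = mul H" "unity T = unity H" "counit T = counit H" "comul T = A.Dt" "antipode T = A.St"
    and c': "carr T' = carr H'" "mul T' = mul H'" "unity T' = unity H'" "counit T' = counit H'" "comul T' = B.Dt" "antipode T' = B.St"
    by (simp_all add: is_twist_def)
  show "hopf_iso T T' \<phi>"
    unfolding hopf_iso_def c c' tensor_cong[OF c(1)] tensor_cong[OF c'(1)]
  proof (intro conjI ballI iso_linear iso_bij iso_mul iso_unity iso_counit)
    fix x assume x: "x \<in> carr H"
    have "B.Dt (\<phi> x) = lift2 H' (\<lambda>a b. \<Sum>q\<in>UNIV. pure2 H' (mul H' a (B.gpow q)) (hcomp B.P q b)) (push (comul H x))"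
      using x by (simp add: B.twisted_comul_eq iso_closed iso_comul push_def B.tau_def)
    also have "\<dots> = lift2 H (\<lambda>a b. \<Sum>q\<in>UNIV. pure2 H' (mul H' (\<phi> a) (B.gpow q)) (hcomp B.P q (\<phi> b))) (comul H x)"
      by (rule lift2_push[OF B.bilinear_tau[OF B.bilinear_pure2] A.comul_closed[OF x]])
    also have "\<dots> = lift2 H (\<lambda>a b. \<Sum>q\<in>UNIV. pure2 H' (\<phi> (mul H a (A.gpow q))) (\<phi> (hcomp A.P q b))) (comul H x)"
      by (rule H.lift2_cong) (simp add: hc iso_mul A.gpow_closed gp)
    also have "\<dots> = lift2 H (\<lambda>a b. pure2 H' (\<phi> a) (\<phi> b)) (A.Dt x)"
      by (rule A.lift2_twisted_comul[OF bilinear_comp_iso[OF bilinear_pure] x, symmetric])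
    finally show "B.Dt (\<phi> x) = lift2 H (\<lambda>a b. pure2 H' (\<phi> a) (\<phi> b)) (A.Dt x)" .
    show "\<phi> (A.St x) = B.St (\<phi> x)"
      using x unfolding A.twisted_antipode_eq B.twisted_antipode_eq
      by (simp add: linear_on_sum[OF iso_linear H.subspace_carr] A.hopf_closures iso_mul gp iso_antipode hc)
  qed
qed

end

lemma triangular_objects_hopf: "(H, R) \<in> triangular_objects \<Longrightarrow> hopf_in (flip H) H \<and> R \<in> tensor2 H"
  by (simp add: triangular_objects_def triangular_hopf_algebra_def triangular_in_def quasitriangular_in_def Let_def)

lemma super_objects_hopf: "(K, R, g) \<in> super_objects \<Longrightarrow> hopf_in (superflip K) K \<and> R \<in> tensor2 K \<and> g \<in> carr K
     \<and> (\<forall>p. part K p \<subseteq> carr K)"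
proof -
  assume *: "(K, R, g) \<in> super_objects"
  then have K: "hopf_superalgebra K" "parity_element K g" and R: "triangular_in (superflip K) K R"
    by (simp_all add: super_objects_def triangular_hopf_superalgebra_def)
  have "part K p \<subseteq> carr K" for p
    unfolding parity_element_grading(2)[OF K] by (auto simp: adjoint_grading_def)
  moreover have "g \<in> carr K" using K(2) by (simp add: parity_element_def grouplike_def)
  moreover have "hopf_in (superflip K) K" using K(1) unfolding hopf_superalgebra_def by blast
  moreover have "R \<in> tensor2 K" using R unfolding triangular_in_def quasitriangular_in_def Let_def by blast
  ultimately show ?thesis by blast
qed

lemma hopf_isomorphismI: "hopf_in c H \<Longrightarrow> hopf_in c' H' \<Longrightarrow> hopf_iso H H' \<phi> \<Longrightarrow> hopf_isomorphism H H' \<phi>"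
  by (simp add: hopf_isomorphism_def hopf_in_closed(1))

lemma triangular_isoE:
  assumes "((H, R), (H', R')) \<in> triangular_iso"
  obtains \<phi> where "hopf_isomorphism H H' \<phi>" "R' = lift2 H (\<lambda>x y. pure2 H' (\<phi> x) (\<phi> y)) R"
    "(H, R) \<in> triangular_objects" "(H', R') \<in> triangular_objects"
proof -
  obtain \<phi> where \<phi>: "hopf_iso H H' \<phi>" "R' = lift2 H (\<lambda>x y. pure2 H' (\<phi> x) (\<phi> y)) R"
    and o: "(H, R) \<in> triangular_objects" "(H', R') \<in> triangular_objects"
    using assms unfolding triangular_iso_def by blast
  have "hopf_isomorphism H H' \<phi>"
    using o[THEN triangular_objects_hopf] \<phi>(1) by (blast intro: hopf_isomorphismI)
  then show ?thesis using that \<phi>(2) o by blast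
qed

lemma super_isoE:
  assumes "((K, R, g), (K', R', g')) \<in> super_iso"
  obtains \<phi> where "hopf_isomorphism K K' \<phi>" "R' = lift2 K (\<lambda>x y. pure2 K' (\<phi> x) (\<phi> y)) R"
    "(K, R, g) \<in> super_objects" "(K', R', g') \<in> super_objects" "\<forall>p. \<phi> ` part K p = part K' p" "\<phi> g = g'"
proof -
  obtain \<phi> where \<phi>: "hopf_iso K K' \<phi>" "R' = lift2 K (\<lambda>x y. pure2 K' (\<phi> x) (\<phi> y)) R"
      "\<forall>p. \<phi> ` part K p = part K' p" "\<phi> g = g'"
    and o: "(K, R, g) \<in> super_objects" "(K', R', g') \<in> super_objects"
    using assms unfolding super_iso_def by blast
  have "hopf_isomorphism K K' \<phi>"
    using o[THEN super_objects_hopf] \<phi>(1) by (blast intro: hopf_isomorphismI)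
  then show ?thesis using that \<phi>(2-4) o by blast
qed

lemma sym_triangular_iso: "sym triangular_iso"
proof (rule symI, clarify)
  fix H R H' R' assume "((H, R), (H' :: 'a hopf, R')) \<in> triangular_iso"
  then obtain \<phi> where \<phi>: "hopf_isomorphism H H' \<phi>" "R' = lift2 H (\<lambda>x y. pure2 H' (\<phi> x) (\<phi> y)) R"
    and o: "(H, R) \<in> triangular_objects" "(H', R') \<in> triangular_objects" by (rule triangular_isoE)
  interpret hopf_isomorphism H H' \<phi> by fact
  have h: "hopf_in (flip H) H" and R: "R \<in> tensor2 H" using triangular_objects_hopf[OF o(1)] by auto
  have "hopf_iso H' H inverse" by (rule hopf_iso_inverse) (simp_all add: hopf_in_closed[OF h])
  moreover have "R = lift2 H' (\<lambda>x y. pure2 H (inverse x) (inverse y)) R'"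
    using pull_push[OF R] by (simp add: push_def \<phi>(2))
  ultimately show "((H', R'), (H, R)) \<in> triangular_iso" using o by (auto simp: triangular_iso_def)
qed

lemma trans_triangular_iso: "trans triangular_iso"
proof (rule transI, clarify)
  fix H R H' R' H'' R'' assume 1: "((H, R), (H' :: 'a hopf, R')) \<in> triangular_iso" and 2: "((H', R'), (H'', R'')) \<in> triangular_iso"
  obtain \<phi> where \<phi>: "hopf_isomorphism H H' \<phi>" "R' = lift2 H (\<lambda>x y. pure2 H' (\<phi> x) (\<phi> y)) R"
    and o: "(H, R) \<in> triangular_objects" using 1 by (rule triangular_isoE)
  obtain \<psi> where \<psi>: "hopf_isomorphism H' H'' \<psi>" "R'' = lift2 H' (\<lambda>x y. pure2 H'' (\<psi> x) (\<psi> y)) R'"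
    and o'': "(H'', R'') \<in> triangular_objects" using 2 by (rule triangular_isoE)
  interpret hopf_isomorphism H H' \<phi> by fact
  have h: "hopf_in (flip H) H" and R: "R \<in> tensor2 H" using triangular_objects_hopf[OF o(1)] by auto
  have "hopf_iso H H'' (\<lambda>x. \<psi> (\<phi> x))" by (rule hopf_iso_comp[OF \<psi>(1)]) (simp_all add: hopf_in_closed[OF h])
  moreover have "R'' = lift2 H (\<lambda>x y. pure2 H'' (\<psi> (\<phi> x)) (\<psi> (\<phi> y))) R"
    by (simp add: push_push[OF \<psi>(1) R] push_def \<phi>(2) \<psi>(2))
  ultimately show "((H, R), (H'', R'')) \<in> triangular_iso"
    using o o'' unfolding triangular_iso_def by (auto intro!: exI[of _ "\<lambda>x. \<psi> (\<phi> x)"])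
qed

lemma sym_super_iso: "sym super_iso"
proof (rule symI, clarify)
  fix H R g H' R' g' assume "((H, R, g), (H' :: 'a hopf_super, R', g')) \<in> super_iso"
  then obtain \<phi> where \<phi>: "hopf_isomorphism H H' \<phi>" "R' = lift2 H (\<lambda>x y. pure2 H' (\<phi> x) (\<phi> y)) R"
    and o: "(H, R, g) \<in> super_objects" "(H', R', g') \<in> super_objects" and p: "\<forall>p. \<phi> ` part H p = part H' p" "\<phi> g = g'"
    by (rule super_isoE)
  interpret hopf_isomorphism H H' \<phi> by fact
  have h: "hopf_in (superflip H) H" and R: "R \<in> tensor2 H" and g: "g \<in> carr H" and part: "\<And>p. part H p \<subseteq> carr H"
    using super_objects_hopf[OF o(1)] by auto
  have "hopf_iso H' H inverse" by (rule hopf_iso_inverse) (simp_all add: hopf_in_closed[OF h])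
  moreover have "R = lift2 H' (\<lambda>x y. pure2 H (inverse x) (inverse y)) R'"
    using pull_push[OF R] by (simp add: push_def \<phi>(2))
  moreover have "inverse ` part H' q = part H q" for q
  proof -
    have "inverse ` \<phi> ` part H q = (\<lambda>x. x) ` part H q"
      unfolding image_image using part[of q] by (intro image_cong refl inverse_iso) blast
    then show ?thesis by (simp add: p)
  qed
  moreover have "inverse g' = g" using inverse_iso[OF g] by (simp add: p)
  ultimately show "((H', R', g'), (H, R, g)) \<in> super_iso" using o by (auto simp: super_iso_def)
qed

lemma trans_super_iso: "trans super_iso"
proof (rule transI, clarify)
  fix H R g H' R' g' H'' R'' g''
  assume 1: "((H, R, g), (H' :: 'a hopf_super, R', g')) \<in> super_iso" and 2: "((H', R', g'), (H'', R'', g'')) \<in> super_iso"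
  obtain \<phi> where \<phi>: "hopf_isomorphism H H' \<phi>" "R' = lift2 H (\<lambda>x y. pure2 H' (\<phi> x) (\<phi> y)) R"
    and o: "(H, R, g) \<in> super_objects" and p: "\<forall>p. \<phi> ` part H p = part H' p" "\<phi> g = g'" using 1 by (rule super_isoE)
  obtain \<psi> where \<psi>: "hopf_isomorphism H' H'' \<psi>" "R'' = lift2 H' (\<lambda>x y. pure2 H'' (\<psi> x) (\<psi> y)) R'"
    and o'': "(H'', R'', g'') \<in> super_objects" and p': "\<forall>p. \<psi> ` part H' p = part H'' p" "\<psi> g' = g''" using 2 by (rule super_isoE)
  interpret hopf_isomorphism H H' \<phi> by fact
  have h: "hopf_in (superflip H) H" and R: "R \<in> tensor2 H" using super_objects_hopf[OF o] by auto
  have "hopf_iso H H'' (\<lambda>x. \<psi> (\<phi> x))" by (rule hopf_iso_comp[OF \<psi>(1)]) (simp_all add: hopf_in_closed[OF h])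
  moreover have "R'' = lift2 H (\<lambda>x y. pure2 H'' (\<psi> (\<phi> x)) (\<psi> (\<phi> y))) R"
    by (simp add: push_push[OF \<psi>(1) R] push_def \<phi>(2) \<psi>(2))
  moreover have "(\<lambda>x. \<psi> (\<phi> x)) ` part H q = part H'' q" for q
    using p(1) p'(1) by (metis image_image)
  ultimately show "((H, R, g), (H'', R'', g'')) \<in> super_iso"
    using o o'' p p' unfolding super_iso_def by (auto intro!: exI[of _ "\<lambda>x. \<psi> (\<phi> x)"])
qed

lemma superize_iso:
  assumes "((H, R), (H', R')) \<in> triangular_iso" and HR: "(H, R) \<in> rank_le_two_objects"
  shows "(superize (H, R), superize (H', R')) \<in> super_iso"
proof -
  obtain \<phi> where \<phi>: "hopf_isomorphism H H' \<phi>" "R' = lift2 H (\<lambda>x y. pure2 H' (\<phi> x) (\<phi> y)) R"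
    and o': "(H', R') \<in> triangular_objects" using assms(1) by (rule triangular_isoE)
  obtain u where u: "pointed_hopf H u" "R = R_elem H u" using HR rank_le_two_iff by blast
  interpret hopf_isomorphism H H' \<phi> by fact
  interpret A: pointed_hopf H u by (rule u)
  have uV: "\<phi> u \<in> carr H'" using A.g_closed by (rule iso_closed)
  have t': "triangular_hopf_algebra H' R'" using o' by (simp add: triangular_objects_def)
  have "grouplike H' (\<phi> u)"
  proof -
    have "\<phi> u \<noteq> 0"
      using inverse_iso[OF A.g_closed] linear_on_zero[OF inverse_linear H'.subspace_carr] A.g_nonzero by auto
    then show ?thesis
      using push_pure[OF A.g_closed A.g_closed] by (simp add: grouplike_def uV iso_comul A.g_closed A.comul_g push_def)
  qed
  moreover have "mul H' (\<phi> u) (\<phi> u) = unity H'"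
    using iso_mul[OF A.g_closed A.g_closed] by (simp add: A.g_square iso_unity)
  ultimately have u': "pointed_hopf H' (\<phi> u)"
    using t' by (intro pointed_hopfI) (simp_all add: triangular_hopf_algebra_def)
  then interpret B: pointed_hopf H' "\<phi> u" .
  have R': "R' = R_elem H' (\<phi> u)"
    using push_R[OF A.g_closed A.unity_closed] by (simp add: push_def \<phi>(2) u(2))
  then have HR': "(H', R') \<in> rank_le_two_objects" using u' t' rank_le_two_iff by blast
  note tw = twist_iso[OF A.parity_hopf_axioms B.parity_hopf_axioms]
  have s: "superize (H, R) \<in> super_objects" "superize (H', R') \<in> super_objects"
    using superize_object HR HR' cocommutative_objects_triangular by blast+
  have "hopf_iso (twist_super H u) (twist_super H' (\<phi> u)) \<phi>"
    by (rule tw(3)[OF is_twist_super is_twist_super])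
  moreover have c: "carr (twist_super H u) = carr H" "carr (twist_super H' (\<phi> u)) = carr H'"
    "part (twist_super H u) = adjoint_grading H u" "part (twist_super H' (\<phi> u)) = adjoint_grading H' (\<phi> u)"
    by (simp_all add: twist_super_def)
  moreover have "lift2 H (\<lambda>x y. pure2 H' (\<phi> x) (\<phi> y)) (pure2 H A.e A.e) = pure2 H' B.e B.e"
    using push_pure[OF A.unity_closed A.unity_closed] by (simp add: push_def iso_unity)
  moreover have "\<forall>p. \<phi> ` part (twist_super H u) p = part (twist_super H' (\<phi> u)) p"
    by (simp add: twist_super_def tw(1))
  ultimately show ?thesis
    using s unfolding u(2) R' superize_R_elem[OF u(1)] superize_R_elem[OF u']
    by (simp add: super_iso_def tensor_cong[OF c(1)] tensor_cong[OF c(2)] del: split_paired_Ex) (rule exI[of _ \<phi>], simp)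
qed

lemma cocommutative_iso:
  assumes \<phi>: "hopf_isomorphism K K' \<phi>" and K: "parity_hopf K g (-1)" "part K = adjoint_grading K g"
    and K': "parity_hopf K' (\<phi> g) (-1)" "part K' = adjoint_grading K' (\<phi> g)" and coc: "cocommutative_super K"
  shows "cocommutative_super K'"
  unfolding cocommutative_super_def
proof
  interpret hopf_isomorphism K K' \<phi> by fact
  interpret A: parity_hopf K g "-1" by (rule K)
  interpret B: parity_hopf K' "\<phi> g" "-1" by (rule K')
  have sf: "superflip K = A.braid (-1)" "superflip K' = B.braid (-1)"
    using superflip_eq_braid A.involutive_algebra_axioms B.involutive_algebra_axioms K(2) K'(2) by blast+
  fix y assume "y \<in> carr K'"
  then obtain x where x: "x \<in> carr K" "y = \<phi> x" using iso_surj by metis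
  have "lift2 K' (B.braid (-1)) (push (comul K x)) = lift2 K (\<lambda>a b. B.braid (-1) (\<phi> a) (\<phi> b)) (comul K x)"
    by (rule lift2_push[OF B.bilinear_braid A.comul_closed[OF x(1)]])
  also have "\<dots> = lift2 K (\<lambda>a b. push (A.braid (-1) a b)) (comul K x)"
    by (rule H.lift2_cong)
      (simp add: A.braid_def B.braid_def linear_on_sum[OF push_linear H.subspace_tensor2] linear_on_scale[OF push_linear]
        A.closures push_pure twist_iso(2)[OF A.parity_hopf_axioms B.parity_hopf_axioms])
  also have "\<dots> = push (lift2 K (A.braid (-1)) (comul K x))"
    by (rule H.linear_lift2[OF A.comul_closed[OF x(1)] A.bilinear_braid H.subspace_tensor2 A.braid_closed push_linear, symmetric])
  also have "\<dots> = push (comul K x)" using coc x by (simp add: cocommutative_super_def sf)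
  finally show "lift2 K' (superflip K') (comul K' y) = comul K' y"
    using x by (simp add: sf iso_comul push_def)
qed

lemma unsuperize_iso:
  assumes "((K, R, g), (K', R', g')) \<in> super_iso" and KRg: "(K, R, g) \<in> cocommutative_objects"
  shows "(unsuperize (K, R, g), unsuperize (K', R', g')) \<in> triangular_iso"
proof -
  obtain \<phi> where \<phi>: "hopf_isomorphism K K' \<phi>" "R' = lift2 K (\<lambda>x y. pure2 K' (\<phi> x) (\<phi> y)) R"
    and o': "(K', R', g') \<in> super_objects" and g': "\<phi> g = g'" using assms(1) by (rule super_isoE)
  interpret hopf_isomorphism K K' \<phi> by fact
  have K: "parity_hopf K g (-1)" and part: "part K = adjoint_grading K g" and coc: "cocommutative_super K"
    and R: "R = pure2 K (unity K) (unity K)" using KRg by (simp_all add: cocommutative_iff)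
  have K': "parity_hopf K' (\<phi> g) (-1)" and part': "part K' = adjoint_grading K' (\<phi> g)"
    using parity_element_grading[of K' g'] o' by (simp_all add: super_objects_def triangular_hopf_superalgebra_def g')
  interpret A: parity_hopf K g "-1" by (rule K)
  interpret B: parity_hopf K' "\<phi> g" "-1" by (rule K')
  have "R' = pure2 K' B.e B.e"
    using push_pure[OF A.unity_closed A.unity_closed] by (simp add: push_def iso_unity \<phi>(2) R)
  moreover have "cocommutative_super K'" by (rule cocommutative_iso[OF \<phi>(1) K part K' part' coc])
  ultimately have KRg': "(K', R', \<phi> g) \<in> cocommutative_objects" using K' part' by (simp add: cocommutative_iff)
  let ?H = "twist K (part K) g" and ?H' = "twist K' (part K') (\<phi> g)"
  have c: "carr ?H = carr K" "mul ?H = mul K" "unity ?H = unity K" and c': "carr ?H' = carr K'" "mul ?H' = mul K'" "unity ?H' = unity K'"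
    by (simp_all add: twist_simps)
  have "hopf_iso ?H ?H' \<phi>"
    unfolding part part' by (rule twist_iso(3)[OF K K' is_twist_twist is_twist_twist])
  moreover have "R_elem ?H' (\<phi> g) = lift2 ?H (\<lambda>x y. pure2 ?H' (\<phi> x) (\<phi> y)) (R_elem ?H g)"
    using push_R[OF A.g_closed A.unity_closed]
    by (simp add: A.cong_algebra(4)[OF c] B.cong_algebra(4)[OF c'] tensor_cong[OF c(1)] tensor_cong[OF c'(1)] push_def)
  moreover have "(?H, R_elem ?H g) \<in> triangular_objects" "(?H', R_elem ?H' (\<phi> g)) \<in> triangular_objects"
    using unsuperize_object[OF KRg] unsuperize_object[OF KRg'] rank_le_two_objects_triangular by auto
  ultimately show ?thesis
    unfolding g'[symmetric] unsuperize_object(1)[OF KRg] unsuperize_object(1)[OF KRg']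
    by (auto simp: triangular_iso_def)
qed

lemma unsuperize_superize:
  assumes "(H, R) \<in> rank_le_two_objects"
  shows "((H, R), unsuperize (superize (H, R))) \<in> triangular_iso"
proof -
  obtain u where u: "pointed_hopf H u" "R = R_elem H u" using assms rank_le_two_iff by blast
  interpret pointed_hopf H u by (rule u)
  let ?K = "twist_super H u"
  let ?H = "twist ?K (part ?K) u"
  have s: "superize (H, R) = (?K, pure2 H e e, u)" unfolding u(2) by (rule superize_R_elem[OF u(1)])
  have K: "(?K, pure2 H e e, u) \<in> cocommutative_objects" using superize_object[OF assms] by (simp add: s)
  have c: "carr ?H = carr H" "mul ?H = mul H" "unity ?H = unity H" "counit ?H = counit H"
    by (simp_all add: twist_simps twist_super_def)
  have "hopf_iso H ?H (\<lambda>x. x)"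
    by (rule hopf_iso_id[OF carrier_space_axioms c])
      (simp_all add: twist_simps part_twist_super twist_twist[OF is_twist_super] comul_closed)
  moreover have "(?H, R_elem ?H u) \<in> triangular_objects" "(H, R) \<in> triangular_objects"
    using unsuperize_object[OF K] rank_le_two_objects_triangular assms by auto
  moreover have "R_elem ?H u = lift2 H (\<lambda>x y. pure2 ?H x y) R"
    by (simp add: cong_algebra(4)[OF c(1-3)] tensor_cong[OF c(1)] lift2_pure_id R_closed u(2))
  ultimately show ?thesis
    unfolding s unsuperize_object(1)[OF K] by (auto simp: triangular_iso_def)
qed

lemma superize_unsuperize:
  assumes "(K, R, g) \<in> cocommutative_objects"
  shows "((K, R, g), superize (unsuperize (K, R, g))) \<in> super_iso"
proof -
  have K: "parity_hopf K g (-1)" and part: "part K = adjoint_grading K g"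
    and R: "R = pure2 K (unity K) (unity K)" using assms by (simp_all add: cocommutative_iff)
  interpret parity_hopf K g "-1" by (rule K)
  let ?H = "twist K (part K) g"
  let ?K = "twist_super ?H g"
  note H = unsuperize_object[OF assms]
  have s: "superize (unsuperize (K, R, g)) = (?K, pure2 ?H (unity ?H) (unity ?H), g)"
    unfolding H(1) by (rule superize_R_elem[OF H(2)])
  have c: "carr ?H = carr K" "mul ?H = mul K" "unity ?H = unity K" by (simp_all add: twist_simps)
  have c': "carr ?K = carr K" "mul ?K = mul K" "unity ?K = unity K" "counit ?K = counit K"
    by (simp_all add: twist_simps twist_super_def)
  have t: "is_twist K g ?H" unfolding part by (rule is_twist_twist)
  have "hopf_iso K ?K (\<lambda>x. x)"
    by (rule hopf_iso_id[OF carrier_space_axioms c'])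
      (simp_all add: twist_super_def twist_twist[OF t] comul_closed)
  moreover have "(K, R, g) \<in> super_objects" "(?K, pure2 ?H (unity ?H) (unity ?H), g) \<in> super_objects"
    using assms cocommutative_objects_triangular superize_object[of "fst (unsuperize (K, R, g))" "snd (unsuperize (K, R, g))"] H(3) s by auto
  moreover have "part ?K = part K"
    using adjoint_grading_cong[OF c, of g] by (simp add: twist_super_def part)
  moreover have "pure2 ?H (unity ?H) (unity ?H) = lift2 K (\<lambda>x y. pure2 ?K x y) R"
    by (simp add: R tensor_cong[OF c(1)] tensor_cong[OF c'(1)] c lift2_pure_id closures)
  ultimately show ?thesis
    unfolding s by (auto simp: super_iso_def intro!: exI[of _ "\<lambda>x. x"])
qed

section \<open>The correspondence of isomorphism classes\<close>

lemma class_map_class: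
  assumes s: "sym s" "trans s" and x: "(x, x) \<in> r" and f: "\<And>x'. (x, x') \<in> r \<Longrightarrow> (f x, f x') \<in> s"
  shows "class_map s f (r `` {x}) = s `` {f x}"
proof -
  have "s `` {f x'} = s `` {f x}" if "(x, x') \<in> r" for x'
    using f[OF that] s by (auto dest: symD transD)
  then show ?thesis using x unfolding class_map_def by blast
qed

text \<open>
  The class of \<open>f x\<close> depends only on the class of \<open>x\<close>, so on classes \<open>f\<close> can be computed with any
  representative, and the two round trips return to the class where they started.
\<close>

lemma class_map_bij:
  assumes r: "sym r" "trans r" and s: "sym s" "trans s"
    and X: "\<And>x. x \<in> X \<Longrightarrow> f x \<in> Y \<and> (x, g (f x)) \<in> r" and Y: "\<And>y. y \<in> Y \<Longrightarrow> g y \<in> X \<and> (y, f (g y)) \<in> s"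
    and f: "\<And>x x'. (x, x') \<in> r \<Longrightarrow> x \<in> X \<Longrightarrow> (f x, f x') \<in> s"
    and g: "\<And>y y'. (y, y') \<in> s \<Longrightarrow> y \<in> Y \<Longrightarrow> (g y, g y') \<in> r"
  shows "bij_betw (class_map s f) (X // r) (Y // s)
    \<and> (\<forall>C\<in>X // r. class_map r g (class_map s f C) = C) \<and> (\<forall>C\<in>Y // s. class_map s f (class_map r g C) = C)"
proof -
  have x: "(x, x) \<in> r" if "x \<in> X" for x using X[OF that] r by (meson symD transD)
  have y: "(y, y) \<in> s" if "y \<in> Y" for y using Y[OF that] s by (meson symD transD)
  have F: "class_map s f (r `` {x}) = s `` {f x}" if "x \<in> X" for x
    using that by (intro class_map_class s x f)
  have G: "class_map r g (s `` {y}) = r `` {g y}" if "y \<in> Y" for y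
    using that by (intro class_map_class r y g)
  have gf: "r `` {g (f x)} = r `` {x}" if "x \<in> X" for x using X[OF that] r by (auto dest: symD transD)
  have fg: "s `` {f (g y)} = s `` {y}" if "y \<in> Y" for y using Y[OF that] s by (auto dest: symD transD)
  have GF: "\<forall>C\<in>X // r. class_map r g (class_map s f C) = C"
    using X by (auto simp: quotient_def F G gf)
  have FG: "\<forall>C\<in>Y // s. class_map s f (class_map r g C) = C"
    using Y by (auto simp: quotient_def F G fg)
  have "class_map s f ` (X // r) \<subseteq> Y // s" using X F by (fastforce simp: quotient_def)
  moreover have "class_map r g ` (Y // s) \<subseteq> X // r" using Y G by (fastforce simp: quotient_def)
  ultimately show ?thesis using bij_betw_byWitness[OF GF FG] GF FG by blast
qed

theorem corollary3p3p3:
  "rank_le_two_objects \<subseteq> (triangular_objects :: ('a::complex_vector hopf \<times> 'a tensor2) set)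
    \<and> cocommutative_objects \<subseteq> (super_objects :: ('a hopf_super \<times> 'a tensor2 \<times> 'a) set)
    \<and> bij_betw (superize_class :: _ \<Rightarrow> ('a hopf_super \<times> 'a tensor2 \<times> 'a) set)
        (rank_le_two_objects // triangular_iso) (cocommutative_objects // super_iso)
    \<and> (\<forall>X \<in> (rank_le_two_objects :: ('a hopf \<times> 'a tensor2) set) // triangular_iso.
          unsuperize_class (superize_class X) = X)
    \<and> (\<forall>Y \<in> (cocommutative_objects :: ('a hopf_super \<times> 'a tensor2 \<times> 'a) set) // super_iso.
          superize_class (unsuperize_class Y) = Y)"
proof -
  have "bij_betw (class_map super_iso superize) ((rank_le_two_objects :: ('a hopf \<times> 'a tensor2) set) // triangular_iso)
      (cocommutative_objects // super_iso)
    \<and> (\<forall>X \<in> (rank_le_two_objects :: ('a hopf \<times> 'a tensor2) set) // triangular_iso.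
          class_map triangular_iso unsuperize (class_map super_iso superize X) = X)
    \<and> (\<forall>Y \<in> (cocommutative_objects :: ('a hopf_super \<times> 'a tensor2 \<times> 'a) set) // super_iso.
          class_map super_iso superize (class_map triangular_iso unsuperize Y) = Y)"
  proof (rule class_map_bij[OF sym_triangular_iso trans_triangular_iso sym_super_iso trans_super_iso])
    show "superize x \<in> cocommutative_objects \<and> (x, unsuperize (superize x)) \<in> triangular_iso"
      if "x \<in> rank_le_two_objects" for x :: "'a hopf \<times> 'a tensor2"
      using that by (cases x) (simp add: superize_object unsuperize_superize)
    show "unsuperize y \<in> rank_le_two_objects \<and> (y, superize (unsuperize y)) \<in> super_iso"
      if "y \<in> cocommutative_objects" for y :: "'a hopf_super \<times> 'a tensor2 \<times> 'a"
      using that by (cases y) (simp add: unsuperize_object(3) superize_unsuperize)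
    show "(superize x, superize x') \<in> super_iso" if "(x, x') \<in> triangular_iso" "x \<in> rank_le_two_objects"
      for x x' :: "'a hopf \<times> 'a tensor2"
      using that by (cases x, cases x') (simp add: superize_iso)
    show "(unsuperize y, unsuperize y') \<in> triangular_iso" if "(y, y') \<in> super_iso" "y \<in> cocommutative_objects"
      for y y' :: "'a hopf_super \<times> 'a tensor2 \<times> 'a"
      using that by (cases y, cases y') (simp add: unsuperize_iso)
  qed
  then show ?thesis
    unfolding superize_class_def unsuperize_class_def
    using rank_le_two_objects_triangular cocommutative_objects_triangular by blast
qed

end
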